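(* Let $\{Z_{ij}\}_{i,j=1}^{\infty}$ be a family of independent and identically distributed real-valued random variables with $\mathbf E Z_{11}=0$, $\mathbf E Z_{11}^2=1$ and $\mathbf E|Z_{11}|^k<\infty$ for all $k=1,2,3,\dots$. For each $N$ let $X_N$ be the symmetric $N\times N$ matrix with entries $X_N(i,j)=X_N(j,i)=Z_{ij}$ for $i\le j$, and let $\hat X_N$ be the $(N-1)\times(N-1)$ matrix obtained from $X_N$ by removing the $N$th row and column. Let $w_N^X:\mathbb R\to\mathbb R$ be the (random) rectangular Young diagram $w^{\{x_i\},\{y_j\}}$ constructed from the eigenvalues $\{x_i\}_{i=1}^{N}$ of $X_N$ and the eigenvalues $\{y_j\}_{j=1}^{N-1}$ of $\hat X_N$. Let $$\Omega(x)=\begin{cases}\dfrac{2}{\pi}\left(x\arcsin\left(\frac{x}{2}\right)+\sqrt{4-x^2}\right), & |x|\le 2,\\ |x|, & |x|\ge 2.\end{cases}$$ Then $$\lim_{N\to\infty}\ \sup_{x\in\mathbb R}\left|\frac{1}{\sqrt N}\,w_N^X(x\sqrt N)-\Omega(x)\right|=0\qquad\text{in probability.}$$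
   Context: Two real sequences $\{x_i\}_{i=1}^n$, $\{y_j\}_{j=1}^{n-1}$ interlace if $x_1\ge y_1\ge x_2\ge\dots\ge x_{n-1}\ge y_{n-1}\ge x_n$. The eigenvalues (listed in decreasing order with multiplicity) of a real symmetric $n\times n$ matrix and of its submatrix obtained by deleting the last row and column interlace. Put $z_0=\sum_{i=1}^n x_i-\sum_{j=1}^{n-1}y_j$. The rectangular Young diagram $w^{\{x_i\},\{y_j\}}:\mathbb R\to\mathbb R$ is the function uniquely determined by: (1) it is continuous and piecewise linear, with derivative $\pm1$ except at finitely many points, which are exactly its local extrema; (2) its local minima are at the points $x_i$, its local maxima are at the points $y_j$, and there are no other local extrema; (3) $w^{\{x_i\},\{y_j\}}(x)=|x-z_0|$ when $|x|$ is large enough. Equivalently (and this is the meaning when some $x_i$ and $y_j$ coincide), $w^{\{x_i\},\{y_j\}}(x)=\sum_{i=1}^n|x-x_i|-\sum_{j=1}^{n-1}|x-y_j|$. *)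

theory Defs
  imports "HOL-Probability.Probability" "Jordan_Normal_Form.Char_Poly"
begin

(* The multiplicities are algebraic. For a real symmetric matrix they agree with the geometric
   ones, and the characteristic polynomial splits over the reals, so that the list has length
   dim_row A. *)
definition eigenvalue_list :: "real mat \<Rightarrow> real list" where
  "eigenvalue_list A = rev (sorted_list_of_multiset (proots (char_poly A)))"

(* If xs and ys interlace, with length xs = length ys + 1, this is the zigzag line of slopes 1 and -1
   with local minima at xs and local maxima at ys that equals \<bar>t - (sum_list xs - sum_list ys)\<bar> for
   large \<bar>t\<bar>; the formula also covers coinciding entries. *)
definition rect_young_diagram :: "real list \<Rightarrow> real list \<Rightarrow> real \<Rightarrow> real" where
  "rect_young_diagram xs ys t = (\<Sum>x\<leftarrow>xs. \<bar>t - x\<bar>) - (\<Sum>y\<leftarrow>ys. \<bar>t - y\<bar>)"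

(* Rows, columns and the family Z are indexed from 0; only the entries Z i j with i \<le> j are used. *)
definition wigner_matrix :: "(nat \<Rightarrow> nat \<Rightarrow> 'a \<Rightarrow> real) \<Rightarrow> nat \<Rightarrow> 'a \<Rightarrow> real mat" where
  "wigner_matrix Z N \<omega> = Matrix.mat N N (\<lambda>(i, j). if i \<le> j then Z i j \<omega> else Z j i \<omega>)"

definition wigner_diagram :: "(nat \<Rightarrow> nat \<Rightarrow> 'a \<Rightarrow> real) \<Rightarrow> nat \<Rightarrow> 'a \<Rightarrow> real \<Rightarrow> real" where
  "wigner_diagram Z N \<omega> =
     rect_young_diagram (eigenvalue_list (wigner_matrix Z N \<omega>))
       (eigenvalue_list (mat_delete (wigner_matrix Z N \<omega>) (N - 1) (N - 1)))"

definition Omega_curve :: "real \<Rightarrow> real" where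
  "Omega_curve x =
     (if \<bar>x\<bar> \<le> 2 then 2 / pi * (x * arcsin (x / 2) + sqrt (4 - x\<^sup>2)) else \<bar>x\<bar>)"

(* Measurability is part of the notion: the measure of a non-measurable set is 0 by convention,
   so the limit alone would say nothing about a non-measurable sequence. *)
definition tendsto_in_probability ::
    "'a measure \<Rightarrow> (nat \<Rightarrow> 'a \<Rightarrow> real) \<Rightarrow> real \<Rightarrow> bool" where
  "tendsto_in_probability M Y c \<longleftrightarrow>
     (\<forall>n. Y n \<in> borel_measurable M) \<and>
     (\<forall>\<epsilon>>0. (\<lambda>n. measure M {\<omega> \<in> space M. \<bar>Y n \<omega> - c\<bar> > \<epsilon>}) \<longlonglongrightarrow> 0)"

end

theory Submission
  imports Defs "Jordan_Normal_Form.Schur_Decomposition" "HOL-Real_Asymp.Real_Asymp"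
begin

text \<open>
  Let \<open>x\<close> and \<open>y\<close> be the rescaled spectra of \<open>X\<^sub>N\<close> and of its minor, let \<open>p k\<close> be the sum of the powers
  \<open>x ^ k\<close> minus the sum of the powers \<open>y ^ k\<close>, and let \<open>z = p 1\<close>. Half of the difference of the diagram
  and \<open>\<bar>t - z\<bar>\<close> is a nonnegative Lipschitz function of compact support
  (\<open>rect_young_diagram_shape\<close>), whose \<open>k\<close>-th moment is \<open>(p (k + 2) - z ^ (k + 2)) / ((k + 1) * (k + 2))\<close>
  (\<open>diagram_excess_moment\<close>). For such functions convergence of all moments to those of a compactly
  supported function implies uniform convergence: the moments exclude escaping mass, polynomials
  approximate test functions, and the Lipschitz property turns weak convergence into uniform convergence
  (\<open>converging_moments.uniformly_close\<close>). Half of the second derivative of \<open>\<Omega>\<close> is the arcsine law on the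
  interval from -2 to 2, so it remains to prove that \<open>p k\<close> tends in probability to the \<open>k\<close>-th moment
  of the arcsine law (\<open>Omega_excess_moment\<close>, \<open>diagram_close_of_power_sums\<close>).

  The power sum \<open>p k\<close> is the difference of the traces of the \<open>k\<close>-th powers, that is, a sum over the closed
  walks that meet the last vertex. A first passage decomposition expresses it as a polynomial in the
  weights of first returns to this vertex (\<open>closed_walk_sum_diff\<close>). A first return weight of length
  \<open>k + 2\<close> is a quadratic form in the last row, whose coefficients are entries of the \<open>k\<close>-th power of the
  minor and independent of that row. Hence it concentrates at the trace of this power
  (\<open>first_return_variance\<close>); the variance is controlled by the expected number of closed walks of length
  \<open>2 k\<close>, for which the count of walks that use no edge just once gives the right order
  (\<open>expectation_walk_sum_even_le\<close>).

  The limits of the traces come from the same decomposition. A diagonal entry of a power of the matrix is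
  a polynomial in first return weights at its vertex, and the trace is the sum of the diagonal entries;
  this determines the limits of the traces of order \<open>k\<close> from those of order at most \<open>k - 2\<close>
  (\<open>scaled_trace_converges\<close>). The recursion is that of the Catalan numbers, and substituting its solution
  into the formula for \<open>p k\<close> yields the Wallis recurrence (\<open>arcsine_moment_recurrence\<close>).

  Interlacing enters through the Lipschitz property of the diagram. The ratio of the characteristic
  polynomials of the minor and of the matrix maps the upper half plane into the lower one
  (\<open>Im_det_pencil_pos\<close>). The argument of this ratio is therefore confined to an interval of length \<open>pi\<close>,
  and near the real axis it is, up to a constant and a factor, the slope of the diagram
  (\<open>phase_difference_bound\<close>, \<open>rect_young_diagram_lipschitz\<close>).
\<close>


section \<open>Walks and first passage decompositions\<close>

fun walk_sum :: "('b \<Rightarrow> 'b \<Rightarrow> real) \<Rightarrow> 'b set \<Rightarrow> nat \<Rightarrow> 'b \<Rightarrow> 'b \<Rightarrow> real" where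
  "walk_sum w S 0 a b = (if a = b then 1 else 0)"
| "walk_sum w S (Suc k) a b = (\<Sum>c\<in>S. w a c * walk_sum w S k c b)"

definition closed_walk_sum :: "('b \<Rightarrow> 'b \<Rightarrow> real) \<Rightarrow> 'b set \<Rightarrow> nat \<Rightarrow> real" where
  "closed_walk_sum w S k = (\<Sum>a\<in>S. walk_sum w S k a a)"

text \<open>The total weight of the walks from \<open>a\<close> to \<open>i\<close> of the given length that meet \<open>i\<close> only at
  their end.\<close>
fun first_passage :: "('b \<Rightarrow> 'b \<Rightarrow> real) \<Rightarrow> 'b set \<Rightarrow> 'b \<Rightarrow> nat \<Rightarrow> 'b \<Rightarrow> real" where
  "first_passage w S i 0 a = (if a = i then 1 else 0)"
| "first_passage w S i (Suc k) a = (if a = i then 0 else \<Sum>c\<in>S. w a c * first_passage w S i k c)"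

text \<open>The total weight of the closed walks at \<open>i\<close> of the given length that meet \<open>i\<close> only at both
  ends. Cutting off the first and the last step leaves a walk that avoids \<open>i\<close>; this makes the
  weight a quadratic form in the row \<open>i\<close> of the matrix, with coefficients that do not involve
  that row.\<close>
fun first_return :: "('b \<Rightarrow> 'b \<Rightarrow> real) \<Rightarrow> 'b set \<Rightarrow> 'b \<Rightarrow> nat \<Rightarrow> real" where
  "first_return w S i 0 = 0"
| "first_return w S i (Suc 0) = w i i"
| "first_return w S i (Suc (Suc k)) =
     (\<Sum>a\<in>S - {i}. \<Sum>b\<in>S - {i}. w i a * walk_sum w (S - {i}) k a b * w b i)"

lemma walk_sum_add:
  assumes "finite S" "a \<in> S"
  shows "walk_sum w S (k + l) a b = (\<Sum>c\<in>S. walk_sum w S k a c * walk_sum w S l c b)"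
  using assms(2)
proof (induction k arbitrary: a)
  case 0
  then show ?case using assms(1) by (simp add: if_distrib [of "\<lambda>x. x * _"] sum.delta cong: if_cong)
next
  case (Suc k)
  have "walk_sum w S (Suc k + l) a b
      = (\<Sum>c\<in>S. w a c * (\<Sum>d\<in>S. walk_sum w S k c d * walk_sum w S l d b))"
    using Suc.IH by (auto intro!: sum.cong)
  also have "\<dots> = (\<Sum>c\<in>S. \<Sum>d\<in>S. w a c * walk_sum w S k c d * walk_sum w S l d b)"
    by (simp add: sum_distrib_left mult.assoc)
  also have "\<dots> = (\<Sum>d\<in>S. walk_sum w S (Suc k) a d * walk_sum w S l d b)"
    by (subst sum.swap) (simp add: sum_distrib_right)
  finally show ?case .
qed

lemma walk_sum_1: "finite S \<Longrightarrow> a \<in> S \<Longrightarrow> b \<in> S \<Longrightarrow> walk_sum w S (Suc 0) a b = w a b"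
  by (simp add: if_distrib [of "\<lambda>x. _ * x"] sum.delta cong: if_cong)

lemma walk_sum_sym:
  assumes "finite S" "\<And>a b. w a b = w b a" "a \<in> S" "b \<in> S"
  shows "walk_sum w S k a b = walk_sum w S k b a"
  using assms(3,4)
proof (induction k arbitrary: a b)
  case (Suc k)
  have "walk_sum w S (Suc k) a b = (\<Sum>c\<in>S. walk_sum w S k b c * w c a)"
    using Suc by (auto intro!: sum.cong simp: assms(2)[of a] mult.commute)
  also have "\<dots> = walk_sum w S (k + 1) b a"
    using Suc.prems assms(1) by (subst walk_sum_add) (auto intro!: sum.cong simp: walk_sum_1 simp del: walk_sum.simps)
  finally show ?case by simp
qed simp

text \<open>A walk that meets \<open>i\<close> splits uniquely at its first visit. The left side is the weight of the
  walks from \<open>a\<close> to \<open>b\<close> that meet \<open>i\<close>, since the walks in \<open>S - {i}\<close> are subtracted.\<close>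
lemma walk_sum_visiting:
  assumes "finite S" "i \<in> S" "a \<in> S" "b \<in> S"
  shows "walk_sum w S k a b - (if a = i \<or> b = i then 0 else walk_sum w (S - {i}) k a b)
       = (\<Sum>l\<le>k. first_passage w S i l a * walk_sum w S (k - l) i b)"
  using assms(3)
proof (induction k arbitrary: a)
  case 0
  then show ?case by auto
next
  case (Suc k)
  show ?case
  proof (cases "a = i")
    case True
    have "first_passage w S i l i = (if l = 0 then 1 else 0)" for l by (cases l) auto
    then show ?thesis using True
      by (simp add: if_distrib [of "\<lambda>x. x * _"] sum.delta del: walk_sum.simps cong: if_cong)
  next
    case False
    have "walk_sum w S (Suc k) a b - (if a = i \<or> b = i then 0 else walk_sum w (S - {i}) (Suc k) a b)
        = (\<Sum>c\<in>S. w a c * walk_sum w S k c b) -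
          (\<Sum>c\<in>S. w a c * (if c = i \<or> b = i then 0 else walk_sum w (S - {i}) k c b))"
      using False assms(1,2) by (auto simp: sum.remove[of S i])
    also have "\<dots> = (\<Sum>c\<in>S. w a c * (\<Sum>l\<le>k. first_passage w S i l c * walk_sum w S (k - l) i b))"
      by (simp add: sum_subtractf[symmetric] right_diff_distrib[symmetric] Suc.IH)
    also have "\<dots> = (\<Sum>l\<le>k. \<Sum>c\<in>S. w a c * first_passage w S i l c * walk_sum w S (k - l) i b)"
      by (subst sum.swap) (simp add: sum_distrib_left mult.assoc)
    also have "\<dots> = (\<Sum>l\<le>k. first_passage w S i (Suc l) a * walk_sum w S (Suc k - Suc l) i b)"
      using False by (simp add: sum_distrib_right)
    also have "\<dots> = (\<Sum>l\<le>Suc k. first_passage w S i l a * walk_sum w S (Suc k - l) i b)"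
      using False by (subst sum.atMost_Suc_shift) simp
    finally show ?thesis .
  qed
qed

lemma first_passage_eq:
  assumes "finite S" "i \<in> S" "a \<in> S - {i}"
  shows "first_passage w S i (Suc k) a = (\<Sum>b\<in>S - {i}. walk_sum w (S - {i}) k a b * w b i)"
  using assms(3)
proof (induction k arbitrary: a)
  case 0
  then show ?case using assms(1,2)
    by (simp add: if_distrib [of "\<lambda>x. x * _"] if_distrib [of "\<lambda>x. _ * x"] sum.delta cong: if_cong)
next
  case (Suc k)
  have "first_passage w S i (Suc (Suc k)) a = (\<Sum>c\<in>S. w a c * first_passage w S i (Suc k) c)"
    using Suc.prems by simp
  also have "\<dots> = (\<Sum>c\<in>S-{i}. w a c * first_passage w S i (Suc k) c)"
    using assms(1,2) by (subst sum.remove[of S i]) auto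
  also have "\<dots> = (\<Sum>c\<in>S-{i}. w a c * (\<Sum>b\<in>S - {i}. walk_sum w (S - {i}) k c b * w b i))"
    using Suc.IH by (intro sum.cong) auto
  also have "\<dots> = (\<Sum>b\<in>S - {i}. walk_sum w (S - {i}) (Suc k) a b * w b i)"
    by (simp add: sum_distrib_left sum_distrib_right mult.assoc) (rule sum.swap)
  finally show ?case .
qed

lemma first_return_eq:
  assumes "finite S" "i \<in> S"
  shows "first_return w S i (Suc k) = (\<Sum>c\<in>S. w i c * first_passage w S i k c)"
proof (cases k)
  case 0
  then show ?thesis using assms
    by (simp add: if_distrib [of "\<lambda>x. _ * x"] sum.delta cong: if_cong)
next
  case (Suc j)
  have "(\<Sum>c\<in>S. w i c * first_passage w S i (Suc j) c) = (\<Sum>c\<in>S-{i}. w i c * first_passage w S i (Suc j) c)"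
    using assms by (subst sum.remove[of S i]) auto
  also have "\<dots> = (\<Sum>c\<in>S-{i}. w i c * (\<Sum>b\<in>S - {i}. walk_sum w (S - {i}) j c b * w b i))"
    using assms first_passage_eq[of S i _ w j] by (intro sum.cong) auto
  also have "\<dots> = first_return w S i (Suc (Suc j))"
    by (simp add: sum_distrib_left mult.assoc)
  finally show ?thesis using Suc by simp
qed

lemma walk_sum_first_return:
  assumes "finite S" "i \<in> S"
  shows "walk_sum w S (Suc k) i i = (\<Sum>j\<le>k. first_return w S i (Suc j) * walk_sum w S (k - j) i i)"
proof -
  have "walk_sum w S (Suc k) i i = (\<Sum>c\<in>S. w i c * (\<Sum>l\<le>k. first_passage w S i l c * walk_sum w S (k - l) i i))"
    using walk_sum_visiting[OF assms _ assms(2), of _ w k] by simp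
  also have "\<dots> = (\<Sum>l\<le>k. \<Sum>c\<in>S. w i c * first_passage w S i l c * walk_sum w S (k - l) i i)"
    by (subst sum.swap) (simp add: sum_distrib_left mult.assoc)
  also have "\<dots> = (\<Sum>l\<le>k. first_return w S i (Suc l) * walk_sum w S (k - l) i i)"
    by (simp add: first_return_eq[OF assms] sum_distrib_right)
  finally show ?thesis .
qed

text \<open>Here \<open>m\<close> stands for the generating function of all closed walks at a vertex and \<open>f\<close> for the
  one of the first returns, so that \<open>m = 1 / (1 - f)\<close>; the equation for \<open>p\<close> says that \<open>p\<close> is the
  derivative of \<open>X m\<close> divided by \<open>m\<close>. Eliminating \<open>m\<close> leaves a relation of \<open>p\<close> and \<open>f\<close> alone.\<close>
lemma fps_renewal_derivative:
  fixes m f p :: "real fps"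
  assumes "m = 1 + f * m" "p * m = m + fps_X * fps_deriv m"
  shows "p * (1 - f) = 1 - f + fps_X * fps_deriv f"
proof -
  have m: "m * (1 - f) = 1" using assms(1) by (simp add: algebra_simps)
  then have "fps_deriv (m * (1 - f)) = 0" by (metis fps_deriv_1)
  then have d: "fps_deriv m * (1 - f) = m * fps_deriv f" by (simp add: algebra_simps)
  have "p * (1 - f) = (p * m) * (1 - f) * (1 - f)" using m by (simp add: mult.assoc)
  also have "\<dots> = (m * (1 - f)) * (1 - f) + fps_X * (fps_deriv m * (1 - f)) * (1 - f)"
    unfolding assms(2) by (simp add: algebra_simps)
  also have "\<dots> = 1 - f + fps_X * (m * fps_deriv f) * (1 - f)"
    unfolding d m by simp
  also have "\<dots> = 1 - f + fps_X * (m * (1 - f)) * fps_deriv f"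
    by (simp only: mult_ac)
  finally show ?thesis unfolding m by simp
qed

text \<open>These are the Newton identities for the power sums \<open>p k\<close> of the formal difference of the spectrum
  of a matrix and the spectrum of its minor. The number \<open>p k\<close> is the total weight of the closed walks
  that meet \<open>i\<close>. Cutting at the first visit gives \<open>p = \<Sum>a. F a * V a\<close> with generating functions
  \<open>F a\<close> of the first passages from \<open>a\<close> and \<open>V a\<close> of the walks from \<open>i\<close> to \<open>a\<close>. Multiplying by
  \<open>m\<close> turns \<open>F a\<close> into all walks from \<open>a\<close> to \<open>i\<close>, so \<open>p * m\<close> belongs to the closed walks at \<open>i\<close>
  with a marked position: there are \<open>k + 1\<close> positions in a walk of length \<open>k\<close>.\<close>
lemma closed_walk_sum_diff:
  fixes w :: "'b \<Rightarrow> 'b \<Rightarrow> real"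
  assumes "finite S" "i \<in> S"
  defines "p \<equiv> \<lambda>k. closed_walk_sum w S k - closed_walk_sum w (S - {i}) k"
  shows "p 0 = 1"
    and "p (Suc k) = real k * first_return w S i (Suc k) + (\<Sum>j\<le>k. first_return w S i (Suc j) * p (k - j))"
proof -
  define m where "m = Abs_fps (\<lambda>k. walk_sum w S k i i)"
  define f where "f = Abs_fps (first_return w S i)"
  define P where "P = Abs_fps p"
  show p0: "p 0 = 1"
    using assms(1,2) by (simp add: p_def closed_walk_sum_def sum.remove[of S i])
  have mf: "m = 1 + f * m"
  proof (rule fps_ext)
    fix n
    show "fps_nth m n = fps_nth (1 + f * m) n"
    proof (cases n)
      case (Suc k)
      have "fps_nth (f * m) (Suc k) = (\<Sum>j\<le>k. first_return w S i (Suc j) * walk_sum w S (k - j) i i)"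
        by (simp add: fps_mult_nth f_def m_def atLeast0AtMost sum.atMost_Suc_shift del: walk_sum.simps sum.atMost_Suc)
      then show ?thesis using Suc walk_sum_first_return[OF assms(1,2), of w k]
        by (simp add: m_def)
    qed (simp add: m_def f_def)
  qed
  define U V F where "U = (\<lambda>a. Abs_fps (\<lambda>k. walk_sum w S k a i))"
    and "V = (\<lambda>b. Abs_fps (\<lambda>k. walk_sum w S k i b))"
    and "F = (\<lambda>a. Abs_fps (\<lambda>k. first_passage w S i k a))"
  have UF: "U a = F a * m" if "a \<in> S" for a
    by (rule fps_ext) (use walk_sum_visiting[OF assms(1,2) that assms(2), of w] in
       \<open>simp add: U_def F_def m_def fps_mult_nth atLeast0AtMost\<close>)
  have PF: "P = (\<Sum>a\<in>S. F a * V a)"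
  proof (rule fps_ext)
    fix n
    have "fps_nth (\<Sum>a\<in>S. F a * V a) n
        = (\<Sum>a\<in>S. \<Sum>l\<le>n. first_passage w S i l a * walk_sum w S (n - l) i a)"
      by (simp add: fps_sum_nth F_def V_def fps_mult_nth atLeast0AtMost)
    also have "\<dots> = (\<Sum>a\<in>S. walk_sum w S n a a - (if a = i then 0 else walk_sum w (S - {i}) n a a))"
      using walk_sum_visiting[OF assms(1,2), of _ _ w n, symmetric] by (intro sum.cong) auto
    also have "\<dots> = p n"
      using assms(1,2) by (simp add: p_def closed_walk_sum_def sum_subtractf sum.remove[of S i])
    finally show "fps_nth P n = fps_nth (\<Sum>a\<in>S. F a * V a) n" by (simp add: P_def)
  qed
  have "P * m = (\<Sum>a\<in>S. V a * U a)"
    unfolding PF sum_distrib_right by (intro sum.cong) (auto simp: UF mult_ac)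
  also have "\<dots> = m + fps_X * fps_deriv m"
  proof (rule fps_ext)
    fix n
    have "fps_nth (\<Sum>a\<in>S. V a * U a) n = (\<Sum>l\<le>n. \<Sum>a\<in>S. walk_sum w S l i a * walk_sum w S (n - l) a i)"
      by (subst sum.swap) (simp add: fps_sum_nth U_def V_def fps_mult_nth atLeast0AtMost)
    also have "\<dots> = (\<Sum>l\<le>n. walk_sum w S n i i)"
      by (intro sum.cong) (auto simp flip: walk_sum_add[OF assms(1,2)])
    also have "\<dots> = fps_nth (m + fps_X * fps_deriv m) n"
      by (cases n) (auto simp: m_def algebra_simps)
    finally show "fps_nth (\<Sum>a\<in>S. V a * U a) n = fps_nth (m + fps_X * fps_deriv m) n" .
  qed
  finally have "P * (1 - f) = 1 - f + fps_X * fps_deriv f"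
    by (rule fps_renewal_derivative[OF mf])
  then have "P = P * f + 1 - f + fps_X * fps_deriv f" by (simp add: algebra_simps)
  then have "fps_nth P (Suc k) = fps_nth (f * P + 1 - f + fps_X * fps_deriv f) (Suc k)"
    by (metis mult.commute)
  moreover have "fps_nth (f * P) (Suc k) = (\<Sum>j\<le>k. first_return w S i (Suc j) * p (k - j))"
    by (simp add: fps_mult_nth f_def P_def atLeast0AtMost sum.atMost_Suc_shift del: sum.atMost_Suc)
  ultimately show "p (Suc k) = real k * first_return w S i (Suc k) + (\<Sum>j\<le>k. first_return w S i (Suc j) * p (k - j))"
    by (simp add: P_def f_def algebra_simps)
qed


section \<open>Independence and moments of the matrix entries\<close>

text \<open>All random variables below are polynomials in the entries. Having all moments is closed under
  sums and products, which settles every integrability question at once.\<close>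
definition has_moments :: "'a measure \<Rightarrow> ('a \<Rightarrow> real) \<Rightarrow> bool" where
  "has_moments M X \<longleftrightarrow> X \<in> borel_measurable M \<and> (\<forall>k::nat. integrable M (\<lambda>\<omega>. \<bar>X \<omega>\<bar> ^ k))"

lemma has_moments_measurable: "has_moments M X \<Longrightarrow> X \<in> borel_measurable M"
  and has_moments_abs_power: "has_moments M X \<Longrightarrow> integrable M (\<lambda>\<omega>. \<bar>X \<omega>\<bar> ^ k)"
  by (auto simp: has_moments_def)

lemma has_moments_integrable: "has_moments M X \<Longrightarrow> integrable M X"
  using has_moments_abs_power[of M X 1] has_moments_measurable[of M X]
  by (simp add: integrable_abs_iff)

context prob_space
begin

lemma has_moments_const: "has_moments M (\<lambda>_. c)"
  by (auto simp: has_moments_def)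

lemma has_moments_mult:
  assumes X: "has_moments M X" and Y: "has_moments M Y"
  shows "has_moments M (\<lambda>\<omega>. X \<omega> * Y \<omega>)"
  unfolding has_moments_def
proof (intro conjI allI)
  note [measurable] = has_moments_measurable[OF X] has_moments_measurable[OF Y]
  show "(\<lambda>\<omega>. X \<omega> * Y \<omega>) \<in> borel_measurable M" by measurable
  fix k :: nat
  have "integrable M (\<lambda>\<omega>. \<bar>X \<omega>\<bar> ^ (2 * k) + \<bar>Y \<omega>\<bar> ^ (2 * k))"
    by (intro Bochner_Integration.integrable_add has_moments_abs_power X Y)
  then show "integrable M (\<lambda>\<omega>. \<bar>X \<omega> * Y \<omega>\<bar> ^ k)"
  proof (rule Bochner_Integration.integrable_bound)
    show "AE \<omega> in M. norm (\<bar>X \<omega> * Y \<omega>\<bar> ^ k) \<le> norm (\<bar>X \<omega>\<bar> ^ (2 * k) + \<bar>Y \<omega>\<bar> ^ (2 * k))"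
    proof (intro AE_I2)
      fix \<omega>
      have *: "x * y \<le> x\<^sup>2 + y\<^sup>2" if "0 \<le> x" "0 \<le> y" for x y :: real
        using sum_squares_bound[of x y] mult_nonneg_nonneg[OF that] by linarith
      have "\<bar>X \<omega>\<bar> ^ k * \<bar>Y \<omega>\<bar> ^ k \<le> (\<bar>X \<omega>\<bar> ^ k)\<^sup>2 + (\<bar>Y \<omega>\<bar> ^ k)\<^sup>2"
        by (rule *) simp_all
      also have "\<dots> = \<bar>X \<omega>\<bar> ^ (2 * k) + \<bar>Y \<omega>\<bar> ^ (2 * k)"
        by (simp only: power_even_eq)
      finally have "\<bar>X \<omega> * Y \<omega>\<bar> ^ k \<le> \<bar>X \<omega>\<bar> ^ (2 * k) + \<bar>Y \<omega>\<bar> ^ (2 * k)"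
        by (simp only: abs_mult power_mult_distrib)
      then show "norm (\<bar>X \<omega> * Y \<omega>\<bar> ^ k) \<le> norm (\<bar>X \<omega>\<bar> ^ (2 * k) + \<bar>Y \<omega>\<bar> ^ (2 * k))"
        unfolding real_norm_def by (subst abs_of_nonneg) (auto intro: order_trans[OF _ abs_ge_self])
    qed
  qed measurable
qed

lemma has_moments_add:
  assumes X: "has_moments M X" and Y: "has_moments M Y"
  shows "has_moments M (\<lambda>\<omega>. X \<omega> + Y \<omega>)"
  unfolding has_moments_def
proof (intro conjI allI)
  note [measurable] = has_moments_measurable[OF X] has_moments_measurable[OF Y]
  show "(\<lambda>\<omega>. X \<omega> + Y \<omega>) \<in> borel_measurable M" by measurable
  fix k :: nat
  have "integrable M (\<lambda>\<omega>. 2 ^ k * (\<bar>X \<omega>\<bar> ^ k + \<bar>Y \<omega>\<bar> ^ k))"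
    by (intro integrable_mult_right Bochner_Integration.integrable_add has_moments_abs_power X Y)
  then show "integrable M (\<lambda>\<omega>. \<bar>X \<omega> + Y \<omega>\<bar> ^ k)"
  proof (rule Bochner_Integration.integrable_bound)
    show "AE \<omega> in M. norm (\<bar>X \<omega> + Y \<omega>\<bar> ^ k) \<le> norm (2 ^ k * (\<bar>X \<omega>\<bar> ^ k + \<bar>Y \<omega>\<bar> ^ k))"
    proof (intro AE_I2)
      fix \<omega>
      have "\<bar>X \<omega> + Y \<omega>\<bar> ^ k \<le> (2 * max \<bar>X \<omega>\<bar> \<bar>Y \<omega>\<bar>) ^ k"
        by (intro power_mono) auto
      also have "\<dots> \<le> 2 ^ k * (\<bar>X \<omega>\<bar> ^ k + \<bar>Y \<omega>\<bar> ^ k)"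
        unfolding power_mult_distrib by (intro mult_left_mono) (simp_all add: max_def)
      finally show "norm (\<bar>X \<omega> + Y \<omega>\<bar> ^ k) \<le> norm (2 ^ k * (\<bar>X \<omega>\<bar> ^ k + \<bar>Y \<omega>\<bar> ^ k))"
        unfolding real_norm_def by (subst abs_of_nonneg) (auto intro: order_trans[OF _ abs_ge_self])
    qed
  qed measurable
qed

lemma has_moments_minus: "has_moments M X \<Longrightarrow> has_moments M (\<lambda>\<omega>. - X \<omega>)"
  using has_moments_mult[OF has_moments_const[of "-1"], of X] by simp

lemma has_moments_diff: "has_moments M X \<Longrightarrow> has_moments M Y \<Longrightarrow> has_moments M (\<lambda>\<omega>. X \<omega> - Y \<omega>)"
  using has_moments_add[of X "\<lambda>\<omega>. - Y \<omega>"] has_moments_minus[of Y] by simp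

lemma has_moments_sum:
  "(\<And>i. i \<in> I \<Longrightarrow> has_moments M (X i)) \<Longrightarrow> has_moments M (\<lambda>\<omega>. \<Sum>i\<in>I. X i \<omega>)"
proof (induction I rule: infinite_finite_induct)
  case (insert i I)
  have "has_moments M (\<lambda>\<omega>. X i \<omega> + (\<Sum>i\<in>I. X i \<omega>))"
    using insert by (intro has_moments_add) simp_all
  then show ?case using insert by simp
qed (simp_all add: has_moments_const)

lemma has_moments_power: "has_moments M X \<Longrightarrow> has_moments M (\<lambda>\<omega>. X \<omega> ^ k)"
proof (induction k)
  case (Suc k)
  then show ?case using has_moments_mult[of X "\<lambda>\<omega>. X \<omega> ^ k"] by simp
qed (simp add: has_moments_const)

lemmas has_moments_intros = has_moments_const has_moments_mult has_moments_add has_moments_diff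
  has_moments_minus has_moments_sum has_moments_power

end

definition entry :: "(nat \<Rightarrow> nat \<Rightarrow> 'a \<Rightarrow> real) \<Rightarrow> 'a \<Rightarrow> nat \<Rightarrow> nat \<Rightarrow> real" where
  "entry Z \<omega> a b = Z (min a b) (max a b) \<omega>"

definition edge :: "nat \<Rightarrow> nat \<Rightarrow> nat \<times> nat" where
  "edge a b = (min a b, max a b)"

lemma entry_sym: "entry Z \<omega> a b = entry Z \<omega> b a"
  by (simp add: entry_def min.commute max.commute)

lemma edge_sym: "edge a b = edge b a"
  by (simp add: edge_def min.commute max.commute)

lemma edge_eq_iff: "edge a b = edge c d \<longleftrightarrow> (a = c \<and> b = d) \<or> (a = d \<and> b = c)"
  by (auto simp: edge_def min_def max_def split: if_splits)

locale wigner_family = prob_space M for M :: "'a measure" +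
  fixes Z :: "nat \<Rightarrow> nat \<Rightarrow> 'a \<Rightarrow> real"
  assumes indep: "indep_vars (\<lambda>_. borel) (\<lambda>(i, j). Z i j) UNIV"
    and ident: "\<And>i j. distr M borel (Z i j) = distr M borel (Z 0 0)"
    and moments: "\<And>k::nat. k \<ge> 1 \<Longrightarrow> integrable M (\<lambda>\<omega>. \<bar>Z 0 0 \<omega>\<bar> ^ k)"
    and mean_0: "integral\<^sup>L M (Z 0 0) = 0"
    and variance_1: "integral\<^sup>L M (\<lambda>\<omega>. (Z 0 0 \<omega>)\<^sup>2) = 1"
begin

definition ZZ :: "nat \<times> nat \<Rightarrow> 'a \<Rightarrow> real" where "ZZ = (\<lambda>(i, j). Z i j)"

lemma entry_ZZ: "entry Z \<omega> a b = ZZ (edge a b) \<omega>"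
  by (simp add: entry_def edge_def ZZ_def)

lemma ZZ_measurable [measurable]: "ZZ e \<in> borel_measurable M"
  using indep unfolding indep_vars_def ZZ_def by (cases e) auto

lemma Z_measurable [measurable]: "Z i j \<in> borel_measurable M"
  using ZZ_measurable[of "(i, j)"] by (simp add: ZZ_def)

lemma expectation_ZZ:
  assumes [measurable]: "f \<in> borel_measurable borel"
  shows "expectation (\<lambda>\<omega>. f (ZZ e \<omega>)) = expectation (\<lambda>\<omega>. f (Z 0 0 \<omega>) :: real)"
proof -
  have "expectation (\<lambda>\<omega>. f (ZZ e \<omega>)) = integral\<^sup>L (distr M borel (ZZ e)) f"
    by (subst integral_distr) auto
  also have "distr M borel (ZZ e) = distr M borel (Z 0 0)"
    using ident by (cases e) (auto simp: ZZ_def)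
  also have "integral\<^sup>L (distr M borel (Z 0 0)) f = expectation (\<lambda>\<omega>. f (Z 0 0 \<omega>))"
    by (subst integral_distr) auto
  finally show ?thesis .
qed

lemma has_moments_ZZ: "has_moments M (ZZ e)"
  unfolding has_moments_def
proof (intro conjI allI)
  fix k :: nat
  have "integrable M (\<lambda>\<omega>. \<bar>Z 0 0 \<omega>\<bar> ^ k)"
    using moments[of k] by (cases "k = 0") auto
  then have "integrable (distr M borel (Z 0 0)) (\<lambda>x. \<bar>x\<bar> ^ k)"
    by (subst integrable_distr_eq) auto
  also have "distr M borel (Z 0 0) = distr M borel (ZZ e)"
    unfolding ZZ_def split_beta by (rule ident[symmetric])
  finally show "integrable M (\<lambda>\<omega>. \<bar>ZZ e \<omega>\<bar> ^ k)"
    by (subst (asm) integrable_distr_eq) auto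
qed simp

lemma has_moments_entry: "has_moments M (\<lambda>\<omega>. entry Z \<omega> a b)"
  unfolding entry_ZZ by (rule has_moments_ZZ)

lemma expectation_ZZ_mean: "expectation (ZZ e) = 0"
  using expectation_ZZ[of "\<lambda>x. x" e] mean_0 by simp

lemma expectation_ZZ_square: "expectation (\<lambda>\<omega>. (ZZ e \<omega>)\<^sup>2) = 1"
  using expectation_ZZ[of "\<lambda>x. x\<^sup>2" e] variance_1 by simp

definition events_of :: "nat \<times> nat \<Rightarrow> 'a set set" where
  "events_of e = {ZZ e -` B \<inter> space M | B. B \<in> sets borel}"

text \<open>The \<open>\<sigma>\<close>-algebra generated by the entries with index in \<open>J\<close>. Independence is applied to
  variables that are measurable with respect to two such algebras; measurability, unlike an explicit
  representation as a function of the entries, passes automatically to sums and products.\<close>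
definition sub_algebra :: "(nat \<times> nat) set \<Rightarrow> 'a measure" where
  "sub_algebra J = sigma (space M) (\<Union>e\<in>J. events_of e)"

lemma sets_sub_algebra: "sets (sub_algebra J) = sigma_sets (space M) (\<Union>e\<in>J. events_of e)"
  unfolding sub_algebra_def by (rule sets_measure_of) (auto simp: events_of_def)

lemma space_sub_algebra [simp]: "space (sub_algebra J) = space M"
  unfolding sub_algebra_def by (rule space_measure_of) (auto simp: events_of_def)

lemma sub_algebra_le: "sets (sub_algebra J) \<subseteq> sets M"
  unfolding sets_sub_algebra
  by (rule sets.sigma_sets_subset) (auto simp: events_of_def)

lemma ZZ_sub_algebra: "e \<in> J \<Longrightarrow> ZZ e \<in> borel_measurable (sub_algebra J)"
  by (rule measurableI) (auto simp: sets_sub_algebra events_of_def intro!: sigma_sets.Basic)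

lemma sub_algebra_measurable: "X \<in> borel_measurable (sub_algebra J) \<Longrightarrow> X \<in> borel_measurable M"
  using sub_algebra_le by (auto simp: measurable_def)

lemma indep_sub_algebra:
  fixes X Y :: "'a \<Rightarrow> real"
  assumes X: "X \<in> borel_measurable (sub_algebra J)" and Y: "Y \<in> borel_measurable (sub_algebra K)"
    and JK: "J \<inter> K = {}"
  shows "indep_var borel X borel Y"
proof -
  have "indep_sets (\<lambda>b. sigma_sets (space M) (\<Union>e\<in>(case b of True \<Rightarrow> J | False \<Rightarrow> K). events_of e)) UNIV"
  proof (rule indep_sets_collect_sigma)
    have "indep_sets (\<lambda>i. {ZZ i -` A \<inter> space M |A. A \<in> sets borel}) UNIV"
      using indep unfolding indep_vars_def2 ZZ_def by simp
    then show "indep_sets events_of (\<Union>b\<in>UNIV. case b of True \<Rightarrow> J | False \<Rightarrow> K)"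
      by (rule indep_sets_mono) (auto simp: events_of_def)
    show "Int_stable (events_of i)" for i
    proof (unfold Int_stable_def events_of_def, safe)
      fix A B :: "real set" assume "A \<in> sets borel" "B \<in> sets borel"
      then show "\<exists>C. ZZ i -` A \<inter> space M \<inter> (ZZ i -` B \<inter> space M) = ZZ i -` C \<inter> space M \<and> C \<in> sets borel"
        by (intro exI[of _ "A \<inter> B"]) auto
    qed
    show "disjoint_family (\<lambda>b. case b of True \<Rightarrow> J | False \<Rightarrow> K)"
      using JK by (auto simp: disjoint_family_on_def split: bool.splits)
  qed
  then have "indep_set (sets (sub_algebra J)) (sets (sub_algebra K))"
    unfolding indep_set_def sets_sub_algebra
    by (rule indep_sets_mono) (auto split: bool.splits)
  moreover have "sigma_sets (space M) {X -` A \<inter> space M |A. A \<in> sets borel} \<subseteq> sets (sub_algebra J)"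
    by (rule sets.sigma_sets_subset[of _ "sub_algebra J", simplified])
       (use measurable_sets[OF X] in auto)
  moreover have "sigma_sets (space M) {Y -` A \<inter> space M |A. A \<in> sets borel} \<subseteq> sets (sub_algebra K)"
    by (rule sets.sigma_sets_subset[of _ "sub_algebra K", simplified])
       (use measurable_sets[OF Y] in auto)
  ultimately have "indep_set (sigma_sets (space M) {X -` A \<inter> space M |A. A \<in> sets borel})
      (sigma_sets (space M) {Y -` A \<inter> space M |A. A \<in> sets borel})"
    unfolding indep_sets2_eq by blast
  then show ?thesis
    unfolding indep_var_eq using X Y by (auto intro: sub_algebra_measurable)
qed

lemma expectation_mult_indep:
  assumes "X \<in> borel_measurable (sub_algebra J)" "Y \<in> borel_measurable (sub_algebra K)"
    and "J \<inter> K = {}" "has_moments M X" "has_moments M Y"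
  shows "expectation (\<lambda>\<omega>. X \<omega> * Y \<omega>) = expectation X * expectation Y"
  by (rule indep_var_lebesgue_integral[OF indep_sub_algebra[OF assms(1-3)]])
     (auto intro: has_moments_integrable assms)

text \<open>The source of all cancellations: a centred entry that is independent of the other factors.\<close>
lemma expectation_mult_ZZ_eq_0:
  assumes "X \<in> borel_measurable (sub_algebra J)" "has_moments M X" "e \<notin> J"
  shows "expectation (\<lambda>\<omega>. ZZ e \<omega> * X \<omega>) = 0"
  using expectation_mult_indep[OF ZZ_sub_algebra[of e "{e}"] assms(1), OF _ _ has_moments_ZZ assms(2)] assms(3)
  by (simp add: expectation_ZZ_mean)

lemma walk_sum_sub_algebra:
  assumes "a \<in> S" "b \<in> S" "{edge a b |a b. a \<in> S \<and> b \<in> S} \<subseteq> J"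
  shows "(\<lambda>\<omega>. walk_sum (entry Z \<omega>) S k a b) \<in> borel_measurable (sub_algebra J)"
  using assms(1)
proof (induction k arbitrary: a)
  case (Suc k)
  have "(\<lambda>\<omega>. entry Z \<omega> a c) \<in> borel_measurable (sub_algebra J)" if "c \<in> S" for c
    unfolding entry_ZZ using assms that Suc.prems by (intro ZZ_sub_algebra) auto
  then show ?case unfolding walk_sum.simps
    by (intro borel_measurable_sum borel_measurable_times Suc.IH) auto
qed simp

lemma has_moments_walk_sum: "has_moments M (\<lambda>\<omega>. walk_sum (entry Z \<omega>) S k a b)"
proof (induction k arbitrary: a)
  case (Suc k)
  show ?case unfolding walk_sum.simps
    by (intro has_moments_sum has_moments_mult has_moments_entry Suc.IH)
qed (simp add: has_moments_const)

lemma has_moments_closed_walk_sum: "has_moments M (\<lambda>\<omega>. closed_walk_sum (entry Z \<omega>) S k)"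
  unfolding closed_walk_sum_def by (intro has_moments_sum has_moments_walk_sum)

lemma has_moments_first_return: "has_moments M (\<lambda>\<omega>. first_return (entry Z \<omega>) S i k)"
proof (cases k)
  case (Suc j)
  show ?thesis
  proof (cases j)
    case 0
    then show ?thesis using Suc by (simp add: has_moments_entry)
  next
    case (Suc l)
    show ?thesis unfolding Suc \<open>k = Suc j\<close> first_return.simps
      by (intro has_moments_sum has_moments_mult has_moments_entry has_moments_walk_sum)
  qed
qed (simp add: has_moments_const)

end


section \<open>Expected closed walks\<close>

fun walk_weight :: "('b \<Rightarrow> 'b \<Rightarrow> real) \<Rightarrow> 'b list \<Rightarrow> real" where
  "walk_weight w (x # y # zs) = w x y * walk_weight w (y # zs)"
| "walk_weight w xs = 1"

fun walk_edges :: "nat list \<Rightarrow> (nat \<times> nat) list" where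
  "walk_edges (x # y # zs) = edge x y # walk_edges (y # zs)"
| "walk_edges xs = []"

lemma length_walk_edges: "length (walk_edges xs) = length xs - 1"
  by (induction xs rule: walk_edges.induct) auto

lemma set_walk_edges: "e \<in> set (walk_edges xs) \<Longrightarrow> fst e \<in> set xs \<and> snd e \<in> set xs"
proof (induction xs rule: walk_edges.induct)
  case (1 x y zs)
  have "fst (edge x y) \<in> {x, y}" "snd (edge x y) \<in> {x, y}"
    by (auto simp: edge_def min_def max_def)
  then show ?case using 1 by auto
qed auto

text \<open>A connected graph has at most one more vertex than edges: reading the walk backwards, every new
  vertex comes with a new edge.\<close>
lemma card_vertices_le_edges: "card (set xs) \<le> Suc (card (set (walk_edges xs)))"
proof (induction xs rule: walk_edges.induct)
  case (1 x y zs)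
  show ?case
  proof (cases "x \<in> set (y # zs)")
    case True
    then have "card (set (x # y # zs)) = card (set (y # zs))" by (simp add: insert_absorb)
    also have "\<dots> \<le> Suc (card (set (walk_edges (y # zs))))" by (rule 1)
    also have "\<dots> \<le> Suc (card (set (walk_edges (x # y # zs))))"
      by (intro Suc_leI le_imp_less_Suc card_mono) auto
    finally show ?thesis .
  next
    case False
    then have "edge x y \<notin> set (walk_edges (y # zs))"
      using set_walk_edges[of "edge x y" "y # zs"] by (auto simp: edge_def min_def max_def split: if_splits)
    then show ?thesis using 1 False by simp
  qed
qed auto

lemma walk_sum_eq_sum_words:
  assumes "finite S" "b \<in> S"
  shows "walk_sum w S (Suc k) a b = (\<Sum>xs | set xs \<subseteq> S \<and> length xs = k. walk_weight w (a # xs @ [b]))"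
proof (induction k arbitrary: a)
  case 0
  have "{xs. set xs \<subseteq> S \<and> length xs = 0} = {[]}" by auto
  then show ?case using assms
    by (simp add: if_distrib [of "\<lambda>x. _ * x"] sum.delta cong: if_cong)
next
  case (Suc k)
  have words: "{xs. set xs \<subseteq> S \<and> length xs = Suc k}
      = (\<lambda>(c, xs). c # xs) ` (S \<times> {xs. set xs \<subseteq> S \<and> length xs = k})"
    by (auto simp: length_Suc_conv image_iff)
  have "(\<Sum>xs | set xs \<subseteq> S \<and> length xs = Suc k. walk_weight w (a # xs @ [b]))
      = (\<Sum>(c, xs)\<in>S \<times> {xs. set xs \<subseteq> S \<and> length xs = k}. w a c * walk_weight w (c # xs @ [b]))"
    unfolding words by (subst sum.reindex) (auto simp: inj_on_def intro!: sum.cong)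
  also have "\<dots> = walk_sum w S (Suc (Suc k)) a b"
    using Suc.IH by (simp add: sum.cartesian_product[symmetric] sum_distrib_left[symmetric] del: walk_sum.simps)
      (simp add: walk_sum.simps(2)[of w S "Suc k"] del: walk_sum.simps)
  finally show ?case by simp
qed

text \<open>Such a word is determined by a list of \<open>k\<close> letters besides \<open>a\<close> and by the positions in
  \<open>a # gs\<close> at which its letters are found.\<close>
lemma card_words_few_letters:
  assumes S: "finite S" "a \<in> S"
  shows "card {xs. set xs \<subseteq> S \<and> length xs = l \<and> card (insert a (set xs)) \<le> Suc k} \<le> card S ^ k * Suc k ^ l"
proof -
  let ?G = "{gs. set gs \<subseteq> S \<and> length gs = k}" and ?H = "{hs. set hs \<subseteq> {..k} \<and> length hs = l}"
  let ?f = "\<lambda>(gs, hs). map (\<lambda>h. (a # gs) ! h) hs"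
  have "{xs. set xs \<subseteq> S \<and> length xs = l \<and> card (insert a (set xs)) \<le> Suc k} \<subseteq> ?f ` (?G \<times> ?H)"
  proof safe
    fix xs assume xs: "set xs \<subseteq> S" "l = length xs" "card (insert a (set xs)) \<le> Suc k"
    have "card (insert a (set xs)) = Suc (card (set xs - {a}))"
      by (simp add: card.insert_remove)
    with xs have c: "card (set xs - {a}) \<le> k" by simp
    obtain ds where ds: "set ds = set xs - {a}" "distinct ds"
      using finite_distinct_list[of "set xs - {a}"] by auto
    then have len: "length ds \<le> k" using c distinct_card[of ds] by simp
    \<comment> \<open>The padding by \<open>a\<close> makes all lists of letters equally long.\<close>
    define gs where "gs = ds @ replicate (k - length ds) a"
    have gs: "gs \<in> ?G" using ds len xs S by (auto simp: gs_def)
    have "\<exists>h\<le>k. (a # gs) ! h = x" if "x \<in> set xs" for x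
    proof -
      have "x \<in> set (a # gs)" using that ds by (auto simp: gs_def)
      then obtain h where "h < length (a # gs)" "(a # gs) ! h = x" by (metis in_set_conv_nth)
      then show ?thesis using gs by (intro exI[of _ h]) auto
    qed
    then obtain idx where idx: "\<And>x. x \<in> set xs \<Longrightarrow> idx x \<le> k \<and> (a # gs) ! idx x = x" by metis
    have "xs = ?f (gs, map idx xs)" using idx by (auto simp: map_idI)
    moreover have "map idx xs \<in> {hs. set hs \<subseteq> {..k} \<and> length hs = length xs}" using idx by auto
    ultimately show "xs \<in> ?f ` (?G \<times> {hs. set hs \<subseteq> {..k} \<and> length hs = length xs})" using gs by blast
  qed
  moreover have fin: "finite (?G \<times> ?H)" using S by (auto intro: finite_lists_length_eq)
  ultimately have "card {xs. set xs \<subseteq> S \<and> length xs = l \<and> card (insert a (set xs)) \<le> Suc k} \<le> card (?G \<times> ?H)"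
    by (meson card_image_le card_mono finite_imageI le_trans)
  also have "\<dots> = card S ^ k * Suc k ^ l"
    using S by (simp add: card_cartesian_product card_lists_length_eq)
  finally show ?thesis .
qed

context wigner_family
begin

lemma walk_weight_entry: "walk_weight (entry Z \<omega>) xs = prod_list (map (\<lambda>e. ZZ e \<omega>) (walk_edges xs))"
  by (induction xs rule: walk_edges.induct) (auto simp: entry_ZZ)

lemma has_moments_prod_list: "has_moments M (\<lambda>\<omega>. prod_list (map (\<lambda>e. ZZ e \<omega>) es))"
proof (induction es)
  case (Cons e es)
  show ?case unfolding list.map prod_list.Cons
    by (intro has_moments_mult has_moments_ZZ Cons)
qed (simp add: has_moments_const)

lemma prod_list_sub_algebra:
  "set es \<subseteq> J \<Longrightarrow> (\<lambda>\<omega>. prod_list (map (\<lambda>e. ZZ e \<omega>) es)) \<in> borel_measurable (sub_algebra J)"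
  by (induction es) (auto intro!: borel_measurable_times ZZ_sub_algebra)

lemma abs_prod_list_le:
  fixes xs :: "real list"
  assumes "xs \<noteq> []"
  shows "\<bar>prod_list xs\<bar> \<le> (\<Sum>x\<leftarrow>xs. \<bar>x\<bar> ^ length xs)"
proof -
  define m where "m = Max ((\<lambda>x. \<bar>x\<bar>) ` set xs)"
  have "m \<in> (\<lambda>x. \<bar>x\<bar>) ` set xs" unfolding m_def using assms by (intro Max_in) auto
  then obtain x where x: "x \<in> set xs" "m = \<bar>x\<bar>" by auto
  have "\<bar>prod_list ys\<bar> \<le> m ^ length ys" if "set ys \<subseteq> set xs" for ys
    using that
  proof (induction ys)
    case (Cons y ys)
    have "\<bar>y\<bar> \<le> m" unfolding m_def using Cons.prems by (intro Max_ge) auto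
    then show ?case using Cons x by (auto simp: abs_mult intro!: mult_mono)
  qed auto
  then have "\<bar>prod_list xs\<bar> \<le> \<bar>x\<bar> ^ length xs" using x by auto
  also have "\<dots> \<le> (\<Sum>x\<leftarrow>xs. \<bar>x\<bar> ^ length xs)"
    using x(1) by (intro member_le_sum_list) auto
  finally show ?thesis .
qed

text \<open>The product is at most the largest factor to the power of the length, hence at most the sum of
  these powers; as the entries are identically distributed, the sum has \<open>length es\<close> equal terms.\<close>
lemma abs_expectation_prod_list_le:
  assumes "es \<noteq> []"
  shows "\<bar>expectation (\<lambda>\<omega>. prod_list (map (\<lambda>e. ZZ e \<omega>) es))\<bar>
    \<le> length es * expectation (\<lambda>\<omega>. \<bar>Z 0 0 \<omega>\<bar> ^ length es)"
proof -
  let ?n = "length es"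
  have int: "integrable M (\<lambda>\<omega>. \<Sum>e\<leftarrow>es'. \<bar>ZZ e \<omega>\<bar> ^ ?n)" for es'
    by (induction es') (auto intro!: Bochner_Integration.integrable_add has_moments_abs_power has_moments_ZZ)
  have eq: "expectation (\<lambda>\<omega>. \<Sum>e\<leftarrow>es'. \<bar>ZZ e \<omega>\<bar> ^ ?n) = length es' * expectation (\<lambda>\<omega>. \<bar>Z 0 0 \<omega>\<bar> ^ ?n)" for es'
  proof (induction es')
    case (Cons e es')
    have "expectation (\<lambda>\<omega>. \<Sum>e\<leftarrow>e # es'. \<bar>ZZ e \<omega>\<bar> ^ ?n) =
        expectation (\<lambda>\<omega>. \<bar>ZZ e \<omega>\<bar> ^ ?n) + expectation (\<lambda>\<omega>. \<Sum>e\<leftarrow>es'. \<bar>ZZ e \<omega>\<bar> ^ ?n)"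
      unfolding list.map sum_list.Cons
      by (intro Bochner_Integration.integral_add int has_moments_abs_power has_moments_ZZ)
    then show ?case using Cons expectation_ZZ[of "\<lambda>x. \<bar>x\<bar> ^ ?n" e] by (simp add: algebra_simps)
  qed simp
  have "\<bar>expectation (\<lambda>\<omega>. prod_list (map (\<lambda>e. ZZ e \<omega>) es))\<bar>
      \<le> expectation (\<lambda>\<omega>. \<bar>prod_list (map (\<lambda>e. ZZ e \<omega>) es)\<bar>)"
    by (rule integral_abs_bound)
  also have "\<dots> \<le> expectation (\<lambda>\<omega>. \<Sum>e\<leftarrow>es. \<bar>ZZ e \<omega>\<bar> ^ ?n)"
  proof (intro integral_mono int integrable_abs has_moments_integrable has_moments_prod_list)
    fix \<omega>
    show "\<bar>prod_list (map (\<lambda>e. ZZ e \<omega>) es)\<bar> \<le> (\<Sum>e\<leftarrow>es. \<bar>ZZ e \<omega>\<bar> ^ ?n)"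
      using abs_prod_list_le[of "map (\<lambda>e. ZZ e \<omega>) es"] assms by (simp add: o_def)
  qed
  finally show ?thesis unfolding eq .
qed

lemma expectation_prod_list_eq_0:
  assumes "count_list es e = 1"
  shows "expectation (\<lambda>\<omega>. prod_list (map (\<lambda>e. ZZ e \<omega>) es)) = 0"
proof -
  have "e \<in> set es" using assms by (metis count_notin zero_neq_one)
  then obtain xs ys where es: "es = xs @ e # ys" "e \<notin> set xs" by (meson split_list_first)
  then have "count_list ys e = 0" using assms by simp
  then have e: "e \<notin> set (xs @ ys)" using es by (auto simp: count_list_0_iff)
  have "(\<lambda>\<omega>. prod_list (map (\<lambda>e. ZZ e \<omega>) es)) = (\<lambda>\<omega>. ZZ e \<omega> * prod_list (map (\<lambda>e. ZZ e \<omega>) (xs @ ys)))"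
    by (simp add: es mult_ac)
  then show ?thesis
    using expectation_mult_ZZ_eq_0[OF prod_list_sub_algebra[OF order_refl] has_moments_prod_list e] by simp
qed

lemma two_card_set_le_length:
  assumes "\<And>e. count_list es e \<noteq> 1"
  shows "2 * card (set es) \<le> length es"
proof -
  have "2 * card (set es) = (\<Sum>e\<in>set es. 2)" by simp
  also have "\<dots> \<le> (\<Sum>e\<in>set es. count_list es e)"
  proof (rule sum_mono)
    fix e assume "e \<in> set es"
    then have "count_list es e \<noteq> 0" by (simp add: count_list_0_iff)
    then show "2 \<le> count_list es e" using assms[of e] by linarith
  qed
  also have "\<dots> = length es" by (simp add: sum_count_set)
  finally show ?thesis .
qed

text \<open>The upper bound in Wigner's moment method. A closed walk of length \<open>2 k\<close> has nonzero expectation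
  only if it uses every edge at least twice. It then has at most \<open>k\<close> edges and, by connectedness,
  at most \<open>k\<close> vertices besides \<open>a\<close>, which leaves \<open>O(card S ^ k)\<close> walks.\<close>
lemma expectation_walk_sum_even_le:
  "\<exists>C\<ge>0. \<forall>S a. finite S \<and> a \<in> S \<longrightarrow>
     expectation (\<lambda>\<omega>. walk_sum (entry Z \<omega>) S (2 * k) a a) \<le> C * real (card S) ^ k"
proof (cases k)
  case 0
  then show ?thesis by (intro exI[of _ 1]) (auto simp: prob_space)
next
  case (Suc k')
  define l where "l = Suc (2 * k')"
  define K where "K = (2 * k) * expectation (\<lambda>\<omega>. \<bar>Z 0 0 \<omega>\<bar> ^ (2 * k))"
  have K: "K \<ge> 0" by (simp add: K_def)
  have two_k: "2 * k = Suc l" by (simp add: Suc l_def)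
  show ?thesis
  proof (intro exI[of _ "Suc k ^ l * K"] conjI allI impI)
    show "0 \<le> Suc k ^ l * K" using K by simp
    fix S a assume "finite S \<and> a \<in> (S :: nat set)"
    then have S: "finite S" "a \<in> S" by auto
    let ?W = "{xs. set xs \<subseteq> S \<and> length xs = l}"
    let ?E = "\<lambda>xs. expectation (\<lambda>\<omega>. walk_weight (entry Z \<omega>) (a # xs @ [a]))"
    let ?G = "{xs. set xs \<subseteq> S \<and> length xs = l \<and> card (insert a (set xs)) \<le> Suc k}"
    have fin: "finite ?W" using S by (auto intro: finite_lists_length_eq)
    have zero: "?E xs = 0" if "xs \<in> ?W - ?G" for xs
    proof -
      let ?es = "walk_edges (a # xs @ [a])"
      have "Suc k < card (set (a # xs @ [a]))" using that by auto
      then have "k < card (set ?es)" using card_vertices_le_edges[of "a # xs @ [a]"] by linarith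
      moreover have "length ?es = 2 * k" using that by (simp add: length_walk_edges two_k del: walk_edges.simps)
      ultimately have "\<exists>e. count_list ?es e = 1" using two_card_set_le_length[of ?es] by fastforce
      then show ?thesis unfolding walk_weight_entry using expectation_prod_list_eq_0 by blast
    qed
    have bound: "?E xs \<le> K" if "xs \<in> ?G" for xs
    proof -
      let ?es = "walk_edges (a # xs @ [a])"
      have l: "length ?es = 2 * k" using that by (simp add: length_walk_edges two_k del: walk_edges.simps)
      then have "?es \<noteq> []" using Suc by force
      from abs_expectation_prod_list_le[OF this] show ?thesis
        unfolding walk_weight_entry K_def l by linarith
    qed
    have "expectation (\<lambda>\<omega>. walk_sum (entry Z \<omega>) S (2 * k) a a) = (\<Sum>xs\<in>?W. ?E xs)"
      unfolding two_k walk_sum_eq_sum_words[OF S]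
      by (subst Bochner_Integration.integral_sum)
         (auto simp: walk_weight_entry intro!: has_moments_integrable has_moments_prod_list simp del: walk_edges.simps)
    also have "\<dots> = (\<Sum>xs\<in>?G. ?E xs)"
      using zero fin by (intro sum.mono_neutral_right) auto
    also have "\<dots> \<le> (\<Sum>xs\<in>?G. K)" by (intro sum_mono bound)
    also have "\<dots> = card ?G * K" by simp
    also have "\<dots> \<le> real (card S ^ k * Suc k ^ l) * K"
      using K card_words_few_letters[OF S, of l k] by (intro mult_right_mono) (auto simp del: of_nat_mult of_nat_power power_Suc of_nat_Suc)
    finally show "expectation (\<lambda>\<omega>. walk_sum (entry Z \<omega>) S (2 * k) a a) \<le> Suc k ^ l * K * real (card S) ^ k"
      by (simp add: mult_ac)
  qed
qed

section \<open>Concentration of first return weights\<close>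

text \<open>The centred coefficient of \<open>walk_sum (S - {i}) k a b\<close> in the first return weight at \<open>i\<close>.\<close>
definition pair_noise :: "nat \<Rightarrow> nat \<Rightarrow> nat \<Rightarrow> 'a \<Rightarrow> real" where
  "pair_noise i a b \<omega> = entry Z \<omega> i a * entry Z \<omega> b i - (if a = b then 1 else 0)"

lemma has_moments_pair_noise: "has_moments M (pair_noise i a b)"
proof -
  have "has_moments M (\<lambda>\<omega>. entry Z \<omega> i a * entry Z \<omega> b i - (if a = b then 1 else 0))"
    by (intro has_moments_diff has_moments_mult has_moments_entry has_moments_const)
  then show ?thesis by (simp add: pair_noise_def[abs_def])
qed

lemma pair_noise_sub_algebra:
  "edge i a \<in> J \<Longrightarrow> edge i b \<in> J \<Longrightarrow> pair_noise i a b \<in> borel_measurable (sub_algebra J)"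
  unfolding pair_noise_def[abs_def] entry_ZZ edge_sym[of b i]
  by (intro borel_measurable_diff borel_measurable_times ZZ_sub_algebra) auto

lemma pair_noise_commute: "pair_noise i a b = pair_noise i b a"
  by (auto simp: pair_noise_def[abs_def] entry_ZZ edge_sym[of _ i])

lemma pair_noise_orthogonal_offdiag:
  assumes "a \<noteq> b" "a \<noteq> c" "a \<noteq> d"
  shows "expectation (\<lambda>\<omega>. pair_noise i a b \<omega> * pair_noise i c d \<omega>) = 0"
proof -
  let ?J = "{edge i b, edge i c, edge i d}"
  have e: "edge i a \<notin> ?J" using assms by (auto simp: edge_eq_iff)
  have "(\<lambda>\<omega>. pair_noise i a b \<omega> * pair_noise i c d \<omega>)
      = (\<lambda>\<omega>. ZZ (edge i a) \<omega> * (ZZ (edge i b) \<omega> * pair_noise i c d \<omega>))"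
    using assms by (auto simp: pair_noise_def[abs_def] entry_ZZ edge_sym[of _ i])
  then show ?thesis
    using expectation_mult_ZZ_eq_0[of "\<lambda>\<omega>. ZZ (edge i b) \<omega> * pair_noise i c d \<omega>" ?J "edge i a"] e
    by (auto intro!: borel_measurable_times ZZ_sub_algebra pair_noise_sub_algebra has_moments_mult
        has_moments_ZZ has_moments_pair_noise)
qed

lemma pair_noise_orthogonal_diag:
  assumes "a \<noteq> c"
  shows "expectation (\<lambda>\<omega>. pair_noise i a a \<omega> * pair_noise i c c \<omega>) = 0"
proof -
  have "edge i a \<noteq> edge i c" using assms by (auto simp: edge_eq_iff)
  moreover have "expectation (pair_noise i a a) = 0"
  proof -
    have "expectation (pair_noise i a a) = expectation (\<lambda>\<omega>. (ZZ (edge i a) \<omega>)\<^sup>2 - 1)"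
      by (intro Bochner_Integration.integral_cong) (auto simp: pair_noise_def entry_ZZ edge_sym[of _ i] power2_eq_square)
    also have "\<dots> = 0"
      by (subst Bochner_Integration.integral_diff)
         (auto simp: expectation_ZZ_square prob_space intro!: has_moments_integrable has_moments_power has_moments_ZZ)
    finally show ?thesis .
  qed
  ultimately show ?thesis
    using expectation_mult_indep[of "pair_noise i a a" "{edge i a}" "pair_noise i c c" "{edge i c}"]
    by (auto intro!: pair_noise_sub_algebra has_moments_pair_noise)
qed

text \<open>Unless \<open>{a, b}\<close> and \<open>{c, d}\<close> agree as multisets, either some row entry occurs exactly once in the
  product, or both noises are diagonal and belong to different entries.\<close>
lemma pair_noise_orthogonal:
  assumes "\<not> (a = c \<and> b = d)" "\<not> (a = d \<and> b = c)"
  shows "expectation (\<lambda>\<omega>. pair_noise i a b \<omega> * pair_noise i c d \<omega>) = 0"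
proof -
  have off: "expectation (\<lambda>\<omega>. pair_noise i a b \<omega> * pair_noise i c d \<omega>) = 0"
    if "\<not> (a = c \<and> b = d)" "\<not> (a = d \<and> b = c)" "a \<noteq> b" for a b c d
  proof (cases "a \<noteq> c \<and> a \<noteq> d")
    case True
    then show ?thesis using that by (intro pair_noise_orthogonal_offdiag) auto
  next
    case False
    then have "b \<noteq> c \<and> b \<noteq> d" using that by auto
    then show ?thesis using that pair_noise_orthogonal_offdiag[of b a c d i]
      by (simp add: pair_noise_commute[of i b a])
  qed
  consider "a \<noteq> b" | "c \<noteq> d" | "a = b" "c = d" by blast
  then show ?thesis
  proof cases
    case 2
    then show ?thesis using off[of c a d b] assms by (auto simp: mult.commute)
  next
    case 3
    then show ?thesis using pair_noise_orthogonal_diag[of a c i] assms by auto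
  qed (use off assms in blast)
qed

lemma pair_noise_covariance_bound:
  "\<exists>C\<ge>0. \<forall>i a b. expectation (\<lambda>\<omega>. (pair_noise i a b \<omega>)\<^sup>2) \<le> C"
proof -
  define m4 where "m4 = expectation (\<lambda>\<omega>. (Z 0 0 \<omega>) ^ 4)"
  have m4: "expectation (\<lambda>\<omega>. (ZZ e \<omega>) ^ 4) = m4" for e
    using expectation_ZZ[of "\<lambda>x. x ^ 4" e] by (simp add: m4_def)
  have "m4 \<ge> 0" unfolding m4_def by (intro integral_nonneg_AE) auto
  moreover have "expectation (\<lambda>\<omega>. (pair_noise i a b \<omega>)\<^sup>2) \<le> 2 * m4 + 2" for i a b
  proof -
    have "expectation (\<lambda>\<omega>. (pair_noise i a b \<omega>)\<^sup>2)
        \<le> expectation (\<lambda>\<omega>. ZZ (edge i a) \<omega> ^ 4 + ZZ (edge i b) \<omega> ^ 4 + 2)"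
    proof (intro integral_mono has_moments_integrable has_moments_intros has_moments_pair_noise has_moments_ZZ)
      fix \<omega>
      define x y d where "x = ZZ (edge i a) \<omega>" and "y = ZZ (edge i b) \<omega>" and "d = (if a = b then 1 else 0 :: real)"
      have "(x * y - d)\<^sup>2 \<le> 2 * (x * y)\<^sup>2 + 2 * d\<^sup>2"
        using zero_le_power2[of "x * y + d"] by (simp add: power2_eq_square algebra_simps)
      also have "2 * (x * y)\<^sup>2 \<le> x ^ 4 + y ^ 4"
        using zero_le_power2[of "x\<^sup>2 - y\<^sup>2"] by (simp add: power2_eq_square power4_eq_xxxx algebra_simps)
      also have "2 * d\<^sup>2 \<le> 2" by (simp add: d_def)
      finally have "(x * y - d)\<^sup>2 \<le> x ^ 4 + y ^ 4 + 2" by simp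
      then show "(pair_noise i a b \<omega>)\<^sup>2 \<le> ZZ (edge i a) \<omega> ^ 4 + ZZ (edge i b) \<omega> ^ 4 + 2"
        by (simp add: pair_noise_def entry_ZZ edge_sym[of b i] x_def y_def d_def)
    qed
    also have "\<dots> = 2 * m4 + 2"
      by (simp add: m4 prob_space has_moments_integrable has_moments_power has_moments_ZZ)
    finally show ?thesis .
  qed
  ultimately show ?thesis by (intro exI[of _ "2 * m4 + 2"]) auto
qed

lemma pair_noise_covariance_le:
  assumes C: "\<And>i a b. expectation (\<lambda>\<omega>. (pair_noise i a b \<omega>)\<^sup>2) \<le> C"
  assumes "(c, d) = (a, b) \<or> (c, d) = (b, a)"
  shows "0 \<le> expectation (\<lambda>\<omega>. pair_noise i a b \<omega> * pair_noise i c d \<omega>)"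
    and "expectation (\<lambda>\<omega>. pair_noise i a b \<omega> * pair_noise i c d \<omega>) \<le> C"
  using assms(2) C[of i a b] pair_noise_commute[of i b a] by (auto simp: power2_eq_square)

lemma first_return_minus_trace:
  assumes "finite S" "i \<in> S"
  shows "first_return (entry Z \<omega>) S i (Suc (Suc k)) - closed_walk_sum (entry Z \<omega>) (S - {i}) k
    = (\<Sum>p\<in>(S - {i}) \<times> (S - {i}). pair_noise i (fst p) (snd p) \<omega> * walk_sum (entry Z \<omega>) (S - {i}) k (fst p) (snd p))"
proof -
  let ?w = "entry Z \<omega>" and ?S = "S - {i}"
  have fin: "finite ?S" using assms by auto
  have "closed_walk_sum ?w ?S k = (\<Sum>a\<in>?S. \<Sum>b\<in>?S. (if a = b then 1 else 0) * walk_sum ?w ?S k a b)"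
    unfolding closed_walk_sum_def using fin
    by (intro sum.cong) (simp_all add: if_distrib [of "\<lambda>x. x * _"] sum.delta cong: if_cong)
  then show ?thesis
    unfolding sum.cartesian_product' first_return.simps
    by (simp only: sum_subtractf[symmetric] fst_conv snd_conv)
       (intro sum.cong refl, simp add: pair_noise_def algebra_simps)
qed

lemma walk_sum_entry_sym:
  assumes "finite S" "a \<in> S" "b \<in> S"
  shows "walk_sum (entry Z \<omega>) S k a b = walk_sum (entry Z \<omega>) S k b a"
  by (rule walk_sum_sym) (use assms entry_sym in auto)

lemma sum_walk_sum_square:
  assumes "finite S"
  shows "(\<Sum>p\<in>S \<times> S. (walk_sum (entry Z \<omega>) S k (fst p) (snd p))\<^sup>2) = closed_walk_sum (entry Z \<omega>) S (2 * k)"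
proof -
  have "walk_sum (entry Z \<omega>) S (2 * k) a a = (\<Sum>b\<in>S. (walk_sum (entry Z \<omega>) S k a b)\<^sup>2)" if "a \<in> S" for a
    unfolding mult_2 walk_sum_add[OF assms that]
    using walk_sum_entry_sym[OF assms that] by (intro sum.cong) (auto simp: power2_eq_square)
  then show ?thesis
    unfolding sum.cartesian_product' by (simp add: closed_walk_sum_def)
qed

text \<open>The row of \<open>i\<close> is independent of the matrix on \<open>S - {i}\<close>, so the quadratic form concentrates at
  its conditional mean, the trace. In the second moment, a double sum over pairs \<open>p\<close> and \<open>q\<close>, only
  \<open>q = p\<close> and \<open>q = prod.swap p\<close> survive, and what remains is a multiple of the expected
  number of closed walks of length \<open>2 k\<close>. Since the first return weight has length \<open>k + 2\<close>, this
  is smaller by a factor \<open>card S\<close> than the square of the natural scale.\<close>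
lemma first_return_variance:
  "\<exists>C\<ge>0. \<forall>S i. finite S \<and> i \<in> S \<longrightarrow>
    expectation (\<lambda>\<omega>. (first_return (entry Z \<omega>) S i (Suc (Suc k))
                         - closed_walk_sum (entry Z \<omega>) (S - {i}) k)\<^sup>2) \<le> C * real (card S) ^ Suc k"
proof -
  obtain C where C: "C \<ge> 0" "\<And>i a b. expectation (\<lambda>\<omega>. (pair_noise i a b \<omega>)\<^sup>2) \<le> C"
    using pair_noise_covariance_bound by blast
  obtain B where B: "B \<ge> 0" "\<And>S a. finite S \<Longrightarrow> a \<in> S \<Longrightarrow>
     expectation (\<lambda>\<omega>. walk_sum (entry Z \<omega>) S (2 * k) a a) \<le> B * real (card S) ^ k"
    using expectation_walk_sum_even_le[of k] by blast
  show ?thesis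
  proof (intro exI[of _ "2 * C * B"] conjI allI impI)
    show "0 \<le> 2 * C * B" using B C by simp
    fix S i assume "finite S \<and> i \<in> (S :: nat set)"
    then have S: "finite S" "i \<in> S" by auto
    define T where "T = S - {i}"
    define P where "P = T \<times> T"
    have fin: "finite T" "finite P" using S by (auto simp: T_def P_def)
    define R where "R = (\<lambda>p \<omega>. walk_sum (entry Z \<omega>) T k (fst p) (snd p))"
    define X where "X = (\<lambda>p \<omega>. pair_noise i (fst p) (snd p) \<omega>)"
    define J K where "J = {edge a b |a b. a \<in> T \<and> b \<in> T}" and "K = edge i ` T"
    have JK: "K \<inter> J = {}" by (auto simp: J_def K_def T_def edge_eq_iff)
    have Rm: "has_moments M (R p)" and Xm: "has_moments M (X p)" for p
      unfolding R_def X_def by (rule has_moments_walk_sum has_moments_pair_noise)+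
    have Rs: "R p \<in> borel_measurable (sub_algebra J)" and Xs: "X p \<in> borel_measurable (sub_algebra K)"
      if "p \<in> P" for p
      unfolding R_def X_def using that
      by (auto intro!: walk_sum_sub_algebra pair_noise_sub_algebra simp: P_def J_def K_def)
    have Rsw: "R (prod.swap p) = R p" if "p \<in> P" for p
      unfolding R_def using that by (auto simp: P_def intro!: walk_sum_entry_sym fin)
    have indep: "expectation (\<lambda>\<omega>. (X p \<omega> * X q \<omega>) * (R p \<omega> * R q \<omega>))
        = expectation (\<lambda>\<omega>. X p \<omega> * X q \<omega>) * expectation (\<lambda>\<omega>. R p \<omega> * R q \<omega>)" if "p \<in> P" "q \<in> P" for p q
      by (rule expectation_mult_indep[OF _ _ JK])
         (intro borel_measurable_times has_moments_mult Rm Xm Rs Xs that)+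
    have row: "(\<Sum>q\<in>P. expectation (\<lambda>\<omega>. (X p \<omega> * X q \<omega>) * (R p \<omega> * R q \<omega>)))
        \<le> 2 * C * expectation (\<lambda>\<omega>. (R p \<omega>)\<^sup>2)" if p: "p \<in> P" for p
    proof -
      let ?g = "\<lambda>q. expectation (\<lambda>\<omega>. (X p \<omega> * X q \<omega>) * (R p \<omega> * R q \<omega>))"
      have sub: "{p, prod.swap p} \<subseteq> P" using p by (auto simp: P_def)
      have "(\<Sum>q\<in>P. ?g q) = (\<Sum>q\<in>{p, prod.swap p}. ?g q)"
      proof (rule sum.mono_neutral_right[OF fin(2) sub], rule ballI)
        fix q assume "q \<in> P - {p, prod.swap p}"
        then have q: "q \<in> P" "q \<noteq> p" "q \<noteq> prod.swap p" by auto
        have "expectation (\<lambda>\<omega>. X p \<omega> * X q \<omega>) = 0"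
          unfolding X_def using q by (intro pair_noise_orthogonal) (auto simp: prod_eq_iff)
        then show "?g q = 0" using indep[OF p q(1)] by simp
      qed
      also have "\<dots> \<le> (\<Sum>q\<in>{p, prod.swap p}. C * expectation (\<lambda>\<omega>. (R p \<omega>)\<^sup>2))"
      proof (rule sum_mono)
        fix q assume q: "q \<in> {p, prod.swap p}"
        then have "?g q = expectation (\<lambda>\<omega>. X p \<omega> * X q \<omega>) * expectation (\<lambda>\<omega>. (R p \<omega>)\<^sup>2)"
          using indep[OF p, of q] sub Rsw[OF p] by (auto simp: power2_eq_square)
        also have "\<dots> \<le> C * expectation (\<lambda>\<omega>. (R p \<omega>)\<^sup>2)"
          unfolding X_def using q
          by (intro mult_right_mono pair_noise_covariance_le(2)[OF C(2)] integral_nonneg_AE)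
             (auto simp: prod.swap_def)
        finally show "?g q \<le> C * expectation (\<lambda>\<omega>. (R p \<omega>)\<^sup>2)" .
      qed
      also have "\<dots> \<le> 2 * C * expectation (\<lambda>\<omega>. (R p \<omega>)\<^sup>2)"
      proof -
        have "card {p, prod.swap p} \<le> 2" by (simp add: card_insert_if)
        then have "real (card {p, prod.swap p}) \<le> 2" by simp
        moreover have "0 \<le> C * expectation (\<lambda>\<omega>. (R p \<omega>)\<^sup>2)"
          using C(1) by (intro mult_nonneg_nonneg integral_nonneg_AE) auto
        ultimately show ?thesis
          unfolding sum_constant mult.assoc[of 2] by (rule mult_right_mono)
      qed
      finally show ?thesis .
    qed
    have "expectation (\<lambda>\<omega>. (first_return (entry Z \<omega>) S i (Suc (Suc k)) - closed_walk_sum (entry Z \<omega>) (S - {i}) k)\<^sup>2)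
        = expectation (\<lambda>\<omega>. \<Sum>p\<in>P. \<Sum>q\<in>P. (X p \<omega> * X q \<omega>) * (R p \<omega> * R q \<omega>))"
      unfolding first_return_minus_trace[OF S] power2_eq_square sum_product
      by (simp add: X_def R_def P_def T_def mult_ac)
    also have "\<dots> = (\<Sum>p\<in>P. \<Sum>q\<in>P. expectation (\<lambda>\<omega>. (X p \<omega> * X q \<omega>) * (R p \<omega> * R q \<omega>)))"
      by (simp add: Bochner_Integration.integral_sum has_moments_integrable has_moments_mult has_moments_sum Rm Xm)
    also have "\<dots> \<le> (\<Sum>p\<in>P. 2 * C * expectation (\<lambda>\<omega>. (R p \<omega>)\<^sup>2))"
      by (intro sum_mono row)
    also have "\<dots> = 2 * C * expectation (\<lambda>\<omega>. \<Sum>p\<in>P. (R p \<omega>)\<^sup>2)"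
      by (simp add: sum_distrib_left Bochner_Integration.integral_sum has_moments_integrable has_moments_power Rm)
    also have "\<dots> = 2 * C * (\<Sum>a\<in>T. expectation (\<lambda>\<omega>. walk_sum (entry Z \<omega>) T (2 * k) a a))"
      unfolding R_def P_def sum_walk_sum_square[OF fin(1)] closed_walk_sum_def
      by (simp add: Bochner_Integration.integral_sum has_moments_integrable has_moments_walk_sum)
    also have "\<dots> \<le> 2 * C * (\<Sum>a\<in>T. B * real (card T) ^ k)"
      using C(1) by (intro mult_left_mono sum_mono B(2) fin) auto
    also have "\<dots> = 2 * C * B * real (card T) ^ Suc k" by simp
    also have "\<dots> \<le> 2 * C * B * real (card S) ^ Suc k"
      using C(1) B(1) S by (intro mult_left_mono power_mono) (auto simp: T_def intro: card_mono)
    finally show "expectation (\<lambda>\<omega>. (first_return (entry Z \<omega>) S i (Suc (Suc k))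
                         - closed_walk_sum (entry Z \<omega>) (S - {i}) k)\<^sup>2) \<le> 2 * C * B * real (card S) ^ Suc k" .
  qed
qed

end


section \<open>The limiting moments\<close>

text \<open>The Catalan numbers, interspersed with zeros.\<close>
fun semicircle_moment :: "nat \<Rightarrow> real" where
  "semicircle_moment 0 = 1"
| "semicircle_moment (Suc 0) = 0"
| "semicircle_moment (Suc (Suc k)) = (\<Sum>i\<le>k. semicircle_moment i * semicircle_moment (k - i))"

text \<open>The first return weights that belong to closed walk weights \<open>semicircle_moment\<close>: removing the
  first and the last step of an excursion leaves an arbitrary closed walk.\<close>
fun semicircle_return :: "nat \<Rightarrow> real" where
  "semicircle_return 0 = 0"
| "semicircle_return (Suc 0) = 0"
| "semicircle_return (Suc (Suc k)) = semicircle_moment k"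

text \<open>The recursion is that of \<open>closed_walk_sum_diff\<close>. Its solution is the moment sequence of the
  arcsine law on the interval from -2 to 2, as \<open>integral_sin_power\<close> shows.\<close>
fun arcsine_moment :: "nat \<Rightarrow> real" where
  "arcsine_moment 0 = 1"
| "arcsine_moment (Suc k) = real k * semicircle_return (Suc k)
     + (\<Sum>j\<le>k. semicircle_return (Suc j) * arcsine_moment (k - j))"

lemma semicircle_moment_renewal:
  "semicircle_moment (Suc k) = (\<Sum>j\<le>k. semicircle_return (Suc j) * semicircle_moment (k - j))"
  by (cases k) (simp_all add: sum.atMost_Suc_shift del: sum.atMost_Suc)

text \<open>The generating functions \<open>f\<close> of the returns and \<open>p\<close> of the arcsine moments satisfy
  \<open>f = X^2 + f^2\<close> and \<open>p * (1 - 2 f) = 1\<close>, so \<open>p\<close> is the inverse of the square root \<open>q\<close> of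
  \<open>1 - 4 X^2\<close>. Differentiating \<open>p * q = 1\<close> gives \<open>p' * (1 - 4 X^2) = 4 X p\<close>, which is the
  Wallis recurrence for the coefficients.\<close>
lemma arcsine_moment_recurrence:
  "real (Suc (Suc k)) * arcsine_moment (Suc (Suc k)) = 4 * real (Suc k) * arcsine_moment k"
proof -
  define m f p where "m = Abs_fps semicircle_moment" and "f = Abs_fps semicircle_return"
    and "p = Abs_fps arcsine_moment"
  have m: "m = 1 + f * m"
  proof (rule fps_ext)
    fix n
    show "fps_nth m n = fps_nth (1 + f * m) n"
      by (cases n) (simp_all add: m_def f_def fps_mult_nth atLeast0AtMost semicircle_moment_renewal
          sum.atMost_Suc_shift del: sum.atMost_Suc semicircle_moment.simps(3))
  qed
  have f: "f = fps_X\<^sup>2 * m"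
  proof (rule fps_ext)
    fix n
    show "fps_nth f n = fps_nth (fps_X\<^sup>2 * m) n"
      by (cases n rule: semicircle_return.cases) (simp_all add: m_def f_def fps_X_power_mult_nth)
  qed
  have p: "p = f * p + 1 - f + fps_X * fps_deriv f"
  proof (rule fps_ext)
    fix n
    show "fps_nth p n = fps_nth (f * p + 1 - f + fps_X * fps_deriv f) n"
    proof (cases n)
      case (Suc k)
      have "fps_nth (f * p) (Suc k) = (\<Sum>j\<le>k. semicircle_return (Suc j) * arcsine_moment (k - j))"
        by (simp add: p_def f_def fps_mult_nth atLeast0AtMost sum.atMost_Suc_shift
            del: sum.atMost_Suc arcsine_moment.simps)
      then show ?thesis using Suc by (simp add: p_def f_def algebra_simps)
    qed (simp add: p_def f_def)
  qed
  have ff: "f = fps_X\<^sup>2 + f * f"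
  proof -
    have "f = fps_X\<^sup>2 * (1 + f * m)" using f m by simp
    also have "\<dots> = fps_X\<^sup>2 + f * (fps_X\<^sup>2 * m)" by (simp add: algebra_simps)
    finally show ?thesis using f by simp
  qed
  have df: "fps_deriv f = 2 * fps_X + 2 * f * fps_deriv f"
  proof -
    have "fps_deriv f = fps_deriv (fps_X\<^sup>2 + f * f)" using ff by simp
    then show ?thesis by (simp add: power2_eq_square algebra_simps)
  qed
  define q where "q = 1 - 2 * f"
  have qq: "q * q = 1 - 4 * fps_X\<^sup>2"
  proof -
    have "q * q = 1 - 4 * (f - f * f)" by (simp add: q_def algebra_simps)
    also have "f - f * f = fps_X\<^sup>2" using ff by (simp add: algebra_simps)
    finally show ?thesis .
  qed
  have "(1 - f) * (p * q) = (1 - f) * 1"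
  proof -
    have "p * (1 - f) = 1 - f + fps_X * fps_deriv f" using p by (simp add: algebra_simps)
    moreover have "fps_deriv f * q = 2 * fps_X" using df by (simp add: q_def algebra_simps)
    ultimately have "p * (1 - f) * q = (1 - f) * q + fps_X * (2 * fps_X)"
      by (simp only: distrib_right mult.assoc)
    then have "p * (1 - f) * q = (1 - f) * q + 2 * fps_X\<^sup>2"
      by (simp add: power2_eq_square mult_ac)
    also have "fps_X\<^sup>2 = f - f * f" using ff by (simp add: algebra_simps)
    finally have "p * (1 - f) * q = 1 - f" by (simp add: q_def algebra_simps)
    then show ?thesis by (simp add: mult_ac)
  qed
  moreover have "1 - f \<noteq> 0"
  proof
    assume "1 - f = 0"
    then have "fps_nth (1 - f) 0 = 0" by simp
    then show False by (simp add: f_def)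
  qed
  ultimately have pq: "p * q = 1"
    unfolding mult_left_cancel by simp
  have dq: "q * fps_deriv q = - 4 * fps_X"
  proof -
    have "fps_deriv (q * q) = fps_deriv (1 - 4 * fps_X\<^sup>2)" using qq by simp
    then have "2 * (q * fps_deriv q) = 2 * (- 4 * fps_X)" by (simp add: power2_eq_square algebra_simps)
    then show ?thesis by (subst (asm) mult_left_cancel) auto
  qed
  have "fps_deriv (p * q) = 0" using pq by simp
  then have dp: "fps_deriv p * q = - (p * fps_deriv q)" by (simp add: algebra_simps eq_neg_iff_add_eq_0)
  have "fps_deriv p * (1 - 4 * fps_X\<^sup>2) = (fps_deriv p * q) * q" using qq by (simp add: mult.assoc)
  also have "\<dots> = - (p * (q * fps_deriv q))" unfolding dp by (simp add: mult_ac)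
  also have "\<dots> = 4 * fps_X * p" unfolding dq by simp
  finally have "fps_deriv p - 4 * (fps_X\<^sup>2 * fps_deriv p) = 4 * (fps_X * p)"
    by (simp add: algebra_simps)
  then have "fps_nth (fps_deriv p - 4 * (fps_X\<^sup>2 * fps_deriv p)) (Suc k) = fps_nth (4 * (fps_X * p)) (Suc k)"
    by (rule arg_cong)
  then have "real (Suc (Suc k)) * arcsine_moment (Suc (Suc k)) - 4 * (real k * arcsine_moment k) = 4 * arcsine_moment k"
    by (cases k) (simp_all add: p_def fps_X_power_mult_nth numeral_fps_const del: arcsine_moment.simps)
  then show ?thesis by (simp add: algebra_simps del: arcsine_moment.simps)
qed

lemma arcsine_moment_1: "arcsine_moment (Suc 0) = 0" by simp

section \<open>Convergence in probability\<close>

context prob_space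
begin

text \<open>The index runs through a filter on an arbitrary type, because the moment recursion needs estimates
  that are uniform over all index sets of a given size and all their points.\<close>
definition converges_in_prob :: "('i \<Rightarrow> 'a \<Rightarrow> real) \<Rightarrow> real \<Rightarrow> 'i filter \<Rightarrow> bool" where
  "converges_in_prob Y c F \<longleftrightarrow> (\<forall>i. Y i \<in> borel_measurable M) \<and>
     (\<forall>\<epsilon>>0. ((\<lambda>i. prob {\<omega> \<in> space M. \<epsilon> < \<bar>Y i \<omega> - c\<bar>}) \<longlongrightarrow> 0) F)"

lemma converges_in_prob_measurable: "converges_in_prob Y c F \<Longrightarrow> Y i \<in> borel_measurable M"
  by (simp add: converges_in_prob_def)

lemma converges_in_prob_compose:
  assumes "converges_in_prob Y c F" "filterlim g F G"
  shows "converges_in_prob (\<lambda>j. Y (g j)) c G"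
  using assms unfolding converges_in_prob_def by (auto intro: filterlim_compose)

lemma converges_in_prob_cong:
  assumes "converges_in_prob Y c F" "eventually (\<lambda>i. Y i = Y' i) F" "\<And>i. Y' i \<in> borel_measurable M"
  shows "converges_in_prob Y' c F"
  unfolding converges_in_prob_def
proof (intro conjI allI impI)
  fix \<epsilon> :: real assume "\<epsilon> > 0"
  then have *: "((\<lambda>i. prob {\<omega> \<in> space M. \<epsilon> < \<bar>Y i \<omega> - c\<bar>}) \<longlongrightarrow> 0) F"
    using assms(1) by (simp add: converges_in_prob_def)
  show "((\<lambda>i. prob {\<omega> \<in> space M. \<epsilon> < \<bar>Y' i \<omega> - c\<bar>}) \<longlongrightarrow> 0) F"
    by (rule Lim_transform_eventually[OF *]) (use assms(2) in \<open>auto elim: eventually_mono\<close>)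
qed (rule assms(3))

lemma converges_in_prob_deterministic:
  assumes "(x \<longlongrightarrow> c) F"
  shows "converges_in_prob (\<lambda>i _. x i) c F"
  unfolding converges_in_prob_def
proof (intro conjI allI impI)
  fix \<epsilon> :: real assume \<epsilon>: "\<epsilon> > 0"
  show "((\<lambda>i. prob {\<omega> \<in> space M. \<epsilon> < \<bar>x i - c\<bar>}) \<longlongrightarrow> 0) F"
  proof (rule tendsto_eventually)
    have "eventually (\<lambda>i. dist (x i) c < \<epsilon>) F" using assms \<epsilon> by (rule tendstoD)
    then show "\<forall>\<^sub>F i in F. prob {\<omega> \<in> space M. \<epsilon> < \<bar>x i - c\<bar>} = 0"
      by eventually_elim (auto simp: dist_real_def)
  qed
qed simp

lemma converges_in_prob_combine:
  assumes X: "converges_in_prob X a F" and Y: "converges_in_prob Y b F"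
    and W: "\<And>i. W i \<in> borel_measurable M"
    and cont: "\<And>\<epsilon>. \<epsilon> > 0 \<Longrightarrow> \<exists>\<delta>>0. \<forall>i \<omega>. \<bar>X i \<omega> - a\<bar> \<le> \<delta> \<longrightarrow> \<bar>Y i \<omega> - b\<bar> \<le> \<delta> \<longrightarrow> \<bar>W i \<omega> - c\<bar> \<le> \<epsilon>"
  shows "converges_in_prob W c F"
  unfolding converges_in_prob_def
proof (intro conjI allI impI W)
  fix \<epsilon> :: real assume "\<epsilon> > 0"
  then obtain \<delta> where \<delta>: "\<delta> > 0"
    "\<And>i \<omega>. \<bar>X i \<omega> - a\<bar> \<le> \<delta> \<Longrightarrow> \<bar>Y i \<omega> - b\<bar> \<le> \<delta> \<Longrightarrow> \<bar>W i \<omega> - c\<bar> \<le> \<epsilon>"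
    using cont by meson
  note [measurable] = converges_in_prob_measurable[OF X] converges_in_prob_measurable[OF Y] W
  have "((\<lambda>i. prob {\<omega> \<in> space M. \<delta> < \<bar>X i \<omega> - a\<bar>} + prob {\<omega> \<in> space M. \<delta> < \<bar>Y i \<omega> - b\<bar>}) \<longlongrightarrow> 0 + 0) F"
    using X Y \<delta>(1) by (intro tendsto_add) (auto simp: converges_in_prob_def)
  then have lim: "((\<lambda>i. prob {\<omega> \<in> space M. \<delta> < \<bar>X i \<omega> - a\<bar>} + prob {\<omega> \<in> space M. \<delta> < \<bar>Y i \<omega> - b\<bar>}) \<longlongrightarrow> 0) F"
    by simp
  show "((\<lambda>i. prob {\<omega> \<in> space M. \<epsilon> < \<bar>W i \<omega> - c\<bar>}) \<longlongrightarrow> 0) F"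
  proof (rule tendsto_sandwich[OF _ _ tendsto_const lim])
    show "\<forall>\<^sub>F i in F. prob {\<omega> \<in> space M. \<epsilon> < \<bar>W i \<omega> - c\<bar>}
        \<le> prob {\<omega> \<in> space M. \<delta> < \<bar>X i \<omega> - a\<bar>} + prob {\<omega> \<in> space M. \<delta> < \<bar>Y i \<omega> - b\<bar>}"
    proof (intro always_eventually allI)
      fix i
      have "prob {\<omega> \<in> space M. \<epsilon> < \<bar>W i \<omega> - c\<bar>}
          \<le> prob ({\<omega> \<in> space M. \<delta> < \<bar>X i \<omega> - a\<bar>} \<union> {\<omega> \<in> space M. \<delta> < \<bar>Y i \<omega> - b\<bar>})"
      proof (rule finite_measure_mono)
        show "{\<omega> \<in> space M. \<epsilon> < \<bar>W i \<omega> - c\<bar>} \<subseteq> {\<omega> \<in> space M. \<delta> < \<bar>X i \<omega> - a\<bar>} \<union> {\<omega> \<in> space M. \<delta> < \<bar>Y i \<omega> - b\<bar>}"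
        proof (rule subsetI, rule ccontr)
          fix \<omega>
          assume *: "\<omega> \<in> {\<omega> \<in> space M. \<epsilon> < \<bar>W i \<omega> - c\<bar>}"
            "\<omega> \<notin> {\<omega> \<in> space M. \<delta> < \<bar>X i \<omega> - a\<bar>} \<union> {\<omega> \<in> space M. \<delta> < \<bar>Y i \<omega> - b\<bar>}"
          then have "\<bar>X i \<omega> - a\<bar> \<le> \<delta>" "\<bar>Y i \<omega> - b\<bar> \<le> \<delta>" by auto
          from \<delta>(2)[OF this] * show False by simp
        qed
      qed measurable
      also have "\<dots> \<le> prob {\<omega> \<in> space M. \<delta> < \<bar>X i \<omega> - a\<bar>} + prob {\<omega> \<in> space M. \<delta> < \<bar>Y i \<omega> - b\<bar>}"
        by (rule measure_Un_le) measurable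
      finally show "prob {\<omega> \<in> space M. \<epsilon> < \<bar>W i \<omega> - c\<bar>}
        \<le> prob {\<omega> \<in> space M. \<delta> < \<bar>X i \<omega> - a\<bar>} + prob {\<omega> \<in> space M. \<delta> < \<bar>Y i \<omega> - b\<bar>}" .
    qed
  qed simp
qed

lemma converges_in_prob_add:
  assumes X: "converges_in_prob X a F" and Y: "converges_in_prob Y b F"
  shows "converges_in_prob (\<lambda>i \<omega>. X i \<omega> + Y i \<omega>) (a + b) F"
proof (rule converges_in_prob_combine[OF X Y])
  note [measurable] = converges_in_prob_measurable[OF X] converges_in_prob_measurable[OF Y]
  show "(\<lambda>\<omega>. X i \<omega> + Y i \<omega>) \<in> borel_measurable M" for i by measurable
  fix \<epsilon> :: real assume "\<epsilon> > 0"
  then show "\<exists>\<delta>>0. \<forall>i \<omega>. \<bar>X i \<omega> - a\<bar> \<le> \<delta> \<longrightarrow> \<bar>Y i \<omega> - b\<bar> \<le> \<delta> \<longrightarrow> \<bar>X i \<omega> + Y i \<omega> - (a + b)\<bar> \<le> \<epsilon>"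
    by (intro exI[of _ "\<epsilon> / 2"] conjI allI impI) linarith+
qed

lemma converges_in_prob_mult:
  assumes X: "converges_in_prob X a F" and Y: "converges_in_prob Y b F"
  shows "converges_in_prob (\<lambda>i \<omega>. X i \<omega> * Y i \<omega>) (a * b) F"
proof (rule converges_in_prob_combine[OF X Y])
  note [measurable] = converges_in_prob_measurable[OF X] converges_in_prob_measurable[OF Y]
  show "(\<lambda>\<omega>. X i \<omega> * Y i \<omega>) \<in> borel_measurable M" for i by measurable
  fix \<epsilon> :: real assume \<epsilon>: "\<epsilon> > 0"
  define \<delta> where "\<delta> = min 1 (\<epsilon> / (1 + \<bar>a\<bar> + \<bar>b\<bar>))"
  have \<delta>: "\<delta> > 0" "\<delta> \<le> 1" "\<delta> * (1 + \<bar>a\<bar> + \<bar>b\<bar>) \<le> \<epsilon>"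
    using \<epsilon> by (auto simp: \<delta>_def min_def field_simps add_pos_nonneg)
  have "\<bar>x * y - a * b\<bar> \<le> \<epsilon>" if "\<bar>x - a\<bar> \<le> \<delta>" "\<bar>y - b\<bar> \<le> \<delta>" for x y
  proof -
    have "x * y - a * b = (x - a) * (y - b) + a * (y - b) + (x - a) * b" by (simp add: algebra_simps)
    also have "\<bar>\<dots>\<bar> \<le> \<bar>x - a\<bar> * \<bar>y - b\<bar> + \<bar>a\<bar> * \<bar>y - b\<bar> + \<bar>x - a\<bar> * \<bar>b\<bar>"
      unfolding abs_mult[symmetric] by (rule order_trans[OF abs_triangle_ineq add_right_mono[OF abs_triangle_ineq]])
    also have "\<dots> \<le> \<delta> * 1 + \<bar>a\<bar> * \<delta> + \<delta> * \<bar>b\<bar>"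
      using that \<delta> by (intro add_mono mult_mono) auto
    also have "\<dots> \<le> \<epsilon>" using \<delta>(3) by (simp add: algebra_simps)
    finally show ?thesis .
  qed
  then show "\<exists>\<delta>>0. \<forall>i \<omega>. \<bar>X i \<omega> - a\<bar> \<le> \<delta> \<longrightarrow> \<bar>Y i \<omega> - b\<bar> \<le> \<delta> \<longrightarrow> \<bar>X i \<omega> * Y i \<omega> - a * b\<bar> \<le> \<epsilon>"
    using \<delta>(1) by blast
qed

lemma converges_in_prob_sum:
  assumes "\<And>j. j \<in> J \<Longrightarrow> converges_in_prob (X j) (a j) F"
  shows "converges_in_prob (\<lambda>i \<omega>. \<Sum>j\<in>J. X j i \<omega>) (\<Sum>j\<in>J. a j) F"
  using assms
proof (induction J rule: infinite_finite_induct)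
  case (insert j J)
  have "converges_in_prob (\<lambda>i \<omega>. X j i \<omega> + (\<Sum>j\<in>J. X j i \<omega>)) (a j + (\<Sum>j\<in>J. a j)) F"
    using insert by (intro converges_in_prob_add) auto
  then show ?case using insert by simp
qed (auto intro: converges_in_prob_deterministic)

lemma converges_in_prob_L1:
  assumes int: "\<And>i. integrable M (\<lambda>\<omega>. Y i \<omega>)"
    and lim: "((\<lambda>i. expectation (\<lambda>\<omega>. \<bar>Y i \<omega> - c\<bar>)) \<longlongrightarrow> 0) F"
  shows "converges_in_prob Y c F"
  unfolding converges_in_prob_def
proof (intro conjI allI impI)
  show "Y i \<in> borel_measurable M" for i using int[of i] by simp
  fix \<epsilon> :: real assume \<epsilon>: "\<epsilon> > 0"
  have lim': "((\<lambda>i. expectation (\<lambda>\<omega>. \<bar>Y i \<omega> - c\<bar>) / \<epsilon>) \<longlongrightarrow> 0) F"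
    using tendsto_divide[OF lim tendsto_const, of \<epsilon>] \<epsilon> by simp
  show "((\<lambda>i. prob {\<omega> \<in> space M. \<epsilon> < \<bar>Y i \<omega> - c\<bar>}) \<longlongrightarrow> 0) F"
  proof (rule tendsto_sandwich[OF _ _ tendsto_const lim'])
    show "\<forall>\<^sub>F i in F. prob {\<omega> \<in> space M. \<epsilon> < \<bar>Y i \<omega> - c\<bar>} \<le> expectation (\<lambda>\<omega>. \<bar>Y i \<omega> - c\<bar>) / \<epsilon>"
    proof (intro always_eventually allI)
      fix i
      have [measurable]: "Y i \<in> borel_measurable M" using int[of i] by simp
      have "prob {\<omega> \<in> space M. \<epsilon> < \<bar>Y i \<omega> - c\<bar>} \<le> prob {\<omega> \<in> space M. \<bar>Y i \<omega> - c\<bar> \<ge> \<epsilon>}"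
        by (rule finite_measure_mono) auto
      also have "\<dots> \<le> expectation (\<lambda>\<omega>. \<bar>Y i \<omega> - c\<bar>) / \<epsilon>"
        using int \<epsilon> by (intro integral_Markov_inequality_measure[of _ _ "{}"]) auto
      finally show "prob {\<omega> \<in> space M. \<epsilon> < \<bar>Y i \<omega> - c\<bar>} \<le> expectation (\<lambda>\<omega>. \<bar>Y i \<omega> - c\<bar>) / \<epsilon>" .
    qed
  qed simp
qed

text \<open>Where \<open>\<bar>Y\<bar> > \<epsilon>\<close>, use \<open>y \<le> \<eta> y^2 + 1 / \<eta>\<close>, a weak form of the inequality of the means.\<close>
lemma L1_le_prob:
  assumes [measurable]: "Y \<in> borel_measurable M" and int: "integrable M (\<lambda>\<omega>. (Y \<omega>)\<^sup>2)" "integrable M Y"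
    and "\<epsilon> > 0" "\<eta> > 0"
  shows "expectation (\<lambda>\<omega>. \<bar>Y \<omega>\<bar>) \<le> \<epsilon> + \<eta> * expectation (\<lambda>\<omega>. (Y \<omega>)\<^sup>2) + prob {\<omega> \<in> space M. \<epsilon> < \<bar>Y \<omega>\<bar>} / \<eta>"
proof -
  let ?A = "{\<omega> \<in> space M. \<epsilon> < \<bar>Y \<omega>\<bar>}"
  have A: "integrable M (\<lambda>\<omega>. indicat_real ?A \<omega> / \<eta>)"
    by (intro integrable_divide_zero integrable_real_indicator) (auto simp: emeasure_eq_measure)
  have "expectation (\<lambda>\<omega>. \<bar>Y \<omega>\<bar>) \<le> expectation (\<lambda>\<omega>. \<epsilon> + \<eta> * (Y \<omega>)\<^sup>2 + indicat_real ?A \<omega> / \<eta>)"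
  proof (rule integral_mono)
    show "integrable M (\<lambda>\<omega>. \<epsilon> + \<eta> * (Y \<omega>)\<^sup>2 + indicat_real ?A \<omega> / \<eta>)"
      using int A by auto
    fix \<omega> assume \<omega>: "\<omega> \<in> space M"
    show "\<bar>Y \<omega>\<bar> \<le> \<epsilon> + \<eta> * (Y \<omega>)\<^sup>2 + indicat_real ?A \<omega> / \<eta>"
    proof (cases "\<epsilon> < \<bar>Y \<omega>\<bar>")
      case True
      define y where "y = \<bar>Y \<omega>\<bar>"
      have "0 \<le> (\<eta> * y - 1)\<^sup>2" by simp
      then have "2 * (\<eta> * y) \<le> \<eta> * (\<eta> * y\<^sup>2) + 1" by (simp add: power2_eq_square algebra_simps)
      moreover have "\<eta> * y \<ge> 0" using assms by (simp add: y_def)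
      ultimately have "\<eta> * y \<le> \<eta> * (\<eta> * y\<^sup>2 + 1 / \<eta>)"
        using assms by (simp add: algebra_simps)
      then have "y \<le> \<eta> * y\<^sup>2 + 1 / \<eta>" using assms by (simp add: mult_le_cancel_left_pos)
      then show ?thesis using True \<omega> assms by (simp add: y_def)
    next
      case False
      then show ?thesis using assms by (simp add: add_increasing2)
    qed
  qed (use int in auto)
  also have "\<dots> = \<epsilon> + \<eta> * expectation (\<lambda>\<omega>. (Y \<omega>)\<^sup>2) + prob ?A / \<eta>"
    using int A by (simp add: prob_space)
  finally show ?thesis .
qed

text \<open>Bounded second moments give uniform integrability. The constant \<open>B'\<close> bounds the second moments
  of the centred variables, and \<open>\<eta>\<close> is chosen such that the middle term of \<open>L1_le_prob\<close> is small.\<close>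
lemma converges_in_prob_imp_L1:
  assumes Y: "converges_in_prob Y c F" and int: "\<And>i. has_moments M (Y i)"
    and bd: "eventually (\<lambda>i. expectation (\<lambda>\<omega>. (Y i \<omega>)\<^sup>2) \<le> B) F"
  shows "((\<lambda>i. expectation (\<lambda>\<omega>. \<bar>Y i \<omega> - c\<bar>)) \<longlongrightarrow> 0) F"
proof (rule tendstoI)
  fix \<epsilon> :: real assume \<epsilon>: "\<epsilon> > 0"
  define B' where "B' = 2 * \<bar>B\<bar> + 2 * c\<^sup>2 + 1"
  have B': "B' > 0" by (simp add: B'_def add_nonneg_pos)
  define \<eta> where "\<eta> = \<epsilon> / (4 * B')"
  have \<eta>: "\<eta> > 0" "\<eta> * B' = \<epsilon> / 4" using \<epsilon> B' by (auto simp: \<eta>_def field_simps)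
  have "((\<lambda>i. prob {\<omega> \<in> space M. \<epsilon> / 4 < \<bar>Y i \<omega> - c\<bar>}) \<longlongrightarrow> 0) F"
    using conjunct2[OF Y[unfolded converges_in_prob_def], rule_format, of "\<epsilon> / 4"] \<epsilon> by simp
  then have "eventually (\<lambda>i. prob {\<omega> \<in> space M. \<epsilon> / 4 < \<bar>Y i \<omega> - c\<bar>} < \<eta> * (\<epsilon> / 4)) F"
    by (rule order_tendstoD) (use \<eta> \<epsilon> in simp)
  with bd show "eventually (\<lambda>i. dist (expectation (\<lambda>\<omega>. \<bar>Y i \<omega> - c\<bar>)) 0 < \<epsilon>) F"
  proof eventually_elim
    case (elim i)
    have D: "has_moments M (\<lambda>\<omega>. Y i \<omega> - c)" by (intro has_moments_diff int has_moments_const)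
    have "expectation (\<lambda>\<omega>. (Y i \<omega> - c)\<^sup>2) \<le> expectation (\<lambda>\<omega>. 2 * (Y i \<omega>)\<^sup>2 + 2 * c\<^sup>2)"
    proof (intro integral_mono has_moments_integrable has_moments_intros int)
      fix \<omega>
      show "(Y i \<omega> - c)\<^sup>2 \<le> 2 * (Y i \<omega>)\<^sup>2 + 2 * c\<^sup>2"
        using zero_le_power2[of "Y i \<omega> + c"] by (simp add: power2_eq_square algebra_simps)
    qed
    also have "\<dots> = 2 * expectation (\<lambda>\<omega>. (Y i \<omega>)\<^sup>2) + 2 * c\<^sup>2"
      by (simp add: prob_space has_moments_integrable has_moments_power int)
    also have "\<dots> \<le> B'" using elim(1) by (simp add: B'_def)
    finally have "\<eta> * expectation (\<lambda>\<omega>. (Y i \<omega> - c)\<^sup>2) \<le> \<epsilon> / 4"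
      using \<eta> by (metis mult_left_mono less_imp_le)
    moreover have "prob {\<omega> \<in> space M. \<epsilon> / 4 < \<bar>Y i \<omega> - c\<bar>} / \<eta> < \<epsilon> / 4"
      using elim(2) \<eta>(1) by (simp add: field_simps)
    moreover have "expectation (\<lambda>\<omega>. \<bar>Y i \<omega> - c\<bar>) \<le> \<epsilon> / 4 + \<eta> * expectation (\<lambda>\<omega>. (Y i \<omega> - c)\<^sup>2)
        + prob {\<omega> \<in> space M. \<epsilon> / 4 < \<bar>Y i \<omega> - c\<bar>} / \<eta>"
      using \<epsilon> \<eta> by (intro L1_le_prob has_moments_measurable has_moments_integrable has_moments_power D) auto
    ultimately have "expectation (\<lambda>\<omega>. \<bar>Y i \<omega> - c\<bar>) < \<epsilon>"
      using \<epsilon> by linarith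
    then show ?case by (simp add: dist_real_def)
  qed
qed

lemma converges_in_prob_L2:
  assumes int: "\<And>i. has_moments M (Y i)"
    and lim: "((\<lambda>i. expectation (\<lambda>\<omega>. (Y i \<omega>)\<^sup>2)) \<longlongrightarrow> 0) F"
  shows "converges_in_prob Y 0 F"
  unfolding converges_in_prob_def
proof (intro conjI allI impI)
  show "Y i \<in> borel_measurable M" for i using int by (rule has_moments_measurable)
  fix \<epsilon> :: real assume \<epsilon>: "\<epsilon> > 0"
  have "converges_in_prob (\<lambda>i \<omega>. (Y i \<omega>)\<^sup>2) 0 F"
    by (rule converges_in_prob_L1) (use lim in \<open>auto intro!: has_moments_integrable has_moments_power int\<close>)
  moreover have "\<epsilon> < \<bar>y - 0\<bar> \<longleftrightarrow> \<epsilon>\<^sup>2 < \<bar>y\<^sup>2 - 0\<bar>" for y :: real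
    using \<epsilon> abs_le_square_iff[of y \<epsilon>] by (simp add: not_le[symmetric])
  ultimately show "((\<lambda>i. prob {\<omega> \<in> space M. \<epsilon> < \<bar>Y i \<omega> - 0\<bar>}) \<longlongrightarrow> 0) F"
    using \<epsilon> by (simp add: converges_in_prob_def del: diff_0_right)
qed

end


section \<open>The moment recursion\<close>

text \<open>Finite index sets, ordered by their size. A limit along this filter is uniform over all sets of the
  same size; the second filter does the same for sets with a distinguished point.\<close>
definition large_sets :: "nat set filter" where
  "large_sets = inf (filtercomap card at_top) (principal {S. finite S})"

definition large_pointed_sets :: "(nat set \<times> nat) filter" where
  "large_pointed_sets = inf (filtercomap (\<lambda>p. card (fst p)) at_top) (principal {p. finite (fst p) \<and> snd p \<in> fst p})"

lemma eventually_large_sets: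
  "eventually P large_sets \<longleftrightarrow> (\<exists>N. \<forall>S. finite S \<longrightarrow> N \<le> card S \<longrightarrow> P S)"
  by (auto simp: large_sets_def eventually_inf_principal eventually_filtercomap eventually_at_top_linorder)

lemma eventually_large_pointed_sets:
  "eventually P large_pointed_sets \<longleftrightarrow> (\<exists>N. \<forall>S i. finite S \<longrightarrow> i \<in> S \<longrightarrow> N \<le> card S \<longrightarrow> P (S, i))"
proof
  assume "eventually P large_pointed_sets"
  then show "\<exists>N. \<forall>S i. finite S \<longrightarrow> i \<in> S \<longrightarrow> N \<le> card S \<longrightarrow> P (S, i)"
    by (auto simp: large_pointed_sets_def eventually_inf_principal eventually_filtercomap eventually_at_top_linorder)
next
  assume "\<exists>N. \<forall>S i. finite S \<longrightarrow> i \<in> S \<longrightarrow> N \<le> card S \<longrightarrow> P (S, i)"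
  then obtain N where "\<forall>S i. finite S \<longrightarrow> i \<in> S \<longrightarrow> N \<le> card S \<longrightarrow> P (S, i)" by blast
  then show "eventually P large_pointed_sets"
    unfolding large_pointed_sets_def eventually_inf_principal eventually_filtercomap
    by (intro exI[of _ "\<lambda>n. N \<le> n"]) (auto simp: eventually_at_top_linorder)
qed

lemma filterlim_remove_point: "filterlim (\<lambda>p. fst p - {snd p}) large_sets large_pointed_sets"
  unfolding filterlim_iff eventually_large_sets eventually_large_pointed_sets
proof (intro allI impI)
  fix P :: "nat set \<Rightarrow> bool" assume "\<exists>N. \<forall>S. finite S \<longrightarrow> N \<le> card S \<longrightarrow> P S"
  then obtain N where "\<forall>S. finite S \<longrightarrow> N \<le> card S \<longrightarrow> P S" by blast
  then show "\<exists>N. \<forall>S i. finite S \<longrightarrow> i \<in> S \<longrightarrow> N \<le> card S \<longrightarrow> P (fst (S, i) - {snd (S, i)})"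
    by (intro exI[of _ "Suc N"]) auto
qed

lemma filterlim_initial_segments: "filterlim (\<lambda>n. ({..<n}, n - 1)) large_pointed_sets sequentially"
  unfolding filterlim_iff eventually_large_pointed_sets
proof (intro allI impI)
  fix P :: "nat set \<times> nat \<Rightarrow> bool"
  assume "\<exists>N. \<forall>S i. finite S \<longrightarrow> i \<in> S \<longrightarrow> N \<le> card S \<longrightarrow> P (S, i)"
  then obtain N where N: "\<And>S i. finite S \<Longrightarrow> i \<in> S \<Longrightarrow> N \<le> card S \<Longrightarrow> P (S, i)" by blast
  show "\<forall>\<^sub>F n in sequentially. P ({..<n}, n - 1)"
    unfolding eventually_sequentially by (intro exI[of _ "Suc N"]) (auto intro!: N)
qed

lemma filterlim_card_large_pointed_sets: "filterlim (\<lambda>p. card (fst p)) at_top large_pointed_sets"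
  unfolding filterlim_at_top eventually_large_pointed_sets by auto

context wigner_family
begin

definition scaled_walk :: "nat \<Rightarrow> nat set \<times> nat \<Rightarrow> 'a \<Rightarrow> real" where
  "scaled_walk k p \<omega> = walk_sum (entry Z \<omega>) (fst p) k (snd p) (snd p) / sqrt (card (fst p)) ^ k"

definition scaled_return :: "nat \<Rightarrow> nat set \<times> nat \<Rightarrow> 'a \<Rightarrow> real" where
  "scaled_return k p \<omega> = first_return (entry Z \<omega>) (fst p) (snd p) k / sqrt (card (fst p)) ^ k"

definition scaled_trace :: "nat \<Rightarrow> nat set \<Rightarrow> 'a \<Rightarrow> real" where
  "scaled_trace k S \<omega> = closed_walk_sum (entry Z \<omega>) S k / sqrt (card S) ^ (k + 2)"

definition scaled_trace_diff :: "nat \<Rightarrow> nat set \<times> nat \<Rightarrow> 'a \<Rightarrow> real" where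
  "scaled_trace_diff k p \<omega> = (closed_walk_sum (entry Z \<omega>) (fst p) k
      - closed_walk_sum (entry Z \<omega>) (fst p - {snd p}) k) / sqrt (card (fst p)) ^ k"

lemma has_moments_divide: "has_moments M X \<Longrightarrow> has_moments M (\<lambda>\<omega>. X \<omega> / c)"
  unfolding divide_inverse by (intro has_moments_mult has_moments_const)

lemma has_moments_scaled [simp]:
  "has_moments M (scaled_walk k p)" "has_moments M (scaled_return k p)"
  "has_moments M (scaled_trace k S)" "has_moments M (scaled_trace_diff k p)"
  unfolding scaled_walk_def[abs_def] scaled_return_def[abs_def] scaled_trace_def[abs_def] scaled_trace_diff_def[abs_def]
  by (intro has_moments_divide has_moments_diff has_moments_walk_sum has_moments_first_return has_moments_closed_walk_sum)+

lemmas scaled_measurable [measurable] = has_moments_scaled[THEN has_moments_measurable]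

lemma scaled_walk_second_moment:
  "\<exists>C. \<forall>S i. finite S \<and> i \<in> S \<longrightarrow> expectation (\<lambda>\<omega>. (scaled_walk k (S, i) \<omega>)\<^sup>2) \<le> C"
proof -
  obtain C where C: "C \<ge> 0" "\<And>S a. finite S \<Longrightarrow> a \<in> S \<Longrightarrow>
     expectation (\<lambda>\<omega>. walk_sum (entry Z \<omega>) S (2 * k) a a) \<le> C * real (card S) ^ k"
    using expectation_walk_sum_even_le[of k] by blast
  show ?thesis
  proof (intro exI[of _ C] allI impI)
    fix S i assume "finite S \<and> i \<in> (S :: nat set)"
    then have S: "finite S" "i \<in> S" by auto
    then have n: "card S > 0" by (auto simp: card_gt_0_iff)
    have "expectation (\<lambda>\<omega>. (scaled_walk k (S, i) \<omega>)\<^sup>2)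
        \<le> expectation (\<lambda>\<omega>. walk_sum (entry Z \<omega>) S (2 * k) i i / real (card S) ^ k)"
    proof (intro integral_mono has_moments_integrable has_moments_power has_moments_divide has_moments_walk_sum has_moments_scaled)
      fix \<omega>
      let ?W = "walk_sum (entry Z \<omega>) S"
      have "(?W k i i)\<^sup>2 \<le> (\<Sum>b\<in>S. (?W k i b)\<^sup>2)"
        using S by (intro member_le_sum) auto
      also have "\<dots> = ?W (2 * k) i i"
        unfolding mult_2 walk_sum_add[OF S]
        using walk_sum_entry_sym[OF S] by (intro sum.cong) (auto simp: power2_eq_square)
      finally show "(scaled_walk k (S, i) \<omega>)\<^sup>2 \<le> ?W (2 * k) i i / real (card S) ^ k"
        by (simp add: scaled_walk_def power_divide real_sqrt_power[symmetric] divide_right_mono)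
    qed
    also have "\<dots> = expectation (\<lambda>\<omega>. walk_sum (entry Z \<omega>) S (2 * k) i i) / real (card S) ^ k"
      by simp
    also have "\<dots> \<le> C" using C(2)[OF S] n by (simp add: pos_divide_le_eq)
    finally show "expectation (\<lambda>\<omega>. (scaled_walk k (S, i) \<omega>)\<^sup>2) \<le> C" .
  qed
qed

lemma scaled_return_1: "converges_in_prob (scaled_return (Suc 0)) 0 large_pointed_sets"
proof (rule converges_in_prob_L2)
  have "expectation (\<lambda>\<omega>. (scaled_return (Suc 0) p \<omega>)\<^sup>2) = 1 / real (card (fst p))" for p
    using expectation_ZZ_square[of "edge (snd p) (snd p)"]
    by (simp add: scaled_return_def power_divide entry_ZZ)
  moreover have "((\<lambda>p. 1 / real (card (fst p))) \<longlongrightarrow> 0) large_pointed_sets"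
    by (rule filterlim_compose[OF lim_1_over_n filterlim_card_large_pointed_sets])
  ultimately show "((\<lambda>p. expectation (\<lambda>\<omega>. (scaled_return (Suc 0) p \<omega>)\<^sup>2)) \<longlongrightarrow> 0) large_pointed_sets"
    by simp
qed simp

text \<open>The centred first return weight tends to zero in mean square. Its mean is the trace of a matrix
  with one row less, normalized for the larger size; the factor \<open>r\<close>, which tends to 1, corrects this.\<close>
lemma scaled_return_converges:
  assumes "converges_in_prob (scaled_trace k) c large_sets"
  shows "converges_in_prob (scaled_return (Suc (Suc k))) c large_pointed_sets"
proof -
  define D where "D = (\<lambda>p \<omega>. (first_return (entry Z \<omega>) (fst p) (snd p) (Suc (Suc k))
      - closed_walk_sum (entry Z \<omega>) (fst p - {snd p}) k) / sqrt (card (fst p)) ^ (k + 2))"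
  define r where "r = (\<lambda>p :: nat set \<times> nat. (sqrt (1 - 1 / real (card (fst p)))) ^ (k + 2))"
  obtain C where C: "C \<ge> 0" "\<And>S i. finite S \<Longrightarrow> i \<in> S \<Longrightarrow>
    expectation (\<lambda>\<omega>. (first_return (entry Z \<omega>) S i (Suc (Suc k)) - closed_walk_sum (entry Z \<omega>) (S - {i}) k)\<^sup>2)
      \<le> C * real (card S) ^ Suc k"
    using first_return_variance[of k] by blast
  have lim_n: "((\<lambda>p :: nat set \<times> nat. 1 / real (card (fst p))) \<longlongrightarrow> 0) large_pointed_sets"
    by (rule filterlim_compose[OF lim_1_over_n filterlim_card_large_pointed_sets])
  have "converges_in_prob D 0 large_pointed_sets"
  proof (rule converges_in_prob_L2)
    show "has_moments M (D p)" for p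
      unfolding D_def by (intro has_moments_divide has_moments_diff has_moments_first_return has_moments_closed_walk_sum)
    have up: "((\<lambda>p. C * (1 / real (card (fst p)))) \<longlongrightarrow> 0) large_pointed_sets"
      using tendsto_mult_right_zero[OF lim_n, of C] .
    show "((\<lambda>p. expectation (\<lambda>\<omega>. (D p \<omega>)\<^sup>2)) \<longlongrightarrow> 0) large_pointed_sets"
    proof (rule tendsto_sandwich[OF _ _ tendsto_const up])
      show "\<forall>\<^sub>F p in large_pointed_sets. expectation (\<lambda>\<omega>. (D p \<omega>)\<^sup>2) \<le> C * (1 / real (card (fst p)))"
        unfolding eventually_large_pointed_sets
      proof (intro exI[of _ 0] allI impI)
        fix S i assume S: "finite S" "i \<in> (S :: nat set)"
        then have n: "card S > 0" by (auto simp: card_gt_0_iff)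
        have "expectation (\<lambda>\<omega>. (D (S, i) \<omega>)\<^sup>2) = expectation (\<lambda>\<omega>. (first_return (entry Z \<omega>) S i (Suc (Suc k))
              - closed_walk_sum (entry Z \<omega>) (S - {i}) k)\<^sup>2) / real (card S) ^ Suc (Suc k)"
          by (simp add: D_def power_divide real_sqrt_power[symmetric] power_mult_distrib del: first_return.simps)
        also have "\<dots> \<le> C * real (card S) ^ Suc k / real (card S) ^ Suc (Suc k)"
          by (intro divide_right_mono C S) auto
        also have "\<dots> = C * (1 / real (card S))" using n by simp
        finally show "expectation (\<lambda>\<omega>. (D (S, i) \<omega>)\<^sup>2) \<le> C * (1 / real (card (fst (S, i))))" by simp
      qed
    qed simp
  qed
  moreover have "(r \<longlongrightarrow> 1) large_pointed_sets"
  proof -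
    have "(r \<longlongrightarrow> (sqrt (1 - 0)) ^ (k + 2)) large_pointed_sets"
      unfolding r_def by (intro tendsto_intros lim_n)
    then show ?thesis by simp
  qed
  ultimately have "converges_in_prob (\<lambda>p \<omega>. D p \<omega> + r p * scaled_trace k (fst p - {snd p}) \<omega>) (0 + 1 * c) large_pointed_sets"
    by (intro converges_in_prob_add converges_in_prob_mult converges_in_prob_deterministic
        converges_in_prob_compose[OF assms filterlim_remove_point])
  then have "converges_in_prob (\<lambda>p \<omega>. D p \<omega> + r p * scaled_trace k (fst p - {snd p}) \<omega>) c large_pointed_sets" by simp
  then show ?thesis
  proof (rule converges_in_prob_cong)
    show "\<forall>\<^sub>F p in large_pointed_sets. (\<lambda>\<omega>. D p \<omega> + r p * scaled_trace k (fst p - {snd p}) \<omega>) = scaled_return (Suc (Suc k)) p"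
      unfolding eventually_large_pointed_sets
    \<comment> \<open>Two points are required because the smaller set must not be empty when its trace is rescaled.\<close>
    proof (intro exI[of _ 2] allI impI ext)
      fix S i \<omega> assume S: "finite S" "i \<in> (S :: nat set)" "2 \<le> card S"
      define n where "n = real (card S)"
      have n: "n \<ge> 2" using S by (simp add: n_def)
      have c: "real (card (S - {i})) = n - 1" using S by (simp add: n_def of_nat_diff)
      have "sqrt (1 - 1 / n) = sqrt (n - 1) / sqrt n"
        using n by (simp add: real_sqrt_divide[symmetric] field_simps)
      then have "r (S, i) = sqrt (n - 1) ^ (k + 2) / sqrt n ^ (k + 2)"
        unfolding r_def fst_conv n_def[symmetric] by (simp only: power_divide)
      then have "r (S, i) * scaled_trace k (S - {i}) \<omega> = closed_walk_sum (entry Z \<omega>) (S - {i}) k / sqrt n ^ (k + 2)"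
        using n unfolding scaled_trace_def c by simp
      then show "D (S, i) \<omega> + r (S, i) * scaled_trace k (fst (S, i) - {snd (S, i)}) \<omega> = scaled_return (Suc (Suc k)) (S, i) \<omega>"
        by (simp add: D_def scaled_return_def n_def[symmetric] diff_divide_distrib del: first_return.simps)
    qed
  qed simp
qed

lemma scaled_walk_renewal:
  assumes "finite S" "i \<in> S"
  shows "scaled_walk (Suc k) (S, i) \<omega> = (\<Sum>j\<le>k. scaled_return (Suc j) (S, i) \<omega> * scaled_walk (k - j) (S, i) \<omega>)"
  unfolding scaled_walk_def fst_conv snd_conv walk_sum_first_return[OF assms] sum_divide_distrib scaled_return_def
proof (rule sum.cong[OF refl])
  fix j assume "j \<in> {..k}"
  then have "Suc k = Suc j + (k - j)" by simp
  then have "sqrt (card S) ^ Suc k = sqrt (card S) ^ Suc j * sqrt (card S) ^ (k - j)" by (metis power_add)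
  then show "first_return (entry Z \<omega>) S i (Suc j) * walk_sum (entry Z \<omega>) S (k - j) i i / sqrt (real (card S)) ^ Suc k =
         first_return (entry Z \<omega>) S i (Suc j) / sqrt (real (card S)) ^ Suc j *
         (walk_sum (entry Z \<omega>) S (k - j) i i / sqrt (real (card S)) ^ (k - j))"
    by simp
qed

lemma scaled_trace_diff_renewal:
  assumes "finite S" "i \<in> S"
  shows "scaled_trace_diff (Suc k) (S, i) \<omega> = real k * scaled_return (Suc k) (S, i) \<omega>
     + (\<Sum>j\<le>k. scaled_return (Suc j) (S, i) \<omega> * scaled_trace_diff (k - j) (S, i) \<omega>)"
proof -
  let ?p = "\<lambda>k. closed_walk_sum (entry Z \<omega>) S k - closed_walk_sum (entry Z \<omega>) (S - {i}) k"
  let ?s = "sqrt (card S)"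
  have "(\<Sum>j\<le>k. first_return (entry Z \<omega>) S i (Suc j) * ?p (k - j)) / ?s ^ Suc k
     = (\<Sum>j\<le>k. scaled_return (Suc j) (S, i) \<omega> * scaled_trace_diff (k - j) (S, i) \<omega>)"
    unfolding sum_divide_distrib scaled_return_def scaled_trace_diff_def fst_conv snd_conv
  proof (rule sum.cong[OF refl])
    fix j assume "j \<in> {..k}"
    then have "Suc k = Suc j + (k - j)" by simp
    then have "?s ^ Suc k = ?s ^ Suc j * ?s ^ (k - j)" by (metis power_add)
    then show "first_return (entry Z \<omega>) S i (Suc j) * ?p (k - j) / ?s ^ Suc k =
        first_return (entry Z \<omega>) S i (Suc j) / ?s ^ Suc j * (?p (k - j) / ?s ^ (k - j))"
      by simp
  qed
  then show ?thesis
    unfolding scaled_trace_diff_def[of "Suc k"] fst_conv snd_conv closed_walk_sum_diff(2)[OF assms] add_divide_distrib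
    by (simp add: scaled_return_def)
qed

lemma scaled_walk_converges:
  assumes "\<And>j. j \<le> k \<Longrightarrow> converges_in_prob (scaled_return j) (semicircle_return j) large_pointed_sets"
  shows "converges_in_prob (scaled_walk k) (semicircle_moment k) large_pointed_sets"
  using assms
proof (induction k rule: less_induct)
  case (less k)
  show ?case
  proof (cases k)
    case 0
    have "converges_in_prob (\<lambda>_ _. 1) 1 large_pointed_sets" by (intro converges_in_prob_deterministic tendsto_const)
    then show ?thesis using 0 by (simp add: scaled_walk_def[abs_def])
  next
    case (Suc k')
    have "converges_in_prob (\<lambda>p \<omega>. \<Sum>j\<le>k'. scaled_return (Suc j) p \<omega> * scaled_walk (k' - j) p \<omega>)
        (\<Sum>j\<le>k'. semicircle_return (Suc j) * semicircle_moment (k' - j)) large_pointed_sets"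
      using less Suc by (intro converges_in_prob_sum converges_in_prob_mult) auto
    then show ?thesis unfolding Suc semicircle_moment_renewal
    proof (rule converges_in_prob_cong)
      show "\<forall>\<^sub>F p in large_pointed_sets. (\<lambda>\<omega>. \<Sum>j\<le>k'. scaled_return (Suc j) p \<omega> * scaled_walk (k' - j) p \<omega>) = scaled_walk (Suc k') p"
        unfolding eventually_large_pointed_sets by (intro exI[of _ 0]) (auto simp: scaled_walk_renewal)
    qed simp
  qed
qed

lemma scaled_trace_average:
  assumes "finite S"
  shows "scaled_trace k S \<omega> = (\<Sum>i\<in>S. scaled_walk k (S, i) \<omega>) / card S"
  by (simp add: scaled_trace_def scaled_walk_def closed_walk_sum_def sum_divide_distrib[symmetric] power_add)

text \<open>The normalized trace is the average of the normalized diagonal entries. These converge in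
  probability uniformly in the point, and in the mean because of their bounded second moments; the
  average inherits the convergence in the mean.\<close>
lemma scaled_trace_converges_of_walk:
  assumes "converges_in_prob (scaled_walk k) c large_pointed_sets"
  shows "converges_in_prob (scaled_trace k) c large_sets"
proof (rule converges_in_prob_L1)
  show "integrable M (scaled_trace k S)" for S by (rule has_moments_integrable) simp
  obtain C where C: "\<And>S i. finite S \<Longrightarrow> i \<in> S \<Longrightarrow> expectation (\<lambda>\<omega>. (scaled_walk k (S, i) \<omega>)\<^sup>2) \<le> C"
    using scaled_walk_second_moment[of k] by blast
  have L1: "((\<lambda>p. expectation (\<lambda>\<omega>. \<bar>scaled_walk k p \<omega> - c\<bar>)) \<longlongrightarrow> 0) large_pointed_sets"
    by (rule converges_in_prob_imp_L1[OF assms]) (auto simp: eventually_large_pointed_sets intro: C)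
  show "((\<lambda>S. expectation (\<lambda>\<omega>. \<bar>scaled_trace k S \<omega> - c\<bar>)) \<longlongrightarrow> 0) large_sets"
  proof (rule tendstoI)
    fix \<epsilon> :: real assume \<epsilon>: "\<epsilon> > 0"
    have "\<forall>\<^sub>F p in large_pointed_sets. dist (expectation (\<lambda>\<omega>. \<bar>scaled_walk k p \<omega> - c\<bar>)) 0 < \<epsilon> / 2"
      using tendstoD[OF L1, of "\<epsilon> / 2"] \<epsilon> by simp
    then obtain N where N: "\<And>S i. finite S \<Longrightarrow> i \<in> S \<Longrightarrow> N \<le> card S \<Longrightarrow>
        expectation (\<lambda>\<omega>. \<bar>scaled_walk k (S, i) \<omega> - c\<bar>) < \<epsilon> / 2"
      unfolding eventually_large_pointed_sets by (auto simp: dist_real_def)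
    show "\<forall>\<^sub>F S in large_sets. dist (expectation (\<lambda>\<omega>. \<bar>scaled_trace k S \<omega> - c\<bar>)) 0 < \<epsilon>"
      unfolding eventually_large_sets
    proof (intro exI[of _ "Suc N"] allI impI)
      fix S :: "nat set" assume S: "finite S" "Suc N \<le> card S"
      then have n: "card S > 0" by simp
      have int: "integrable M (\<lambda>\<omega>. \<bar>scaled_walk k p \<omega> - c\<bar>)" for p
        by (intro integrable_abs has_moments_integrable has_moments_diff has_moments_const has_moments_scaled)
      have "expectation (\<lambda>\<omega>. \<bar>scaled_trace k S \<omega> - c\<bar>)
          \<le> expectation (\<lambda>\<omega>. (\<Sum>i\<in>S. \<bar>scaled_walk k (S, i) \<omega> - c\<bar>) / card S)"
      proof (intro integral_mono)
        show "integrable M (\<lambda>\<omega>. \<bar>scaled_trace k S \<omega> - c\<bar>)"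
          by (intro integrable_abs has_moments_integrable has_moments_diff has_moments_const has_moments_scaled)
        show "integrable M (\<lambda>\<omega>. (\<Sum>i\<in>S. \<bar>scaled_walk k (S, i) \<omega> - c\<bar>) / real (card S))"
          by (intro integrable_divide_zero Bochner_Integration.integrable_sum int)
        fix \<omega>
        have "scaled_trace k S \<omega> - c = (\<Sum>i\<in>S. scaled_walk k (S, i) \<omega> - c) / card S"
          using n by (simp add: scaled_trace_average[OF S(1)] sum_subtractf diff_divide_distrib)
        also have "\<bar>\<dots>\<bar> \<le> (\<Sum>i\<in>S. \<bar>scaled_walk k (S, i) \<omega> - c\<bar>) / card S"
          by (simp add: divide_right_mono)
        finally show "\<bar>scaled_trace k S \<omega> - c\<bar> \<le> (\<Sum>i\<in>S. \<bar>scaled_walk k (S, i) \<omega> - c\<bar>) / card S" .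
      qed
      also have "\<dots> = (\<Sum>i\<in>S. expectation (\<lambda>\<omega>. \<bar>scaled_walk k (S, i) \<omega> - c\<bar>)) / card S"
        using int by simp
      also have "\<dots> \<le> (\<Sum>i\<in>S. \<epsilon> / 2) / card S"
        using N S by (intro divide_right_mono sum_mono) (auto intro: less_imp_le)
      also have "\<dots> = \<epsilon> / 2" using n by simp
      finally show "dist (expectation (\<lambda>\<omega>. \<bar>scaled_trace k S \<omega> - c\<bar>)) 0 < \<epsilon>"
        using \<epsilon> by (simp add: dist_real_def)
    qed
  qed
qed

lemma scaled_return_converges_of_trace:
  assumes "\<And>l. j = Suc (Suc l) \<Longrightarrow> converges_in_prob (scaled_trace l) (semicircle_moment l) large_sets"
  shows "converges_in_prob (scaled_return j) (semicircle_return j) large_pointed_sets"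
proof (cases j rule: semicircle_return.cases)
  case 1
  have "converges_in_prob (\<lambda>_ _. 0) 0 large_pointed_sets" by (intro converges_in_prob_deterministic tendsto_const)
  then show ?thesis using 1 by (simp add: scaled_return_def[abs_def])
next
  case 2
  then show ?thesis using scaled_return_1 by simp
next
  case (3 l)
  then show ?thesis using assms[of l] by (simp add: scaled_return_converges del: first_return.simps)
qed

text \<open>The semicircle law for the moments, by induction on \<open>k\<close>: the traces of order below \<open>k - 1\<close>
  determine the limits of the first return weights up to length \<open>k\<close>, these determine the limit of the
  diagonal entries of the \<open>k\<close>-th power, and averaging these entries gives the trace.\<close>
lemma scaled_trace_converges: "converges_in_prob (scaled_trace k) (semicircle_moment k) large_sets"
proof (induction k rule: less_induct)
  case (less k)
  show ?case
  proof (rule scaled_trace_converges_of_walk, rule scaled_walk_converges, rule scaled_return_converges_of_trace)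
    fix j l assume "j \<le> k" "j = Suc (Suc l)"
    then show "converges_in_prob (scaled_trace l) (semicircle_moment l) large_sets"
      by (intro less) simp
  qed
qed

lemma scaled_return_converges_semicircle:
  "converges_in_prob (scaled_return j) (semicircle_return j) large_pointed_sets"
  by (rule scaled_return_converges_of_trace, rule scaled_trace_converges)

lemma scaled_trace_diff_converges:
  "converges_in_prob (scaled_trace_diff k) (arcsine_moment k) large_pointed_sets"
proof (induction k rule: less_induct)
  case (less k)
  show ?case
  proof (cases k)
    case 0
    have "converges_in_prob (\<lambda>_ _. 1) 1 large_pointed_sets" by (intro converges_in_prob_deterministic tendsto_const)
    then have "converges_in_prob (scaled_trace_diff 0) 1 large_pointed_sets"
    proof (rule converges_in_prob_cong)
      show "\<forall>\<^sub>F p in large_pointed_sets. (\<lambda>_. 1) = scaled_trace_diff 0 p"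
        unfolding eventually_large_pointed_sets
        by (intro exI[of _ 0]) (auto simp: scaled_trace_diff_def closed_walk_sum_diff(1))
    qed simp
    then show ?thesis using 0 by simp
  next
    case (Suc k')
    have "converges_in_prob (\<lambda>p \<omega>. real k' * scaled_return (Suc k') p \<omega>
         + (\<Sum>j\<le>k'. scaled_return (Suc j) p \<omega> * scaled_trace_diff (k' - j) p \<omega>))
        (arcsine_moment (Suc k')) large_pointed_sets"
      unfolding arcsine_moment.simps using less Suc
      by (intro converges_in_prob_add converges_in_prob_sum converges_in_prob_mult converges_in_prob_deterministic
          tendsto_const scaled_return_converges_semicircle) auto
    then show ?thesis unfolding Suc
    proof (rule converges_in_prob_cong)
      show "\<forall>\<^sub>F p in large_pointed_sets. (\<lambda>\<omega>. real k' * scaled_return (Suc k') p \<omega>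
         + (\<Sum>j\<le>k'. scaled_return (Suc j) p \<omega> * scaled_trace_diff (k' - j) p \<omega>)) = scaled_trace_diff (Suc k') p"
        unfolding eventually_large_pointed_sets by (intro exI[of _ 0]) (auto simp: scaled_trace_diff_renewal)
    qed simp
  qed
qed

end



section \<open>Characteristic polynomials of symmetric matrices\<close>

definition kernel_mat :: "(nat \<Rightarrow> nat \<Rightarrow> real) \<Rightarrow> nat \<Rightarrow> real mat" where
  "kernel_mat w n = Matrix.mat n n (\<lambda>(i, j). w i j)"

definition pencil :: "(nat \<Rightarrow> nat \<Rightarrow> real) \<Rightarrow> nat \<Rightarrow> complex \<Rightarrow> complex mat" where
  "pencil w n z = Matrix.mat n n (\<lambda>(i, j). (if i = j then z else 0) - complex_of_real (w i j))"

lemma kernel_mat_carrier [simp]: "kernel_mat w n \<in> carrier_mat n n"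
  by (simp add: kernel_mat_def)

lemma pencil_carrier [simp]: "pencil w n z \<in> carrier_mat n n"
  by (simp add: pencil_def)

lemma mat_delete_kernel_mat: "mat_delete (kernel_mat w (Suc n)) n n = kernel_mat w n"
  by (rule eq_matI) (auto simp: mat_delete_def kernel_mat_def)

lemma mat_delete_pencil: "mat_delete (pencil w (Suc n) z) n n = pencil w n z"
  by (rule eq_matI) (auto simp: mat_delete_def pencil_def)

text \<open>Let \<open>u\<close> be the last column of the adjugate of \<open>z - A\<close>. Its last entry is the determinant for the
  minor, and \<open>(z - A) u\<close> is the determinant times the last unit vector. Taking the inner product
  with \<open>u\<close> and imaginary parts gives the claim with \<open>s\<close> the squared norm of \<open>u\<close>, as the
  quadratic form of a real symmetric matrix takes real values.\<close>
lemma Im_det_pencil: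
  assumes sym: "\<And>i j. w i j = w j i"
  shows "\<exists>s. (cmod (Determinant.det (pencil w n z)))\<^sup>2 \<le> s \<and>
    Im (cnj (Determinant.det (pencil w n z)) * Determinant.det (pencil w (Suc n) z)) = Im z * s"
proof -
  let ?B = "pencil w (Suc n) z" and ?I = "{..<Suc n}"
  define u where "u = (\<lambda>k. adj_mat ?B $$ (k, n))"
  have adj: "adj_mat ?B \<in> carrier_mat (Suc n) (Suc n)"
    and mult: "?B * adj_mat ?B = Determinant.det ?B \<cdot>\<^sub>m 1\<^sub>m (Suc n)"
    by (rule adj_mat[OF pencil_carrier])+
  have un: "u n = Determinant.det (pencil w n z)"
    by (simp add: u_def adj_mat_def cofactor_def mat_delete_pencil pencil_def[of w "Suc n"] flip: mult_2)
       (simp add: pencil_def[symmetric] mat_delete_pencil)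
  have Bu: "(\<Sum>k\<in>?I. ?B $$ (i, k) * u k) = (if i = n then Determinant.det ?B else 0)" if "i \<in> ?I" for i
  proof -
    have "(\<Sum>k\<in>?I. ?B $$ (i, k) * u k) = (?B * adj_mat ?B) $$ (i, n)"
      using that carrier_matD[OF adj] carrier_matD[OF pencil_carrier[of w "Suc n" z]]
      by (simp add: scalar_prod_def u_def atLeast0LessThan del: sum.lessThan_Suc)
    also have "\<dots> = (if i = n then Determinant.det ?B else 0)"
      unfolding mult using that by auto
    finally show ?thesis .
  qed
  define Q where "Q = (\<Sum>i\<in>?I. \<Sum>k\<in>?I. cnj (u i) * complex_of_real (w i k) * u k)"
  define s where "s = (\<Sum>i\<in>?I. (cmod (u i))\<^sup>2)"
  \<comment> \<open>The quadratic form is real by symmetry.\<close>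
  have "cnj Q = (\<Sum>i\<in>?I. \<Sum>k\<in>?I. cnj (u k) * complex_of_real (w k i) * u i)"
    unfolding Q_def cnj_sum using sym by (intro sum.cong refl) (simp add: mult_ac)
  also have "\<dots> = Q" unfolding Q_def by (rule sum.swap)
  finally have "Im Q = 0" by (simp add: complex_eq_iff)
  have "cnj (u n) * Determinant.det ?B = (\<Sum>i\<in>?I. cnj (u i) * (\<Sum>k\<in>?I. ?B $$ (i, k) * u k))"
    using Bu by (simp add: if_distrib[of "\<lambda>x. _ * x"] cong: if_cong)
  also have "\<dots> = (\<Sum>i\<in>?I. z * (cnj (u i) * u i) - (\<Sum>k\<in>?I. cnj (u i) * complex_of_real (w i k) * u k))"
  proof (rule sum.cong[OF refl])
    fix i assume i: "i \<in> ?I"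
    have "(\<Sum>k\<in>?I. ?B $$ (i, k) * u k)
        = (\<Sum>k\<in>?I. (if i = k then z * u k else 0) - complex_of_real (w i k) * u k)"
      using i by (intro sum.cong) (auto simp: pencil_def algebra_simps)
    also have "\<dots> = z * u i - (\<Sum>k\<in>?I. complex_of_real (w i k) * u k)"
      using i by (simp add: sum_subtractf del: sum.lessThan_Suc)
    finally show "cnj (u i) * (\<Sum>k\<in>?I. ?B $$ (i, k) * u k)
        = z * (cnj (u i) * u i) - (\<Sum>k\<in>?I. cnj (u i) * complex_of_real (w i k) * u k)"
      by (simp only: right_diff_distrib sum_distrib_left mult_ac)
  qed
  also have "\<dots> = z * of_real s - Q"
  proof -
    have "cnj a * a = complex_of_real ((cmod a)\<^sup>2)" for a
      by (simp only: complex_norm_square mult.commute)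
    then show ?thesis
      unfolding Q_def s_def sum_subtractf of_real_sum sum_distrib_left by simp
  qed
  finally have "Im (cnj (u n) * Determinant.det ?B) = Im z * s"
    using \<open>Im Q = 0\<close> by simp
  moreover have "(cmod (u n))\<^sup>2 \<le> s"
    unfolding s_def by (rule member_le_sum) auto
  ultimately show ?thesis unfolding un by blast
qed

lemma det_pencil_nonzero:
  assumes sym: "\<And>i j. w i j = w j i" and z: "Im z \<noteq> 0"
  shows "Determinant.det (pencil w n z) \<noteq> 0"
proof (induction n)
  case 0
  then show ?case by (simp add: pencil_def det_def)
next
  case (Suc n)
  obtain s where s: "(cmod (Determinant.det (pencil w n z)))\<^sup>2 \<le> s"
    "Im (cnj (Determinant.det (pencil w n z)) * Determinant.det (pencil w (Suc n) z)) = Im z * s"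
    using Im_det_pencil[of w n z] sym by blast
  have "0 < (cmod (Determinant.det (pencil w n z)))\<^sup>2" using Suc by simp
  then have "Im z * s \<noteq> 0" using s(1) z by auto
  then show ?case using s(2) by auto
qed

text \<open>The ratio of the characteristic polynomials of a minor and of the matrix is a Nevanlinna
  function. This is the analytic form of the interlacing of the two spectra.\<close>
lemma Im_det_pencil_pos:
  assumes sym: "\<And>i j. w i j = w j i" and z: "Im z > 0"
  shows "0 < Im (cnj (Determinant.det (pencil w n z)) * Determinant.det (pencil w (Suc n) z))"
proof -
  obtain s where s: "(cmod (Determinant.det (pencil w n z)))\<^sup>2 \<le> s"
    "Im (cnj (Determinant.det (pencil w n z)) * Determinant.det (pencil w (Suc n) z)) = Im z * s"
    using Im_det_pencil[of w n z] sym by blast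
  have "0 < (cmod (Determinant.det (pencil w n z)))\<^sup>2"
    using det_pencil_nonzero[OF sym, where z = z and n = n] z by simp
  then have "0 < s" using s(1) by (rule less_le_trans)
  then show ?thesis unfolding s(2) using z by simp
qed

lemma poly_char_poly_pencil:
  "poly (char_poly (of_real_hom.mat_hom (kernel_mat w n))) z = Determinant.det (pencil w n z)"
proof -
  have "- char_matrix (of_real_hom.mat_hom (kernel_mat w n)) z = pencil w n z"
    by (rule eq_matI) (auto simp: char_matrix_def kernel_mat_def pencil_def)
  moreover have "(of_real_hom.mat_hom (kernel_mat w n) :: complex mat) \<in> carrier_mat n n" by simp
  ultimately show ?thesis using char_poly_matrix[of "of_real_hom.mat_hom (kernel_mat w n)" n z] by simp
qed

text \<open>The complex roots are real because the determinant of the pencil has no zeros off the real axis.\<close>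
lemma kernel_mat_real_rooted:
  assumes sym: "\<And>i j. w i j = w j i"
  obtains xs where "char_poly (kernel_mat w n) = (\<Prod>x\<leftarrow>xs. [:- x, 1:])" "length xs = n"
    "\<And>z. Determinant.det (pencil w n z) = (\<Prod>x\<leftarrow>xs. z - complex_of_real x)"
proof -
  let ?C = "of_real_hom.mat_hom (kernel_mat w n) :: complex mat"
  have C: "?C \<in> carrier_mat n n" by simp
  obtain as where as: "char_poly ?C = (\<Prod>a\<leftarrow>as. [:- a, 1:])" "length as = n"
    using char_poly_factorized[OF C] by blast
  have real: "of_real (Re a) = a" if "a \<in> set as" for a
  proof (rule ccontr)
    assume "of_real (Re a) \<noteq> a"
    then have "Im a \<noteq> 0" by (auto simp: complex_eq_iff)
    then have "poly (char_poly ?C) a \<noteq> 0"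
      unfolding poly_char_poly_pencil by (rule det_pencil_nonzero[OF sym])
    moreover have "poly (char_poly ?C) a = 0"
      unfolding as(1) poly_prod_list using that by (auto simp: prod_list_zero_iff image_iff intro!: bexI[of _ a])
    ultimately show False by simp
  qed
  define xs where "xs = map Re as"
  have as_xs: "as = map complex_of_real xs" using real by (simp add: xs_def map_idI)
  have "complex_of_real (poly (char_poly (kernel_mat w n)) t) = complex_of_real (poly (\<Prod>x\<leftarrow>xs. [:- x, 1:]) t)" for t
  proof -
    have "complex_of_real (poly (char_poly (kernel_mat w n)) t) = poly (char_poly ?C) (complex_of_real t)"
      unfolding of_real_hom.char_poly_hom[OF kernel_mat_carrier] by (simp add: of_real_hom.poly_map_poly)
    also have "\<dots> = (\<Prod>x\<leftarrow>xs. complex_of_real t - complex_of_real x)"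
      unfolding as(1) as_xs poly_prod_list by (simp add: o_def)
    also have "\<dots> = complex_of_real (poly (\<Prod>x\<leftarrow>xs. [:- x, 1:]) t)"
      by (induction xs) (simp_all add: algebra_simps)
    finally show ?thesis .
  qed
  then have "char_poly (kernel_mat w n) = (\<Prod>x\<leftarrow>xs. [:- x, 1:])"
    unfolding poly_eq_poly_eq_iff[symmetric] by (simp add: fun_eq_iff)
  moreover have "length xs = n" using as by (simp add: xs_def)
  moreover have "Determinant.det (pencil w n z) = (\<Prod>x\<leftarrow>xs. z - complex_of_real x)" for z
    unfolding poly_char_poly_pencil[symmetric] as(1) as_xs poly_prod_list by (simp add: o_def)
  ultimately show ?thesis by (rule that)
qed

lemma mset_eigenvalue_list:
  assumes "char_poly A = (\<Prod>x\<leftarrow>xs. [:- x, 1:])"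
  shows "mset (eigenvalue_list A) = mset xs"
proof -
  have "proots (\<Prod>x\<leftarrow>xs. [:- x, 1:]) = mset xs"
  proof (induction xs)
    case (Cons x xs)
    have "(\<Prod>x\<leftarrow>xs. [:- x, 1:]) \<noteq> (0 :: real poly)" by (auto simp: prod_list_zero_iff)
    then show ?case using Cons by (simp add: proots_mult del: mult_pCons_left)
  qed simp
  then show ?thesis by (simp add: eigenvalue_list_def assms)
qed

lemma sum_list_mset_cong:
  "mset xs = mset ys \<Longrightarrow> (\<Sum>x\<leftarrow>xs. f x :: 'b :: comm_monoid_add) = (\<Sum>x\<leftarrow>ys. f x)"
  by (metis mset_map sum_mset_sum_list)

lemma prod_list_mset_cong:
  "mset xs = mset ys \<Longrightarrow> (\<Prod>x\<leftarrow>xs. f x :: 'b :: comm_monoid_mult) = (\<Prod>x\<leftarrow>ys. f x)"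
  by (metis mset_map prod_mset_prod_list)

lemma eigenvalue_list_kernel_mat:
  assumes sym: "\<And>i j. w i j = w j i"
  shows "length (eigenvalue_list (kernel_mat w n)) = n"
    and "Determinant.det (pencil w n z) = (\<Prod>x\<leftarrow>eigenvalue_list (kernel_mat w n). z - complex_of_real x)"
    and "char_poly (kernel_mat w n) = (\<Prod>x\<leftarrow>eigenvalue_list (kernel_mat w n). [:- x, 1:])"
proof -
  obtain xs where xs: "char_poly (kernel_mat w n) = (\<Prod>x\<leftarrow>xs. [:- x, 1:])" "length xs = n"
    "\<And>z. Determinant.det (pencil w n z) = (\<Prod>x\<leftarrow>xs. z - complex_of_real x)"
    using kernel_mat_real_rooted[of w n] sym by blast
  note eq = mset_eigenvalue_list[OF xs(1)]
  show "length (eigenvalue_list (kernel_mat w n)) = n"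
    using arg_cong[OF eq, of size] xs(2) by simp
  show "Determinant.det (pencil w n z) = (\<Prod>x\<leftarrow>eigenvalue_list (kernel_mat w n). z - complex_of_real x)"
    unfolding xs(3) by (rule prod_list_mset_cong[OF eq[symmetric]])
  show "char_poly (kernel_mat w n) = (\<Prod>x\<leftarrow>eigenvalue_list (kernel_mat w n). [:- x, 1:])"
    unfolding xs(1) by (rule prod_list_mset_cong[OF eq[symmetric, unfolded xs(1)]])
qed

section \<open>Traces of powers\<close>

definition trace_mat :: "real mat \<Rightarrow> real" where
  "trace_mat A = (\<Sum>i<dim_row A. A $$ (i, i))"

lemma trace_mat_mult_commute:
  assumes "A \<in> carrier_mat n n" "B \<in> carrier_mat n n"
  shows "trace_mat (A * B) = trace_mat (B * A)"
proof -
  have "trace_mat (A * B) = (\<Sum>i<n. \<Sum>k<n. A $$ (i, k) * B $$ (k, i))"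
    using assms by (simp add: trace_mat_def scalar_prod_def atLeast0LessThan)
  also have "\<dots> = (\<Sum>k<n. \<Sum>i<n. B $$ (k, i) * A $$ (i, k))"
    by (subst sum.swap) (simp add: mult.commute)
  also have "\<dots> = trace_mat (B * A)"
    using assms by (simp add: trace_mat_def scalar_prod_def atLeast0LessThan)
  finally show ?thesis .
qed

lemma upper_triangular_mult:
  fixes A B :: "real mat"
  assumes A: "A \<in> carrier_mat n n" "upper_triangular A" and B: "B \<in> carrier_mat n n" "upper_triangular B"
  shows "upper_triangular (A * B)"
    and "i < n \<Longrightarrow> (A * B) $$ (i, i) = A $$ (i, i) * B $$ (i, i)"
proof -
  have entry: "(A * B) $$ (i, j) = (\<Sum>k<n. A $$ (i, k) * B $$ (k, j))" if "i < n" "j < n" for i j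
    using that A B by (simp add: scalar_prod_def atLeast0LessThan)
  have A0: "A $$ (i, k) = 0" if "k < i" "i < n" for i k
    using upper_triangularD[OF A(2)] that A(1) by auto
  have B0: "B $$ (i, k) = 0" if "k < i" "i < n" for i k
    using upper_triangularD[OF B(2)] that B(1) by auto
  show "upper_triangular (A * B)"
  proof (rule upper_triangularI)
    fix i j assume "j < i" "i < dim_row (A * B)"
    then have ij: "j < i" "i < n" using A by auto
    have "A $$ (i, k) * B $$ (k, j) = 0" if "k < n" for k
      using A0[of k i] B0[of j k] ij that by (cases "k < i") auto
    then show "(A * B) $$ (i, j) = 0" using ij by (simp only: entry) (intro sum.neutral, simp)
  qed
  show "(A * B) $$ (i, i) = A $$ (i, i) * B $$ (i, i)" if i: "i < n"
  proof -
    have *: "A $$ (i, k) * B $$ (k, i) = (if k = i then A $$ (i, i) * B $$ (i, i) else 0)" if "k < n" for k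
      using A0[of k i] B0[of i k] i that by (cases k i rule: linorder_cases) auto
    have "(A * B) $$ (i, i) = (\<Sum>k<n. if k = i then A $$ (i, i) * B $$ (i, i) else 0)"
      unfolding entry[OF i i] by (intro sum.cong refl *) simp
    then show ?thesis using i by simp
  qed
qed

lemma upper_triangular_pow:
  fixes B :: "real mat"
  assumes B: "B \<in> carrier_mat n n" "upper_triangular B"
  shows "upper_triangular (B ^\<^sub>m k) \<and> (\<forall>i<n. (B ^\<^sub>m k) $$ (i, i) = (B $$ (i, i)) ^ k)"
proof (induction k)
  case 0
  then show ?case using B by auto
next
  case (Suc k)
  have "B ^\<^sub>m k \<in> carrier_mat n n" using B(1) by (rule pow_carrier_mat)
  then show ?case using Suc upper_triangular_mult[of "B ^\<^sub>m k" n B] B by (simp add: mult.commute)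
qed

text \<open>By Schur's theorem the matrix is similar to a triangular one, which has the eigenvalues on its
  diagonal; the diagonal of a triangular matrix is compatible with powers.\<close>
lemma trace_mat_pow_eq_sum_eigenvalues:
  assumes A: "A \<in> carrier_mat n n" and xs: "char_poly A = (\<Prod>x\<leftarrow>xs. [:- x, 1:])"
  shows "trace_mat (A ^\<^sub>m k) = (\<Sum>x\<leftarrow>xs. x ^ k)"
proof -
  obtain B P Q where B: "B \<in> carrier_mat n n" "upper_triangular B" and wit: "similar_mat_wit A B P Q"
    using schur_decomposition_exists[OF A xs] unfolding similar_mat_def by blast
  have carr: "P \<in> carrier_mat n n" "Q \<in> carrier_mat n n" "Q * P = 1\<^sub>m n"
    using wit A unfolding similar_mat_wit_def Let_def by auto
  have Bk: "B ^\<^sub>m k \<in> carrier_mat n n" using B(1) by (rule pow_carrier_mat)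
  have "char_poly A = char_poly B"
    by (rule char_poly_similar) (use wit in \<open>auto simp: similar_mat_def\<close>)
  then have "(\<Prod>x\<leftarrow>diag_mat B. [:- x, 1:]) = (\<Prod>x\<leftarrow>xs. [:- x, 1:])"
    using char_poly_upper_triangular[OF B] xs by simp
  then have eq: "mset (diag_mat B) = mset xs"
    using mset_eigenvalue_list[of A xs] mset_eigenvalue_list[of A "diag_mat B"] xs by simp
  have "trace_mat (A ^\<^sub>m k) = trace_mat (P * B ^\<^sub>m k * Q)"
    using similar_mat_wit_pow_id[OF wit] by simp
  also have "\<dots> = trace_mat (Q * (P * B ^\<^sub>m k))"
    using carr Bk by (intro trace_mat_mult_commute) auto
  also have "Q * (P * B ^\<^sub>m k) = B ^\<^sub>m k"
    using carr left_mult_one_mat[OF Bk] Bk by (simp add: assoc_mult_mat[symmetric, of _ n n _ n _ n])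
  also have "trace_mat (B ^\<^sub>m k) = (\<Sum>i<n. (B $$ (i, i)) ^ k)"
    using upper_triangular_pow[OF B, of k] carrier_matD[OF B(1)] by (simp add: trace_mat_def)
  also have "\<dots> = (\<Sum>x\<leftarrow>diag_mat B. x ^ k)"
    using B(1) by (simp add: diag_mat_def o_def interv_sum_list_conv_sum_set_nat atLeast0LessThan)
  also have "\<dots> = (\<Sum>x\<leftarrow>xs. x ^ k)" by (rule sum_list_mset_cong[OF eq])
  finally show ?thesis .
qed

lemma kernel_mat_pow_entry:
  assumes "i < n" "j < n"
  shows "(kernel_mat w n ^\<^sub>m k) $$ (i, j) = walk_sum w {..<n} k i j"
  using assms
proof (induction k arbitrary: i j)
  case (Suc k)
  have carr: "kernel_mat w n ^\<^sub>m k \<in> carrier_mat n n" by simp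
  have "(kernel_mat w n ^\<^sub>m Suc k) $$ (i, j) = (\<Sum>c<n. walk_sum w {..<n} k i c * w c j)"
    using Suc carr by (simp add: scalar_prod_def atLeast0LessThan kernel_mat_def)
  also have "\<dots> = walk_sum w {..<n} (k + 1) i j"
    using Suc.prems by (subst walk_sum_add) (auto intro!: sum.cong simp: walk_sum_1 simp del: walk_sum.simps)
  finally show ?case by simp
qed (auto simp: kernel_mat_def)

lemma sum_eigenvalue_list_powers:
  assumes sym: "\<And>i j. w i j = w j i"
  shows "(\<Sum>x\<leftarrow>eigenvalue_list (kernel_mat w n). x ^ k) = closed_walk_sum w {..<n} k"
  using trace_mat_pow_eq_sum_eigenvalues[OF kernel_mat_carrier eigenvalue_list_kernel_mat(3)[of w, OF sym], of n k]
    carrier_matD[OF kernel_mat_carrier[of w n]]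
  by (simp add: trace_mat_def kernel_mat_pow_entry closed_walk_sum_def)

lemma wigner_matrix_eq_kernel_mat: "wigner_matrix Z n \<omega> = kernel_mat (entry Z \<omega>) n"
  by (rule eq_matI) (auto simp: wigner_matrix_def kernel_mat_def entry_def)


section \<open>The Lipschitz property of the diagram\<close>

lemma upper_half_plane_polar:
  assumes "\<eta> > 0"
  shows "Complex t \<eta> - complex_of_real a
    = of_real (\<eta> * sqrt (1 + ((t - a) / \<eta>)\<^sup>2)) * (\<i> * cis (- arctan ((t - a) / \<eta>)))"
proof -
  let ?u = "(t - a) / \<eta>"
  have "sqrt (1 + ?u\<^sup>2) > 0" by (simp add: add_pos_nonneg)
  then show ?thesis using assms
    by (simp add: complex_eq_iff cos_arctan sin_arctan)
qed

lemma prod_list_upper_half_plane_polar: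
  assumes "\<eta> > 0"
  shows "(\<Prod>x\<leftarrow>xs. Complex t \<eta> - complex_of_real x)
    = of_real (\<Prod>x\<leftarrow>xs. \<eta> * sqrt (1 + ((t - x) / \<eta>)\<^sup>2)) * \<i> ^ length xs * cis (- (\<Sum>x\<leftarrow>xs. arctan ((t - x) / \<eta>)))"
proof (induction xs)
  case (Cons x xs)
  let ?s = "\<Sum>x\<leftarrow>xs. arctan ((t - x) / \<eta>)"
  have "cis (- (arctan ((t - x) / \<eta>) + ?s)) = cis (- arctan ((t - x) / \<eta>)) * cis (- ?s)"
    by (simp add: cis_mult)
  then show ?case
    using Cons upper_half_plane_polar[OF assms, of t x]
    by (simp add: mult_ac)
qed simp

lemma prod_list_pos: "(\<And>x. x \<in> set xs \<Longrightarrow> f x > (0::real)) \<Longrightarrow> (\<Prod>x\<leftarrow>xs. f x) > 0"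
  by (induction xs) auto

lemma tendsto_sum_list:
  fixes f :: "'b \<Rightarrow> 'c \<Rightarrow> real"
  assumes "\<And>x. x \<in> set xs \<Longrightarrow> (f x \<longlongrightarrow> l x) F"
  shows "((\<lambda>t. \<Sum>x\<leftarrow>xs. f x t) \<longlongrightarrow> (\<Sum>x\<leftarrow>xs. l x)) F"
  using assms by (induction xs) (auto intro!: tendsto_add)

lemma has_real_derivative_sum_list:
  fixes f :: "'b \<Rightarrow> real \<Rightarrow> real"
  assumes "\<And>x. x \<in> set xs \<Longrightarrow> (f x has_real_derivative f' x) (at t within S)"
  shows "((\<lambda>t. \<Sum>x\<leftarrow>xs. f x t) has_real_derivative (\<Sum>x\<leftarrow>xs. f' x)) (at t within S)"
  using assms by (induction xs) (auto intro!: DERIV_add)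

text \<open>With \<open>z = t + \<eta> i\<close>, the number \<open>pi / 2 - \<theta> t\<close> is an argument of
  \<open>cnj (\<Prod>y. z - y) * (\<Prod>x. z - x)\<close>. By hypothesis its sine, the cosine of \<open>\<theta> t\<close>, is positive for
  all \<open>t\<close>. A continuous function with this property cannot leave the interval from \<open>- pi / 2\<close> to
  \<open>pi / 2\<close>, and it lies there for large \<open>t\<close> because it tends to \<open>pi / 2\<close>: there is one more \<open>x\<close>
  than there are \<open>y\<close>.\<close>
lemma phase_difference_bound:
  fixes xs ys :: "real list"
  assumes len: "length xs = Suc (length ys)"
    and pos: "\<And>z. Im z > 0 \<Longrightarrow> 0 < Im (cnj (\<Prod>y\<leftarrow>ys. z - complex_of_real y) * (\<Prod>x\<leftarrow>xs. z - complex_of_real x))"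
    and \<eta>: "\<eta> > 0"
  shows "\<bar>(\<Sum>x\<leftarrow>xs. arctan ((t - x) / \<eta>)) - (\<Sum>y\<leftarrow>ys. arctan ((t - y) / \<eta>))\<bar> < pi / 2"
proof -
  define \<theta> where "\<theta> = (\<lambda>t. (\<Sum>x\<leftarrow>xs. arctan ((t - x) / \<eta>)) - (\<Sum>y\<leftarrow>ys. arctan ((t - y) / \<eta>)))"
  have cos_pos: "cos (\<theta> t) > 0" for t
  proof -
    define R where "R = (\<lambda>xs. \<Prod>x\<leftarrow>xs. \<eta> * sqrt (1 + ((t - x) / \<eta>)\<^sup>2))"
    have R: "R zs > 0" for zs
      unfolding R_def using \<eta> by (intro prod_list_pos) (auto intro!: mult_pos_pos add_pos_nonneg)
    let ?m = "length ys" and ?a = "\<Sum>x\<leftarrow>xs. arctan ((t - x) / \<eta>)" and ?b = "\<Sum>y\<leftarrow>ys. arctan ((t - y) / \<eta>)"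
    have "cnj (\<Prod>y\<leftarrow>ys. Complex t \<eta> - complex_of_real y) * (\<Prod>x\<leftarrow>xs. Complex t \<eta> - complex_of_real x)
        = of_real (R ys * R xs) * ((- \<i>) ^ ?m * \<i> ^ Suc ?m) * (cis ?b * cis (- ?a))"
      unfolding prod_list_upper_half_plane_polar[OF \<eta>] R_def[symmetric] len
      by (simp add: R_def cis_cnj mult_ac)
    also have "(- \<i>) ^ ?m * \<i> ^ Suc ?m = \<i>"
      by (simp add: power_mult_distrib[symmetric])
    also have "cis ?b * cis (- ?a) = cis (- \<theta> t)"
      by (simp add: cis_mult \<theta>_def)
    finally have "0 < R ys * R xs * cos (\<theta> t)"
      using pos[of "Complex t \<eta>"] \<eta> by simp
    then show ?thesis by (rule zero_less_mult_pos) (intro mult_pos_pos R)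
  qed
  have cont: "isCont \<theta> t" for t
    unfolding \<theta>_def isCont_def
    by (intro tendsto_diff tendsto_sum_list tendsto_intros) (use \<eta> in auto)
  have lim: "(\<theta> \<longlongrightarrow> pi / 2) at_top"
  proof -
    have "((\<lambda>t. arctan ((t - x) / \<eta>)) \<longlongrightarrow> pi / 2) at_top" for x
      by (rule filterlim_compose[OF tendsto_arctan_at_top]) (use \<eta> in real_asymp)
    then have "(\<theta> \<longlongrightarrow> (\<Sum>x\<leftarrow>xs. pi / 2) - (\<Sum>y\<leftarrow>ys. pi / 2)) at_top"
      unfolding \<theta>_def by (intro tendsto_diff tendsto_sum_list)
    moreover have "(\<Sum>x\<leftarrow>xs. pi / 2) - (\<Sum>y\<leftarrow>ys. pi / 2) = pi / 2"
      by (simp add: sum_list_triv len algebra_simps)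
    ultimately show ?thesis by simp
  qed
  have "eventually (\<lambda>s. \<theta> s < pi \<and> 0 < \<theta> s \<and> t < s) at_top"
    by (intro eventually_conj order_tendstoD[OF lim] eventually_gt_at_top) auto
  then obtain s where s: "\<theta> s < pi" "0 < \<theta> s" "t < s"
    by (metis (no_types, lifting) eventually_happens trivial_limit_at_top_linorder)
  have "\<theta> t < pi / 2"
  proof (rule ccontr)
    assume "\<not> \<theta> t < pi / 2"
    have "\<theta> t > pi"
    proof (rule ccontr)
      assume "\<not> pi < \<theta> t"
      then have "cos (\<theta> t) \<le> cos (pi / 2)"
        using \<open>\<not> \<theta> t < pi / 2\<close> by (intro cos_monotone_0_pi_le) auto
      then show False using cos_pos[of t] by simp
    qed
    then obtain r where "\<theta> r = pi"
      using IVT2[of \<theta> s pi t] s cont by auto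
    then show False using cos_pos[of r] by simp
  qed
  moreover have "- (pi / 2) < \<theta> t"
  proof (rule ccontr)
    assume "\<not> - (pi / 2) < \<theta> t"
    then obtain r where "\<theta> r = - (pi / 2)"
      using IVT[of \<theta> t "- (pi / 2)" s] s cont pi_gt_zero by auto
    then show False using cos_pos[of r] by simp
  qed
  ultimately have "\<bar>\<theta> t\<bar> < pi / 2" by linarith
  then show ?thesis by (simp only: \<theta>_def)
qed

text \<open>An antiderivative of \<open>2 / pi * arctan (u / \<eta>)\<close>, which tends to the sign of \<open>u\<close> as \<open>\<eta>\<close>
  tends to 0.\<close>
definition smooth_abs :: "real \<Rightarrow> real \<Rightarrow> real" where
  "smooth_abs \<eta> u = 2 / pi * u * arctan (u / \<eta>) - \<eta> / pi * ln (\<eta>\<^sup>2 + u\<^sup>2)"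

lemma smooth_abs_derivative:
  assumes "\<eta> > 0"
  shows "((\<lambda>t. smooth_abs \<eta> (t - a)) has_real_derivative 2 / pi * arctan ((t - a) / \<eta>)) (at t)"
proof -
  have pos: "\<eta>\<^sup>2 + (t - a)\<^sup>2 > 0" using assms by (simp add: add_pos_nonneg)
  have "1 + ((t - a) / \<eta>)\<^sup>2 = (\<eta>\<^sup>2 + (t - a)\<^sup>2) / (\<eta> * \<eta>)"
    using assms by (simp add: field_simps power2_eq_square)
  moreover have "inverse (d / (\<eta> * \<eta>)) * (1 / \<eta>) = \<eta> / d" for d
    using assms by (simp add: inverse_eq_divide)
  ultimately have eq: "inverse (1 + ((t - a) / \<eta>)\<^sup>2) * (1 / \<eta>) = \<eta> / (\<eta>\<^sup>2 + (t - a)\<^sup>2)"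
    by simp
  have "((\<lambda>t. (t - a) / \<eta>) has_real_derivative 1 / \<eta>) (at t)"
    by (rule derivative_eq_intros refl | simp add: assms less_imp_neq[OF assms, symmetric])+
  from DERIV_chain2[OF DERIV_arctan this]
  have 1: "((\<lambda>t. arctan ((t - a) / \<eta>)) has_real_derivative \<eta> / (\<eta>\<^sup>2 + (t - a)\<^sup>2)) (at t)"
    unfolding eq .
  have "((\<lambda>t. \<eta>\<^sup>2 + (t - a)\<^sup>2) has_real_derivative 2 * (t - a)) (at t)"
    by (rule derivative_eq_intros refl | simp)+
  from DERIV_chain2[OF DERIV_ln_divide[OF pos] this]
  have 2: "((\<lambda>t. ln (\<eta>\<^sup>2 + (t - a)\<^sup>2)) has_real_derivative 1 / (\<eta>\<^sup>2 + (t - a)\<^sup>2) * (2 * (t - a))) (at t)" .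
  have 3: "((\<lambda>t. 2 / pi * (t - a)) has_real_derivative 2 / pi) (at t)"
    by (rule derivative_eq_intros refl | simp)+
  show ?thesis
    unfolding smooth_abs_def
    by (rule DERIV_cong[OF DERIV_diff[OF DERIV_mult[OF 3 1] DERIV_cmult[OF 2]]]) (simp add: mult_ac)
qed

lemma smooth_abs_tendsto: "((\<lambda>\<eta>. smooth_abs \<eta> u) \<longlongrightarrow> \<bar>u\<bar>) (at_right 0)"
proof (cases u "0::real" rule: linorder_cases)
  case less
  have "((\<lambda>\<eta>. 2 / pi * u * arctan (u / \<eta>)) \<longlongrightarrow> 2 / pi * u * (- (pi / 2))) (at_right 0)"
    by (intro tendsto_intros filterlim_compose[OF tendsto_arctan_at_bot]) (use less in real_asymp)
  moreover have "((\<lambda>\<eta>. \<eta> / pi * ln (\<eta>\<^sup>2 + u\<^sup>2)) \<longlongrightarrow> 0) (at_right 0)"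
    using less by real_asymp
  ultimately show ?thesis
    unfolding smooth_abs_def using less tendsto_diff by fastforce
next
  case equal
  have "((\<lambda>\<eta>::real. \<eta> / pi * ln (\<eta>\<^sup>2)) \<longlongrightarrow> 0) (at_right 0)" by real_asymp
  then show ?thesis using equal tendsto_minus unfolding smooth_abs_def by fastforce
next
  case greater
  have "((\<lambda>\<eta>. 2 / pi * u * arctan (u / \<eta>)) \<longlongrightarrow> 2 / pi * u * (pi / 2)) (at_right 0)"
    by (intro tendsto_intros filterlim_compose[OF tendsto_arctan_at_top]) (use greater in real_asymp)
  moreover have "((\<lambda>\<eta>. \<eta> / pi * ln (\<eta>\<^sup>2 + u\<^sup>2)) \<longlongrightarrow> 0) (at_right 0)"
    using greater by real_asymp
  ultimately show ?thesis
    unfolding smooth_abs_def using greater tendsto_diff by fastforce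
qed

text \<open>Replacing the absolute value by \<open>smooth_abs\<close> gives functions \<open>W\<close> whose derivative is \<open>2 / pi\<close> times
  the phase difference, hence at most 1 in absolute value. The bound survives the limit.\<close>
lemma rect_young_diagram_lipschitz:
  assumes len: "length xs = Suc (length ys)"
    and pos: "\<And>z. Im z > 0 \<Longrightarrow> 0 < Im (cnj (\<Prod>y\<leftarrow>ys. z - complex_of_real y) * (\<Prod>x\<leftarrow>xs. z - complex_of_real x))"
  shows "\<bar>rect_young_diagram xs ys t - rect_young_diagram xs ys s\<bar> \<le> \<bar>t - s\<bar>"
proof -
  define W where "W = (\<lambda>\<eta> t. (\<Sum>x\<leftarrow>xs. smooth_abs \<eta> (t - x)) - (\<Sum>y\<leftarrow>ys. smooth_abs \<eta> (t - y)))"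
  have bound: "\<bar>W \<eta> t - W \<eta> s\<bar> \<le> \<bar>t - s\<bar>" if \<eta>: "\<eta> > 0" for \<eta>
  proof -
    define W' where "W' = (\<lambda>t. 2 / pi * ((\<Sum>x\<leftarrow>xs. arctan ((t - x) / \<eta>)) - (\<Sum>y\<leftarrow>ys. arctan ((t - y) / \<eta>))))"
    have deriv: "(W \<eta> has_real_derivative W' t) (at t)" for t
    proof -
      have "(W \<eta> has_real_derivative (\<Sum>x\<leftarrow>xs. 2 / pi * arctan ((t - x) / \<eta>)) - (\<Sum>y\<leftarrow>ys. 2 / pi * arctan ((t - y) / \<eta>))) (at t)"
        unfolding W_def by (intro DERIV_diff has_real_derivative_sum_list smooth_abs_derivative \<eta>)
      then show ?thesis unfolding W'_def right_diff_distrib sum_list_const_mult .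
    qed
    have "\<bar>W' t\<bar> \<le> 1" for t
    proof -
      have "\<bar>W' t\<bar> = 2 / pi * \<bar>(\<Sum>x\<leftarrow>xs. arctan ((t - x) / \<eta>)) - (\<Sum>y\<leftarrow>ys. arctan ((t - y) / \<eta>))\<bar>"
        unfolding W'_def abs_mult by simp
      also have "\<dots> \<le> 2 / pi * (pi / 2)"
        using phase_difference_bound[OF len pos \<eta>] by (intro mult_left_mono) (auto intro: less_imp_le)
      finally show ?thesis by simp
    qed
    then have "norm (W \<eta> t - W \<eta> s) \<le> 1 * norm (t - s)"
      by (intro field_differentiable_bound[of UNIV "W \<eta>" W']) (auto intro: deriv)
    then show ?thesis by simp
  qed
  have lim: "((\<lambda>\<eta>. W \<eta> t) \<longlongrightarrow> rect_young_diagram xs ys t) (at_right 0)" for t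
    unfolding W_def rect_young_diagram_def
    by (intro tendsto_diff tendsto_sum_list smooth_abs_tendsto)
  show ?thesis
  proof (rule tendsto_upperbound)
    show "((\<lambda>\<eta>. \<bar>W \<eta> t - W \<eta> s\<bar>) \<longlongrightarrow> \<bar>rect_young_diagram xs ys t - rect_young_diagram xs ys s\<bar>) (at_right 0)"
      by (intro tendsto_intros lim)
    show "\<forall>\<^sub>F \<eta> in at_right 0. \<bar>W \<eta> t - W \<eta> s\<bar> \<le> \<bar>t - s\<bar>"
      using bound by (auto simp: eventually_at_right_field intro: exI[of _ 1])
  qed simp
qed

lemma sum_list_const_diff: "(\<Sum>x\<leftarrow>xs. t - x) = real (length xs) * t - sum_list (xs :: real list)"
  by (induction xs) (auto simp: algebra_simps)

lemma rect_young_diagram_right: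
  assumes len: "length xs = Suc (length ys)" and le: "\<And>x. x \<in> set xs \<union> set ys \<Longrightarrow> x \<le> t"
  shows "rect_young_diagram xs ys t = t - (sum_list xs - sum_list ys)"
proof -
  have "(\<Sum>x\<leftarrow>zs. \<bar>t - x\<bar>) = (\<Sum>x\<leftarrow>zs. t - x)" if "set zs \<subseteq> set xs \<union> set ys" for zs
    using that le by (intro arg_cong[of _ _ sum_list] map_cong) auto
  then show ?thesis
    by (simp add: rect_young_diagram_def sum_list_const_diff len algebra_simps)
qed

lemma rect_young_diagram_left:
  assumes len: "length xs = Suc (length ys)" and le: "\<And>x. x \<in> set xs \<union> set ys \<Longrightarrow> t \<le> x"
  shows "rect_young_diagram xs ys t = (sum_list xs - sum_list ys) - t"
proof -
  have "(\<Sum>x\<leftarrow>zs. \<bar>t - x\<bar>) = (\<Sum>x\<leftarrow>zs. - (t - x))" if "set zs \<subseteq> set xs \<union> set ys" for zs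
    by (intro arg_cong[of _ _ sum_list] map_cong refl abs_of_nonpos) (use that le in force)
  moreover have "(\<Sum>x\<leftarrow>zs. - (t - x)) = sum_list zs - real (length zs) * t" for zs
    by (induction zs) (auto simp: algebra_simps)
  ultimately have "rect_young_diagram xs ys t
      = (sum_list xs - real (length xs) * t) - (sum_list ys - real (length ys) * t)"
    unfolding rect_young_diagram_def by simp
  then show ?thesis by (simp add: len algebra_simps)
qed


section \<open>Uniform convergence from moments\<close>

lemma lipschitz_imp_continuous:
  fixes f :: "real \<Rightarrow> real"
  assumes "\<And>t u. \<bar>f t - f u\<bar> \<le> c * \<bar>t - u\<bar>"
  shows "continuous_on S f"
proof -
  have "c \<ge> 0" using assms[of 1 0] by simp
  then have "c-lipschitz_on UNIV f" using assms by (intro lipschitz_onI) (auto simp: dist_real_def)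
  then show ?thesis by (meson continuous_on_subset lipschitz_on_continuous_on subset_UNIV)
qed

lemma integral_extend_zero:
  fixes f :: "real \<Rightarrow> real"
  assumes "continuous_on UNIV f" "\<And>t. \<bar>t\<bar> > a \<Longrightarrow> f t = 0" "a \<le> b"
  shows "integral {-b..b} f = integral {-a..a} f"
proof -
  have "f integrable_on {-a..a}"
    by (intro integrable_continuous_real) (rule continuous_on_subset[OF assms(1) subset_UNIV])
  then have "(f has_integral integral {-a..a} f) {-a..a}" by (rule integrable_integral)
  then have "(f has_integral integral {-a..a} f) {-b..b}"
    by (rule has_integral_on_superset) (use assms in auto)
  then show ?thesis by (rule integral_unique)
qed

text \<open>Nonnegative Lipschitz functions with compact supports of unbounded size, whose moments converge to
  those of a function with a fixed compact support.\<close>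
locale converging_moments =
  fixes s :: "nat \<Rightarrow> real \<Rightarrow> real" and R :: "nat \<Rightarrow> real" and \<sigma> :: "real \<Rightarrow> real"
  assumes s_nonneg: "\<And>n t. 0 \<le> s n t" and s_lipschitz: "\<And>n t u. \<bar>s n t - s n u\<bar> \<le> \<bar>t - u\<bar>"
    and s_support: "\<And>n t. R n < \<bar>t\<bar> \<Longrightarrow> s n t = 0" and R_ge: "\<And>n. 4 \<le> R n"
    and \<sigma>_nonneg: "\<And>t. 0 \<le> \<sigma> t" and \<sigma>_lipschitz: "\<And>t u. \<bar>\<sigma> t - \<sigma> u\<bar> \<le> \<bar>t - u\<bar>"
    and \<sigma>_support: "\<And>t. 2 < \<bar>t\<bar> \<Longrightarrow> \<sigma> t = 0"
    and moments_tendsto: "\<And>k. (\<lambda>n. integral {- R n..R n} (\<lambda>t. t ^ k * s n t)) \<longlonglongrightarrow> integral {-2..2} (\<lambda>t. t ^ k * \<sigma> t)"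
begin

definition gap :: "nat \<Rightarrow> real \<Rightarrow> real" where "gap n t = s n t - \<sigma> t"

definition integ :: "nat \<Rightarrow> (real \<Rightarrow> real) \<Rightarrow> real" where "integ n f = integral {- R n..R n} f"

definition mom :: "nat \<Rightarrow> real" where "mom k = integral {-2..2} (\<lambda>t. t ^ k * \<sigma> t)"

lemma continuous_s [continuous_intros]: "continuous_on S (s n)"
  and continuous_\<sigma> [continuous_intros]: "continuous_on S \<sigma>"
  using lipschitz_imp_continuous[of "s n" 1] lipschitz_imp_continuous[of \<sigma> 1] s_lipschitz \<sigma>_lipschitz by auto

lemma continuous_gap [continuous_intros]: "continuous_on S (gap n)"
  unfolding gap_def[abs_def] by (intro continuous_intros)

lemma integrable: "continuous_on UNIV f \<Longrightarrow> f integrable_on {a..b}" for f :: "real \<Rightarrow> real"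
  by (intro integrable_continuous_real) (erule continuous_on_subset, simp)

lemma integ_\<sigma>: "integ n (\<lambda>t. t ^ k * \<sigma> t) = mom k"
  unfolding integ_def mom_def using \<sigma>_support R_ge[of n]
  by (intro integral_extend_zero) (auto intro!: continuous_intros)

lemma integ_gap: "integ n (\<lambda>t. t ^ k * gap n t) = integ n (\<lambda>t. t ^ k * s n t) - mom k"
  unfolding gap_def right_diff_distrib integ_\<sigma>[symmetric, of k n] integ_def
  by (rule integral_diff) (intro integrable continuous_intros)+

lemma integ_gap_tendsto: "(\<lambda>n. integ n (\<lambda>t. t ^ k * gap n t)) \<longlonglongrightarrow> 0"
  unfolding integ_gap using tendsto_diff[OF moments_tendsto[of k] tendsto_const, of "mom k"]
  by (simp add: integ_def mom_def)

lemma integ_polynomial_tendsto: "(\<lambda>n. integ n (\<lambda>t. (\<Sum>i\<le>d. a i * t ^ i) * gap n t)) \<longlonglongrightarrow> 0"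
proof -
  have "integ n (\<lambda>t. (\<Sum>i\<le>d. a i * t ^ i) * gap n t) = (\<Sum>i\<le>d. a i * integ n (\<lambda>t. t ^ i * gap n t))" for n
  proof -
    have "integ n (\<lambda>t. (\<Sum>i\<le>d. a i * t ^ i) * gap n t) = integ n (\<lambda>t. \<Sum>i\<le>d. a i * (t ^ i * gap n t))"
      by (simp add: sum_distrib_right mult.assoc)
    also have "\<dots> = (\<Sum>i\<le>d. integral {- R n..R n} (\<lambda>t. a i * (t ^ i * gap n t)))"
      unfolding integ_def by (rule integral_sum) (auto intro!: integrable continuous_intros)
    finally show ?thesis by (simp add: integ_def)
  qed
  moreover have "(\<lambda>n. \<Sum>i\<le>d. a i * integ n (\<lambda>t. t ^ i * gap n t)) \<longlonglongrightarrow> (\<Sum>i\<le>d. a i * 0)"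
    by (intro tendsto_intros integ_gap_tendsto)
  ultimately show ?thesis by simp
qed

lemma mom_nonneg: "0 \<le> mom (2 * q)"
  unfolding mom_def by (intro integral_nonneg integrable continuous_intros) (auto simp: \<sigma>_nonneg)

lemma mom_le: "mom (2 * q) \<le> 4 ^ q * mom 0"
proof -
  have "mom (2 * q) \<le> integral {-2..2} (\<lambda>t. 4 ^ q * (t ^ 0 * \<sigma> t))"
    unfolding mom_def
  proof (intro integral_le integrable continuous_intros)
    fix t :: real assume "t \<in> {-2..2}"
    then have "t\<^sup>2 \<le> 4" using abs_le_square_iff[of t 2] by auto
    then have "(t\<^sup>2) ^ q \<le> 4 ^ q" by (intro power_mono) auto
    then show "t ^ (2 * q) * \<sigma> t \<le> 4 ^ q * (t ^ 0 * \<sigma> t)"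
      by (simp add: power_mult mult_right_mono \<sigma>_nonneg)
  qed
  then show ?thesis by (simp add: mom_def)
qed

lemma abs_gap_le: "\<bar>gap n t\<bar> \<le> s n t + \<sigma> t"
  using s_nonneg[of n t] \<sigma>_nonneg[of t] by (simp add: gap_def abs_le_iff)

lemma gap_lipschitz: "\<bar>gap n t - gap n u\<bar> \<le> 2 * \<bar>t - u\<bar>"
proof -
  have "gap n t - gap n u = (s n t - s n u) - (\<sigma> t - \<sigma> u)" by (simp add: gap_def)
  also have "\<bar>\<dots>\<bar> \<le> \<bar>s n t - s n u\<bar> + \<bar>\<sigma> t - \<sigma> u\<bar>" by (rule abs_triangle_ineq4)
  finally show ?thesis using s_lipschitz[of n t u] \<sigma>_lipschitz[of t u] by simp
qed

text \<open>Approximate \<open>g\<close> by a polynomial \<open>P\<close> on the interval from -4 to 4. Outside of it \<open>P\<close> is dominated by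
  a high even power with a small factor, as \<open>\<bar>t\<bar> ^ d \<le> 4 ^ d / 16 ^ q * t ^ (2 * q)\<close> for \<open>\<bar>t\<bar> \<ge> 4\<close>.
  The functions \<open>s n\<close> are nonnegative, so the error is controlled by a moment of order \<open>2 q\<close>, which
  grows only like \<open>4 ^ q\<close> because the limit is supported between -2 and 2.\<close>
lemma integ_test_function_tendsto:
  assumes g: "continuous_on UNIV g" and g0: "\<And>t. 4 < \<bar>t\<bar> \<Longrightarrow> g t = 0"
  shows "(\<lambda>n. integ n (\<lambda>t. g t * gap n t)) \<longlonglongrightarrow> 0"
proof (rule tendstoI)
  fix e :: real assume e: "e > 0"
  define \<eta> where "\<eta> = e / (4 * (2 * mom 0 + 1))"
  have m0: "mom 0 \<ge> 0" using mom_nonneg[of 0] by simp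
  have \<eta>: "\<eta> > 0" "\<eta> * (2 * mom 0 + 1) = e / 4"
  proof -
    have X: "2 * mom 0 + 1 > 0" using m0 by simp
    have "e / (4 * X) * X = e / 4" if "X > 0" for X using that by simp
    from this[OF X] show "\<eta> * (2 * mom 0 + 1) = e / 4" by (simp only: \<eta>_def)
    show "\<eta> > 0" using X e by (simp add: \<eta>_def)
  qed
  obtain P where "real_polynomial_function P" and P: "\<And>t. t \<in> {-4..4} \<Longrightarrow> \<bar>g t - P t\<bar> < \<eta>"
    by (rule Stone_Weierstrass_real_polynomial_function[OF compact_Icc[of "-4 :: real" 4]
          continuous_on_subset[OF g subset_UNIV] \<eta>(1)]) blast
  then obtain a d where Pa: "P = (\<lambda>t. \<Sum>i\<le>d. a i * t ^ i)"
    unfolding real_polynomial_function_iff_sum by blast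
  define A where "A = (\<Sum>i\<le>d. \<bar>a i\<bar>)"
  have A: "A \<ge> 0" by (simp add: A_def sum_nonneg)
  have "(\<lambda>q. A * 4 ^ d * (2 * mom 0 + 1) * (1 / 4 :: real) ^ q) \<longlonglongrightarrow> A * 4 ^ d * (2 * mom 0 + 1) * 0"
    by (intro tendsto_intros LIMSEQ_realpow_zero) auto
  then have "\<forall>\<^sub>F q in sequentially. A * 4 ^ d * (2 * mom 0 + 1) * (1 / 4 :: real) ^ q < e / 4"
    using e by (intro order_tendstoD(2)) auto
  with eventually_ge_at_top[of d]
  have "\<forall>\<^sub>F q in sequentially. d \<le> q \<and> A * 4 ^ d * (2 * mom 0 + 1) * (1 / 4 :: real) ^ q < e / 4"
    by (rule eventually_conj)
  from eventually_happens'[OF sequentially_bot this]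
  obtain q where q: "d \<le> q" "A * 4 ^ d * (2 * mom 0 + 1) * (1 / 4 :: real) ^ q < e / 4"
    by blast
  define c where "c = A * 4 ^ d / 16 ^ q"
  have c: "c \<ge> 0" using A by (simp add: c_def)
  have c_le: "c * (2 * mom (2 * q) + 1) \<le> e / 4"
  proof -
    have "2 * mom (2 * q) + 1 \<le> 2 * (4 ^ q * mom 0) + 4 ^ q * 1"
      using mom_le[of q] by (intro add_mono) auto
    also have "\<dots> = 4 ^ q * (2 * mom 0 + 1)" by (simp add: algebra_simps)
    finally have "c * (2 * mom (2 * q) + 1) \<le> c * (4 ^ q * (2 * mom 0 + 1))"
      using c by (rule mult_left_mono)
    also have "(16::real) ^ q = 4 ^ q * 4 ^ q" by (simp add: power_mult_distrib[symmetric])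
    then have "c * (4 ^ q * (2 * mom 0 + 1)) = A * 4 ^ d * (2 * mom 0 + 1) * (1 / 4) ^ q"
      by (simp add: c_def power_divide)
    finally show ?thesis using q(2) by simp
  qed
  have gP: "\<bar>g t - P t\<bar> \<le> \<eta> + c * t ^ (2 * q)" for t
  proof (cases "\<bar>t\<bar> \<le> 4")
    case True
    then have "\<bar>g t - P t\<bar> < \<eta>" by (intro P) auto
    moreover have "0 \<le> c * t ^ (2 * q)" using c by (simp add: power_mult)
    ultimately show ?thesis by simp
  next
    case False
    then have t: "4 \<le> \<bar>t\<bar>" by simp
    have "\<bar>P t\<bar> \<le> (\<Sum>i\<le>d. \<bar>a i\<bar> * \<bar>t\<bar> ^ i)"
      unfolding Pa by (rule order_trans[OF sum_abs]) (simp add: abs_mult power_abs)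
    also have "\<dots> \<le> (\<Sum>i\<le>d. \<bar>a i\<bar> * \<bar>t\<bar> ^ d)"
      using t by (intro sum_mono mult_left_mono power_increasing) auto
    also have "\<dots> = A * \<bar>t\<bar> ^ d" by (simp add: A_def sum_distrib_right)
    also have "\<bar>t\<bar> ^ d \<le> 4 ^ d / 16 ^ q * t ^ (2 * q)"
    proof -
      have "2 * q = d + (2 * q - d)" using q(1) by simp
      then have split: "x ^ (2 * q) = x ^ d * x ^ (2 * q - d)" for x :: real by (metis power_add)
      have "\<bar>t\<bar> ^ d * 4 ^ (2 * q) = \<bar>t\<bar> ^ d * 4 ^ d * 4 ^ (2 * q - d)" by (simp add: split)
      also have "\<dots> \<le> \<bar>t\<bar> ^ d * 4 ^ d * \<bar>t\<bar> ^ (2 * q - d)"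
        using t by (intro mult_left_mono power_mono) auto
      also have "\<dots> = 4 ^ d * \<bar>t\<bar> ^ (2 * q)"
        unfolding split[of "\<bar>t\<bar>"] by (simp only: mult_ac)
      finally have "\<bar>t\<bar> ^ d * 16 ^ q \<le> 4 ^ d * t ^ (2 * q)" by (simp add: power_mult)
      then show ?thesis by (simp add: field_simps)
    qed
    then have "A * \<bar>t\<bar> ^ d \<le> A * (4 ^ d / 16 ^ q * t ^ (2 * q))" using A by (rule mult_left_mono)
    finally have "\<bar>P t\<bar> \<le> c * t ^ (2 * q)" by (simp add: c_def)
    then show ?thesis using g0[of t] False \<eta> by simp
  qed
  have Pc: "continuous_on UNIV P" unfolding Pa by (intro continuous_intros)
  have ev1: "\<forall>\<^sub>F n in sequentially. \<bar>integ n (\<lambda>t. P t * gap n t)\<bar> < e / 4"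
    using tendstoD[OF integ_polynomial_tendsto[of a d], of "e / 4"] e by (simp add: Pa)
  have ev2: "\<forall>\<^sub>F n in sequentially. integ n (\<lambda>t. t ^ k * gap n t) < 1" for k
    by (rule order_tendstoD(2)[OF integ_gap_tendsto]) simp
  show "\<forall>\<^sub>F n in sequentially. dist (integ n (\<lambda>t. g t * gap n t)) 0 < e"
    using ev1 ev2[of 0] ev2[of "2 * q"]
  proof eventually_elim
    case (elim n)
    have sum_eq: "integ n (\<lambda>t. t ^ k * (s n t + \<sigma> t)) = integ n (\<lambda>t. t ^ k * gap n t) + 2 * mom k" for k
    proof -
      have "integ n (\<lambda>t. t ^ k * (s n t + \<sigma> t)) = integ n (\<lambda>t. t ^ k * gap n t + 2 * (t ^ k * \<sigma> t))"
        by (simp add: gap_def algebra_simps)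
      also have "\<dots> = integ n (\<lambda>t. t ^ k * gap n t) + integ n (\<lambda>t. 2 * (t ^ k * \<sigma> t))"
        unfolding integ_def by (rule integral_add) (intro integrable continuous_intros)+
      also have "integ n (\<lambda>t. 2 * (t ^ k * \<sigma> t)) = 2 * mom k"
        unfolding integ_\<sigma>[symmetric, of k n] by (simp add: integ_def)
      finally show ?thesis .
    qed
    have "integ n (\<lambda>t. g t * gap n t) - integ n (\<lambda>t. P t * gap n t) = integ n (\<lambda>t. (g t - P t) * gap n t)"
      unfolding integ_def left_diff_distrib
      by (rule integral_diff[symmetric]) (intro integrable continuous_intros g Pc)+
    also have "\<bar>\<dots>\<bar> \<le> integ n (\<lambda>t. (\<eta> + c * t ^ (2 * q)) * (s n t + \<sigma> t))"
      unfolding integ_def real_norm_def[symmetric]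
    proof (intro integral_norm_bound_integral integrable continuous_intros g Pc)
      fix t
      have "\<bar>g t - P t\<bar> * \<bar>gap n t\<bar> \<le> (\<eta> + c * t ^ (2 * q)) * (s n t + \<sigma> t)"
        using gP[of t] by (intro mult_mono abs_gap_le gP) (auto intro: order_trans[OF abs_ge_zero gP])
      then show "norm ((g t - P t) * gap n t) \<le> (\<eta> + c * t ^ (2 * q)) * (s n t + \<sigma> t)"
        by (simp add: abs_mult)
    qed
    also have "\<dots> = integ n (\<lambda>t. \<eta> * (t ^ 0 * (s n t + \<sigma> t)) + c * (t ^ (2 * q) * (s n t + \<sigma> t)))"
      by (simp add: algebra_simps)
    also have "\<dots> = \<eta> * integ n (\<lambda>t. t ^ 0 * (s n t + \<sigma> t)) + c * integ n (\<lambda>t. t ^ (2 * q) * (s n t + \<sigma> t))"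
      unfolding integ_def integral_mult_right[symmetric]
      by (rule integral_add) (intro integrable continuous_intros)+
    also have "\<dots> \<le> \<eta> * (2 * mom 0 + 1) + c * (2 * mom (2 * q) + 1)"
      unfolding sum_eq
    proof (rule add_mono)
      show "\<eta> * (integ n (\<lambda>t. t ^ 0 * gap n t) + 2 * mom 0) \<le> \<eta> * (2 * mom 0 + 1)"
        using elim(2) \<eta>(1) by (intro mult_left_mono) auto
      show "c * (integ n (\<lambda>t. t ^ (2 * q) * gap n t) + 2 * mom (2 * q)) \<le> c * (2 * mom (2 * q) + 1)"
        using elim(3) c by (intro mult_left_mono) auto
    qed
    also have "\<dots> \<le> e / 4 + e / 4" using \<eta>(2) c_le by simp
    finally have "\<bar>integ n (\<lambda>t. g t * gap n t) - integ n (\<lambda>t. P t * gap n t)\<bar> \<le> e / 4 + e / 4" .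
    moreover have "\<bar>a\<bar> < e" if "\<bar>a - b\<bar> \<le> e / 4 + e / 4" "\<bar>b\<bar> < e / 4" for a b
      using that e by linarith
    ultimately show ?case using elim(1) by (simp only: dist_real_def diff_0_right)
  qed
qed

text \<open>Test with a tent function of width \<open>h\<close> at \<open>x\<close>: on its support the gap differs from its value at
  \<open>x\<close> by at most \<open>2 h\<close>.\<close>
lemma gap_pointwise_small:
  assumes x: "\<bar>x\<bar> \<le> 3" and \<epsilon>: "\<epsilon> > 0"
  shows "\<forall>\<^sub>F n in sequentially. \<bar>gap n x\<bar> \<le> \<epsilon>"
proof -
  define h where "h = min 1 (\<epsilon> / 4)"
  have h: "h > 0" "h \<le> 1" "2 * h \<le> \<epsilon> / 2" using \<epsilon> by (auto simp: h_def min_def)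
  define g where "g = (\<lambda>t. max 0 (h - \<bar>t - x\<bar>))"
  have gc: "continuous_on S g" for S unfolding g_def by (intro continuous_intros)
  have g0: "g t = 0" if "4 < \<bar>t\<bar>" for t using that x h by (auto simp: g_def)
  define G where "G = integral {-4..4} g"
  have IG: "integ n g = G" for n
    unfolding integ_def G_def by (rule integral_extend_zero[OF gc g0 R_ge])
  have "h / 2 * h = integral {x - h / 2..x + h / 2} (\<lambda>_. h / 2)" using h by simp
  also have "\<dots> \<le> integral {x - h / 2..x + h / 2} g"
  proof (intro integral_le integrable gc continuous_intros)
    fix t assume "t \<in> {x - h / 2..x + h / 2}"
    then have "x - h / 2 \<le> t" "t \<le> x + h / 2" by auto
    then have "\<bar>t - x\<bar> \<le> h / 2" by linarith
    then have "h / 2 \<le> h - \<bar>t - x\<bar>" by linarith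
    then show "h / 2 \<le> g t" unfolding g_def by (rule max.coboundedI2)
  qed
  also have "\<dots> \<le> G"
    unfolding G_def using x h by (intro integral_subset_le integrable gc) (auto simp: g_def)
  finally have "h / 2 * h \<le> G" .
  then have G: "G > 0" using h by (intro less_le_trans[of 0 "h / 2 * h" G]) auto
  have "\<forall>\<^sub>F n in sequentially. \<bar>integ n (\<lambda>t. g t * gap n t)\<bar> < G * (\<epsilon> / 2)"
    using tendstoD[OF integ_test_function_tendsto[OF gc g0], of "G * (\<epsilon> / 2)"] G \<epsilon> by simp
  then show ?thesis
  proof eventually_elim
    case (elim n)
    have "integ n (\<lambda>t. g t * gap n x) - integ n (\<lambda>t. g t * gap n t) = integ n (\<lambda>t. g t * (gap n x - gap n t))"
      unfolding integ_def right_diff_distrib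
      by (rule integral_diff[symmetric]) (intro integrable continuous_intros gc)+
    also have "\<bar>\<dots>\<bar> \<le> integ n (\<lambda>t. g t * (2 * h))"
      unfolding integ_def real_norm_def[symmetric]
    proof (intro integral_norm_bound_integral integrable continuous_intros gc)
      fix t
      show "norm (g t * (gap n x - gap n t)) \<le> g t * (2 * h)"
      proof (cases "\<bar>t - x\<bar> \<le> h")
        case True
        then have "2 * \<bar>x - t\<bar> \<le> 2 * h" by (simp add: abs_minus_commute)
        with gap_lipschitz[of n x t] have "\<bar>gap n x - gap n t\<bar> \<le> 2 * h" by (rule order_trans)
        then show ?thesis by (auto simp: abs_mult g_def intro!: mult_left_mono)
      qed (auto simp: g_def)
    qed
    also have "\<dots> = G * (2 * h)" using IG[of n] by (simp add: integ_def)
    also have "integ n (\<lambda>t. g t * gap n x) = G * gap n x" using IG[of n] by (simp add: integ_def)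
    finally have "\<bar>G * gap n x - integ n (\<lambda>t. g t * gap n t)\<bar> \<le> G * (2 * h)" .
    moreover have "G * (2 * h) \<le> G * (\<epsilon> / 2)" using G h(3) by (intro mult_left_mono) auto
    ultimately have "\<bar>G * gap n x\<bar> \<le> G * \<epsilon>" using elim by (simp add: field_simps)
    then show ?case using G by (simp add: abs_mult)
  qed
qed

text \<open>A value of at least \<open>\<epsilon>\<close> at a point \<open>x\<close> with \<open>\<bar>x\<bar> \<ge> 3\<close> forces \<open>s n \<ge> \<epsilon> / 2\<close> on an interval of length
  \<open>\<epsilon> / 2\<close> that points away from the origin. Its contribution to the moment of order \<open>2 q\<close> is of order
  \<open>9 ^ q\<close>, too much in comparison with \<open>4 ^ q\<close>.\<close>
lemma tail_small:
  assumes \<epsilon>: "\<epsilon> > 0"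
  shows "\<forall>\<^sub>F n in sequentially. \<forall>x. 3 \<le> \<bar>x\<bar> \<longrightarrow> s n x < \<epsilon>"
proof -
  have "(\<lambda>q. (mom 0 + 1) * (4 / 9 :: real) ^ q) \<longlonglongrightarrow> (mom 0 + 1) * 0"
    by (intro tendsto_intros LIMSEQ_realpow_zero) auto
  then have "\<forall>\<^sub>F q in sequentially. (mom 0 + 1) * (4 / 9 :: real) ^ q < \<epsilon> / 2 * (\<epsilon> / 2)"
    using \<epsilon> by (intro order_tendstoD(2)) auto
  then obtain q where "(mom 0 + 1) * (4 / 9 :: real) ^ q < \<epsilon> / 2 * (\<epsilon> / 2)"
    by (auto simp: eventually_sequentially)
  then have q: "(mom 0 + 1) * 4 ^ q < 9 ^ q * (\<epsilon> / 2) * (\<epsilon> / 2)"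
    by (simp add: power_divide field_simps)
  have "\<forall>\<^sub>F n in sequentially. integ n (\<lambda>t. t ^ (2 * q) * gap n t) < 1"
    by (rule order_tendstoD(2)[OF integ_gap_tendsto]) simp
  then show ?thesis
  proof eventually_elim
    case (elim n)
    show ?case
    proof (intro allI impI, rule ccontr)
      fix x assume x: "3 \<le> \<bar>x\<bar>" and "\<not> s n x < \<epsilon>"
      then have sx: "\<epsilon> \<le> s n x" by simp
      define u where "u = (if x \<ge> 0 then x else x - \<epsilon> / 2)"
      have J: "3 \<le> \<bar>t\<bar>" "\<epsilon> / 2 \<le> s n t" "\<bar>t\<bar> \<le> R n" if "t \<in> {u..u + \<epsilon> / 2}" for t
      proof -
        have near: "\<bar>x - t\<bar> \<le> \<epsilon> / 2" using that by (auto simp: u_def split: if_splits)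
        then show *: "\<epsilon> / 2 \<le> s n t" using s_lipschitz[of n x t] sx by linarith
        show "3 \<le> \<bar>t\<bar>" using that x \<epsilon> by (auto simp: u_def split: if_splits)
        show "\<bar>t\<bar> \<le> R n" using s_support[of n t] * \<epsilon> by force
      qed
      have "9 ^ q * (\<epsilon> / 2) * (\<epsilon> / 2) = integral {u..u + \<epsilon> / 2} (\<lambda>_. 9 ^ q * (\<epsilon> / 2))"
        using \<epsilon> by simp
      also have "\<dots> \<le> integral {u..u + \<epsilon> / 2} (\<lambda>t. t ^ (2 * q) * s n t)"
      proof (intro integral_le integrable continuous_intros)
        fix t assume t: "t \<in> {u..u + \<epsilon> / 2}"
        have "9 \<le> t\<^sup>2" using J(1)[OF t] abs_le_square_iff[of 3 t] by simp
        then have "9 ^ q \<le> (t\<^sup>2) ^ q" by (intro power_mono) auto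
        then show "9 ^ q * (\<epsilon> / 2) \<le> t ^ (2 * q) * s n t"
          unfolding power_mult using J(2)[OF t] \<epsilon> by (intro mult_mono) auto
      qed
      also have "\<dots> \<le> integ n (\<lambda>t. t ^ (2 * q) * s n t)"
        unfolding integ_def
      proof (intro integral_subset_le integrable continuous_intros)
        show "{u..u + \<epsilon> / 2} \<subseteq> {- R n..R n}" using J(3) by (force simp: abs_le_iff)
      qed (auto simp: s_nonneg power_mult)
      also have "\<dots> = integ n (\<lambda>t. t ^ (2 * q) * gap n t) + mom (2 * q)" by (simp add: integ_gap)
      also have "\<dots> \<le> 1 + 4 ^ q * mom 0" using elim mom_le[of q] by simp
      also have "\<dots> \<le> (mom 0 + 1) * 4 ^ q" by (simp add: algebra_simps)
      finally show False using q by simp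
    qed
  qed
qed

text \<open>Beyond 3 this is \<open>tail_small\<close>; on the interval from -3 to 3 pointwise smallness on a grid of mesh
  \<open>\<epsilon> / 4\<close> suffices by the Lipschitz property.\<close>
lemma uniformly_close: 
  assumes \<epsilon>: "\<epsilon> > 0"
  shows "\<forall>\<^sub>F n in sequentially. \<forall>t. \<bar>s n t - \<sigma> t\<bar> \<le> \<epsilon>"
proof -
  define d where "d = \<epsilon> / 4"
  have d: "d > 0" using \<epsilon> by (simp add: d_def)
  define K where "K = nat \<lfloor>6 / d\<rfloor>"
  have grid: "\<bar>- 3 + real k * d\<bar> \<le> 3" if "k \<le> K" for k
  proof -
    have "real k \<le> real K" using that by simp
    also have "real K \<le> 6 / d" unfolding K_def using d by (intro of_nat_floor) simp
    finally have "real k \<le> 6 / d" .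
    then have "real k * d \<le> 6" using d by (simp add: field_simps)
    moreover have "0 \<le> real k * d" using d by simp
    ultimately show ?thesis by simp
  qed
  have "\<forall>\<^sub>F n in sequentially. \<forall>k\<in>{..K}. \<bar>gap n (- 3 + real k * d)\<bar> \<le> \<epsilon> / 2"
    using grid \<epsilon> by (intro eventually_ball_finite ballI gap_pointwise_small) auto
  with tail_small[OF \<epsilon>] show ?thesis
  proof eventually_elim
    case (elim n)
    show ?case
    proof
      fix t
      show "\<bar>s n t - \<sigma> t\<bar> \<le> \<epsilon>"
      proof (cases "3 \<le> \<bar>t\<bar>")
        case True
        then show ?thesis using elim(1) s_nonneg[of n t] \<sigma>_support[of t] by (auto intro: less_imp_le)
      next
        case False
        define k where "k = nat \<lfloor>(t + 3) / d\<rfloor>"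
        have nn: "0 \<le> (t + 3) / d" using False d by simp
        have k: "real k \<le> (t + 3) / d" "(t + 3) / d < real k + 1"
          using nn by (auto simp: k_def)
        have "(t + 3) / d \<le> 6 / d" using False d by (intro divide_right_mono) auto
        then have "k \<le> K" unfolding k_def K_def by (intro nat_mono floor_mono)
        define u where "u = - 3 + real k * d"
        have "\<bar>gap n u\<bar> \<le> \<epsilon> / 2" using elim(2) \<open>k \<le> K\<close> by (simp add: u_def)
        moreover have "\<bar>t - u\<bar> \<le> \<epsilon> / 4"
          using k d by (simp add: u_def d_def[symmetric] field_simps abs_le_iff)
        moreover have "b \<le> \<epsilon>" if "a \<le> \<epsilon> / 2" "r \<le> \<epsilon> / 4" "l \<le> 2 * r" "b \<le> a + l" for a b l r
          using that by linarith
        moreover have "\<bar>gap n t\<bar> \<le> \<bar>gap n u\<bar> + \<bar>gap n t - gap n u\<bar>"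
          using abs_triangle_ineq[of "gap n u" "gap n t - gap n u"] by simp
        ultimately have "\<bar>gap n t\<bar> \<le> \<epsilon>"
          using gap_lipschitz[of n t u] by blast
        then show ?thesis by (simp add: gap_def)
      qed
    qed
  qed
qed

end


section \<open>Moments of diagrams and of the limit curve\<close>

text \<open>Apart from the last term the value is affine in \<open>a\<close>; this part cancels in combinations of total mass
  and mean zero.\<close>
lemma has_integral_power_abs:
  fixes a R :: real
  assumes a: "\<bar>a\<bar> \<le> R"
  shows "((\<lambda>t. t ^ k * \<bar>t - a\<bar>) has_integral
    (R ^ (k + 2) + (- R) ^ (k + 2)) / (k + 2) - (R ^ (k + 1) + (- R) ^ (k + 1)) / (k + 1) * a
      + 2 * a ^ (k + 2) / ((k + 1) * (k + 2))) {- R..R}"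
proof -
  define G where "G = (\<lambda>t. t ^ (k + 2) / real (k + 2) - a * (t ^ (k + 1) / real (k + 1)))"
  have G': "(G has_vector_derivative t ^ k * (t - a)) (at t within T)" for t T
  proof -
    have "(G has_real_derivative (real (k + 2) * t ^ (k + 1)) / real (k + 2) - a * ((real (k + 1) * t ^ k) / real (k + 1))) (at t within T)"
      unfolding G_def by (rule derivative_eq_intros refl | simp)+
    then have "(G has_real_derivative t ^ (k + 1) - a * t ^ k) (at t within T)"
      by (simp del: of_nat_add of_nat_Suc)
    then show ?thesis by (simp add: has_real_derivative_iff_has_vector_derivative algebra_simps)
  qed
  have "((\<lambda>t. t ^ k * (t - a)) has_integral (G R - G a)) {a..R}"
    using a by (intro fundamental_theorem_of_calculus G') auto
  then have right: "((\<lambda>t. t ^ k * \<bar>t - a\<bar>) has_integral (G R - G a)) {a..R}"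
    by (rule has_integral_eq[rotated]) auto
  have "((\<lambda>t. - (t ^ k * (t - a))) has_integral - (G a - G (- R))) {- R..a}"
    using a by (intro has_integral_neg fundamental_theorem_of_calculus G') auto
  then have left: "((\<lambda>t. t ^ k * \<bar>t - a\<bar>) has_integral - (G a - G (- R))) {- R..a}"
    by (rule has_integral_eq[rotated]) (auto simp: algebra_simps)
  have "((\<lambda>t. t ^ k * \<bar>t - a\<bar>) has_integral - (G a - G (- R)) + (G R - G a)) {- R..R}"
    using a by (intro has_integral_combine[OF _ _ left right]) auto
  also have "- (G a - G (- R)) + (G R - G a) = (G R + G (- R)) - 2 * G a" by simp
  also have "G a = - (a ^ (k + 2) / ((k + 1) * (k + 2)))"
    by (simp add: G_def field_simps)
  also have "G R + G (- R) = (R ^ (k + 2) + (- R) ^ (k + 2)) / (k + 2) - (R ^ (k + 1) + (- R) ^ (k + 1)) / (k + 1) * a"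
  proof -
    have "p / u - a * (p' / v) + (q / u - a * (q' / v)) = (p + q) / u - (p' + q') / v * a" for p q p' q' u v :: real
      by (simp add: add_divide_distrib algebra_simps)
    then show ?thesis unfolding G_def by blast
  qed
  finally show ?thesis by simp
qed

lemma has_integral_sum_list:
  fixes f :: "'b \<Rightarrow> real \<Rightarrow> real"
  assumes "\<And>x. x \<in> set xs \<Longrightarrow> (f x has_integral c x) S"
  shows "((\<lambda>t. \<Sum>x\<leftarrow>xs. f x t) has_integral (\<Sum>x\<leftarrow>xs. c x)) S"
  using assms by (induction xs) (auto intro: has_integral_add)

text \<open>The height over the rectangle \<open>\<bar>t - z\<bar>\<close>, halved: the second derivative is then the signed measure
  of the entries of \<open>xs\<close>, minus those of \<open>ys\<close>, minus the unit mass at \<open>z\<close>.\<close>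
definition diagram_excess :: "real list \<Rightarrow> real list \<Rightarrow> real \<Rightarrow> real" where
  "diagram_excess xs ys t = (rect_young_diagram xs ys t - \<bar>t - (sum_list xs - sum_list ys)\<bar>) / 2"

lemma diagram_excess_moment:
  fixes xs ys :: "real list"
  assumes len: "length xs = Suc (length ys)"
    and R: "\<And>x. x \<in> set xs \<union> set ys \<Longrightarrow> \<bar>x\<bar> \<le> R" "\<bar>sum_list xs - sum_list ys\<bar> \<le> R"
  shows "((\<lambda>t. t ^ k * diagram_excess xs ys t) has_integral
    ((\<Sum>x\<leftarrow>xs. x ^ (k + 2)) - (\<Sum>y\<leftarrow>ys. y ^ (k + 2)) - (sum_list xs - sum_list ys) ^ (k + 2)) / ((k + 1) * (k + 2))) {- R..R}"
proof -
  define A B c where "A = (R ^ (k + 2) + (- R) ^ (k + 2)) / real (k + 2)"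
    and "B = (R ^ (k + 1) + (- R) ^ (k + 1)) / real (k + 1)"
    and "c = 2 / real ((k + 1) * (k + 2))"
  define z where "z = sum_list xs - sum_list ys"
  have halve: "2 / v / 2 * u = u / v" for u v :: real by simp
  have single: "((\<lambda>t. t ^ k * \<bar>t - a\<bar>) has_integral (A - B * a + c * a ^ (k + 2))) {- R..R}" if "\<bar>a\<bar> \<le> R" for a
    using has_integral_power_abs[OF that, of k] by (simp add: A_def B_def c_def)
  have many: "((\<lambda>t. \<Sum>x\<leftarrow>zs. t ^ k * \<bar>t - x\<bar>) has_integral
      (real (length zs) * A - B * sum_list zs + c * (\<Sum>x\<leftarrow>zs. x ^ (k + 2)))) {- R..R}"
    if "set zs \<subseteq> set xs \<union> set ys" for zs
  proof -
    have "((\<lambda>t. \<Sum>x\<leftarrow>zs. t ^ k * \<bar>t - x\<bar>) has_integral (\<Sum>x\<leftarrow>zs. A - B * x + c * x ^ (k + 2))) {- R..R}"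
      using that R(1) by (intro has_integral_sum_list single) auto
    also have "(\<Sum>x\<leftarrow>zs. A - B * x + c * x ^ (k + 2)) = real (length zs) * A - B * sum_list zs + c * (\<Sum>x\<leftarrow>zs. x ^ (k + 2))"
      by (induction zs) (auto simp: algebra_simps)
    finally show ?thesis .
  qed
  have "((\<lambda>t. ((\<Sum>x\<leftarrow>xs. t ^ k * \<bar>t - x\<bar>) - (\<Sum>y\<leftarrow>ys. t ^ k * \<bar>t - y\<bar>) - t ^ k * \<bar>t - z\<bar>) * (1 / 2)) has_integral
      ((real (length xs) * A - B * sum_list xs + c * (\<Sum>x\<leftarrow>xs. x ^ (k + 2)))
       - (real (length ys) * A - B * sum_list ys + c * (\<Sum>y\<leftarrow>ys. y ^ (k + 2)))
       - (A - B * z + c * z ^ (k + 2))) * (1 / 2)) {- R..R}"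
    using R(2) by (intro has_integral_mult_left has_integral_diff many single) (auto simp: z_def)
  also have "(\<lambda>t. ((\<Sum>x\<leftarrow>xs. t ^ k * \<bar>t - x\<bar>) - (\<Sum>y\<leftarrow>ys. t ^ k * \<bar>t - y\<bar>) - t ^ k * \<bar>t - z\<bar>) * (1 / 2))
      = (\<lambda>t. t ^ k * diagram_excess xs ys t)"
    by (simp add: diagram_excess_def rect_young_diagram_def sum_list_const_mult right_diff_distrib z_def fun_eq_iff)
  also have "((real (length xs) * A - B * sum_list xs + c * (\<Sum>x\<leftarrow>xs. x ^ (k + 2)))
       - (real (length ys) * A - B * sum_list ys + c * (\<Sum>y\<leftarrow>ys. y ^ (k + 2)))
       - (A - B * z + c * z ^ (k + 2))) * (1 / 2)
      = (c / 2) * ((\<Sum>x\<leftarrow>xs. x ^ (k + 2)) - (\<Sum>y\<leftarrow>ys. y ^ (k + 2)) - z ^ (k + 2))"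
    by (simp add: len z_def algebra_simps)
  also have "c / 2 * u = u / real ((k + 1) * (k + 2))" for u
    unfolding c_def by (rule halve)
  finally show ?thesis unfolding z_def .
qed

text \<open>A 1-Lipschitz function that equals \<open>\<bar>t - z\<bar>\<close> far out lies above \<open>\<bar>t - z\<bar>\<close> everywhere: descend with
  slope at most 1 from a distant point \<open>b\<close> or \<open>- b\<close>.\<close>
lemma rect_young_diagram_shape:
  assumes len: "length xs = Suc (length ys)"
    and lip: "\<And>t s. \<bar>rect_young_diagram xs ys t - rect_young_diagram xs ys s\<bar> \<le> \<bar>t - s\<bar>"
  shows "0 \<le> diagram_excess xs ys t"
    and "\<bar>diagram_excess xs ys t - diagram_excess xs ys s\<bar> \<le> \<bar>t - s\<bar>"
    and "(\<And>x. x \<in> set xs \<union> set ys \<Longrightarrow> \<bar>x\<bar> \<le> R) \<Longrightarrow> \<bar>sum_list xs - sum_list ys\<bar> \<le> R \<Longrightarrow> R < \<bar>t\<bar>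
      \<Longrightarrow> diagram_excess xs ys t = 0"
proof -
  let ?w = "rect_young_diagram xs ys" and ?z = "sum_list xs - sum_list ys"
  define b where "b = \<bar>t\<bar> + (\<Sum>x\<in>set xs \<union> set ys. \<bar>x\<bar>)"
  have b: "\<bar>x\<bar> \<le> b" if "x \<in> set xs \<union> set ys" for x
    unfolding b_def using that by (intro add_increasing member_le_sum) auto
  have bt: "\<bar>t\<bar> \<le> b" by (simp add: b_def sum_nonneg)
  have "?w b = b - ?z" using b by (intro rect_young_diagram_right[OF len]) (auto simp: abs_le_iff)
  then have 1: "t - ?z \<le> ?w t" using lip[of b t] bt by linarith
  have "?w (- b) = ?z + b" using b rect_young_diagram_left[OF len, of "- b"] by (force simp: abs_le_iff)
  then have 2: "?z - t \<le> ?w t" using lip[of "- b" t] bt by linarith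
  show "0 \<le> diagram_excess xs ys t" using 1 2 by (simp add: diagram_excess_def abs_le_iff)
  have "\<bar>(?w t - ?w s) - (\<bar>t - ?z\<bar> - \<bar>s - ?z\<bar>)\<bar> \<le> \<bar>?w t - ?w s\<bar> + \<bar>\<bar>t - ?z\<bar> - \<bar>s - ?z\<bar>\<bar>"
    by (rule abs_triangle_ineq4)
  also have "\<dots> \<le> \<bar>t - s\<bar> + \<bar>t - s\<bar>" by (intro add_mono lip) linarith
  finally have "\<bar>(?w t - ?w s) - (\<bar>t - ?z\<bar> - \<bar>s - ?z\<bar>)\<bar> \<le> 2 * \<bar>t - s\<bar>" by simp
  moreover have "\<bar>u / 2\<bar> \<le> r" if "\<bar>u\<bar> \<le> 2 * r" for u r :: real using that by simp
  moreover have "diagram_excess xs ys t - diagram_excess xs ys s = ((?w t - ?w s) - (\<bar>t - ?z\<bar> - \<bar>s - ?z\<bar>)) / 2"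
    by (simp add: diagram_excess_def diff_divide_distrib)
  ultimately show "\<bar>diagram_excess xs ys t - diagram_excess xs ys s\<bar> \<le> \<bar>t - s\<bar>" by metis
  assume R: "\<And>x. x \<in> set xs \<union> set ys \<Longrightarrow> \<bar>x\<bar> \<le> R" "\<bar>?z\<bar> \<le> R" "R < \<bar>t\<bar>"
  show "diagram_excess xs ys t = 0"
  proof (cases "t \<ge> 0")
    case True
    have "x \<le> t" if "x \<in> set xs \<union> set ys" for x using R(1)[OF that] R(3) True by linarith
    then have "?w t = t - ?z" by (rule rect_young_diagram_right[OF len])
    then show ?thesis using R True by (simp add: diagram_excess_def)
  next
    case False
    have "t \<le> x" if "x \<in> set xs \<union> set ys" for x using R(1)[OF that] R(3) False by linarith
    then have "?w t = ?z - t" by (rule rect_young_diagram_left[OF len])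
    then show ?thesis using R False by (simp add: diagram_excess_def)
  qed
qed

lemma Omega_curve_sin:
  assumes "\<theta> \<in> {- (pi / 2)..pi / 2}"
  shows "Omega_curve (2 * sin \<theta>) = 4 / pi * (\<theta> * sin \<theta> + cos \<theta>)"
proof -
  have "4 - (2 * sin \<theta>)\<^sup>2 = (2 * cos \<theta>)\<^sup>2"
    by (simp add: power_mult_distrib sin_squared_eq algebra_simps)
  moreover have "cos \<theta> \<ge> 0" using assms by (intro cos_ge_zero) auto
  ultimately have "sqrt (4 - (2 * sin \<theta>)\<^sup>2) = 2 * cos \<theta>" by (simp add: real_sqrt_unique)
  moreover have "arcsin (2 * sin \<theta> / 2) = \<theta>" using assms by (simp add: arcsin_sin)
  moreover have "\<bar>2 * sin \<theta>\<bar> \<le> 2" by (simp add: abs_mult)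
  ultimately show ?thesis by (simp add: Omega_curve_def algebra_simps)
qed

lemma sin_parametrization:
  assumes "\<bar>t\<bar> \<le> (2 :: real)"
  shows "arcsin (t / 2) \<in> {- (pi / 2)..pi / 2}" "2 * sin (arcsin (t / 2)) = t"
  using assms arcsin_bounded[of "t / 2"] by auto

lemma Omega_curve_outside: "2 \<le> \<bar>x\<bar> \<Longrightarrow> Omega_curve x = \<bar>x\<bar>"
proof (cases "\<bar>x\<bar> = 2")
  case True
  then consider "x = 2" | "x = -2" by linarith
  then show ?thesis
    using Omega_curve_sin[of "pi / 2"] Omega_curve_sin[of "- (pi / 2)"] by cases auto
qed (auto simp: Omega_curve_def)

lemma Omega_curve_lipschitz_inside:
  assumes "- 2 \<le> s" "s \<le> t" "t \<le> 2"
  shows "\<bar>Omega_curve t - Omega_curve s\<bar> \<le> t - s"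
proof -
  have st: "\<bar>s\<bar> \<le> 2" "\<bar>t\<bar> \<le> 2" using assms by auto
  \<comment> \<open>For \<open>c = 1\<close> and \<open>c = -1\<close> this is \<open>t + c * Omega_curve t\<close> in the parameter \<open>t = 2 * sin \<theta>\<close>.\<close>
  define f where "f = (\<lambda>c \<theta>. 2 * sin \<theta> + c * (4 / pi * (\<theta> * sin \<theta> + cos \<theta>)))"
  have f': "(f c has_real_derivative 2 * cos \<theta> * (1 + c * (2 / pi * \<theta>))) (at \<theta>)" for c \<theta>
    unfolding f_def by (rule derivative_eq_intros refl | simp)+ (simp add: algebra_simps)
  have "f c (arcsin (s / 2)) \<le> f c (arcsin (t / 2))" if "\<bar>c\<bar> = 1" for c
  proof (rule DERIV_nonneg_imp_nondecreasing[where f = "f c"])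
    show "arcsin (s / 2) \<le> arcsin (t / 2)" using assms by (intro arcsin_le_arcsin) auto
    fix \<theta> assume "arcsin (s / 2) \<le> \<theta>" "\<theta> \<le> arcsin (t / 2)"
    then have \<theta>: "- (pi / 2) \<le> \<theta>" "\<theta> \<le> pi / 2"
      using sin_parametrization(1)[of s] sin_parametrization(1)[of t] st by auto
    then have "\<bar>\<theta>\<bar> \<le> pi / 2" by linarith
    then have "\<bar>c * (2 / pi * \<theta>)\<bar> \<le> 1" using that by (simp add: abs_mult field_simps)
    then have "0 \<le> 1 + c * (2 / pi * \<theta>)" by linarith
    then have "0 \<le> 2 * cos \<theta> * (1 + c * (2 / pi * \<theta>))" using \<theta> by (intro mult_nonneg_nonneg cos_ge_zero) auto
    then show "\<exists>y. (f c has_real_derivative y) (at \<theta>) \<and> 0 \<le> y" using f' by blast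
  qed
  moreover have "f c (arcsin (u / 2)) = u + c * Omega_curve u" if "\<bar>u\<bar> \<le> 2" for c u
    using Omega_curve_sin[of "arcsin (u / 2)"] sin_parametrization[OF that] by (simp add: f_def)
  ultimately have "s + c * Omega_curve s \<le> t + c * Omega_curve t" if "\<bar>c\<bar> = 1" for c
    using that st by simp
  from this[of 1] this[of "-1"] show ?thesis by (simp add: abs_le_iff)
qed

lemma Omega_curve_lipschitz: "\<bar>Omega_curve t - Omega_curve s\<bar> \<le> \<bar>t - s\<bar>"
proof -
  have *: "\<bar>Omega_curve t - Omega_curve s\<bar> \<le> t - s" if "s \<le> t" for s t
  proof (cases "t \<le> -2 \<or> s \<ge> 2")
    case True
    then have "2 \<le> \<bar>s\<bar>" "2 \<le> \<bar>t\<bar>" using that by auto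
    then show ?thesis using True that by (auto simp: Omega_curve_outside)
  next
    case False
    \<comment> \<open>Between \<open>s\<close> and \<open>t\<close> insert the part of the interval that lies in the region of the arc.\<close>
    define a b where "a = max s (-2)" and "b = min t 2"
    have ab: "s \<le> a" "a \<le> b" "b \<le> t" "-2 \<le> a" "b \<le> 2" using False that by (auto simp: a_def b_def)
    have "\<bar>Omega_curve b - Omega_curve a\<bar> \<le> b - a" using ab by (intro Omega_curve_lipschitz_inside) auto
    moreover have "\<bar>Omega_curve a - Omega_curve s\<bar> \<le> a - s"
      by (cases "s \<ge> -2") (auto simp: a_def Omega_curve_outside)
    moreover have "\<bar>Omega_curve t - Omega_curve b\<bar> \<le> t - b"
      by (cases "t \<le> 2") (auto simp: b_def Omega_curve_outside)
    ultimately show ?thesis by linarith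
  qed
  show ?thesis using *[of s t] *[of t s] by (cases "s \<le> t") auto
qed

definition Omega_excess :: "real \<Rightarrow> real" where
  "Omega_excess t = (Omega_curve t - \<bar>t\<bar>) / 2"

lemma Omega_excess_shape:
  "0 \<le> Omega_excess t" "\<bar>Omega_excess t - Omega_excess s\<bar> \<le> \<bar>t - s\<bar>" "2 < \<bar>t\<bar> \<Longrightarrow> Omega_excess t = 0"
proof -
  have "Omega_curve 2 = 2" "Omega_curve (-2) = 2" by (simp_all add: Omega_curve_outside)
  then have "\<bar>t\<bar> \<le> Omega_curve t" if "\<bar>t\<bar> \<le> 2"
    using Omega_curve_lipschitz[of 2 t] Omega_curve_lipschitz[of "-2" t] that by linarith
  then show "0 \<le> Omega_excess t"
    using Omega_curve_outside[of t] by (cases "\<bar>t\<bar> \<le> 2") (auto simp: Omega_excess_def)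
  have "\<bar>(Omega_curve t - Omega_curve s) - (\<bar>t\<bar> - \<bar>s\<bar>)\<bar> \<le> \<bar>Omega_curve t - Omega_curve s\<bar> + \<bar>\<bar>t\<bar> - \<bar>s\<bar>\<bar>"
    by (rule abs_triangle_ineq4)
  also have "\<dots> \<le> \<bar>t - s\<bar> + \<bar>t - s\<bar>" by (intro add_mono Omega_curve_lipschitz) linarith
  finally show "\<bar>Omega_excess t - Omega_excess s\<bar> \<le> \<bar>t - s\<bar>"
    by (simp add: Omega_excess_def field_simps)
  show "2 < \<bar>t\<bar> \<Longrightarrow> Omega_excess t = 0" by (simp add: Omega_excess_def Omega_curve_outside)
qed

lemma sin_power_integrable: "(\<lambda>\<theta>. (2 * sin \<theta>) ^ k) integrable_on {- (pi / 2)..pi / 2}"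
  by (intro integrable_continuous_real continuous_intros)

text \<open>Integrate the derivative of \<open>2 * cos \<theta> * (2 * sin \<theta>) ^ (k + 1)\<close>, which vanishes at both ends.\<close>
lemma wallis:
  "real (k + 2) * integral {- (pi / 2)..pi / 2} (\<lambda>\<theta>. (2 * sin \<theta>) ^ (k + 2))
    = 4 * real (k + 1) * integral {- (pi / 2)..pi / 2} (\<lambda>\<theta>. (2 * sin \<theta>) ^ k)"
proof -
  let ?J = "{- (pi / 2)..pi / 2}"
  define F where "F = (\<lambda>\<theta>::real. 2 * cos \<theta> * (2 * sin \<theta>) ^ (k + 1))"
  have F': "(F has_vector_derivative 4 * real (k + 1) * (2 * sin \<theta>) ^ k - real (k + 2) * (2 * sin \<theta>) ^ (k + 2)) (at \<theta> within T)" for \<theta> T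
  proof -
    have "(F has_real_derivative 2 * cos \<theta> * (real (k + 1) * (2 * sin \<theta>) ^ k * (2 * cos \<theta>)) + (- 2 * sin \<theta>) * (2 * sin \<theta>) ^ (k + 1)) (at \<theta> within T)"
      unfolding F_def by (rule derivative_eq_intros refl | simp)+
    also have "2 * cos \<theta> * (real (k + 1) * (2 * sin \<theta>) ^ k * (2 * cos \<theta>)) + (- 2 * sin \<theta>) * (2 * sin \<theta>) ^ (k + 1)
        = 4 * real (k + 1) * (2 * sin \<theta>) ^ k * (cos \<theta>)\<^sup>2 - 4 * (sin \<theta>)\<^sup>2 * (2 * sin \<theta>) ^ k"
      by (simp add: power2_eq_square algebra_simps)
    also have "\<dots> = 4 * real (k + 1) * (2 * sin \<theta>) ^ k - real (k + 2) * (4 * (sin \<theta>)\<^sup>2 * (2 * sin \<theta>) ^ k)"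
      unfolding cos_squared_eq by (simp add: algebra_simps)
    also have "4 * (sin \<theta>)\<^sup>2 * (2 * sin \<theta>) ^ k = (2 * sin \<theta>) ^ (k + 2)"
      by (simp add: power_add power_mult_distrib power2_eq_square)
    finally show ?thesis by (simp add: has_real_derivative_iff_has_vector_derivative)
  qed
  have "((\<lambda>\<theta>. 4 * real (k + 1) * (2 * sin \<theta>) ^ k - real (k + 2) * (2 * sin \<theta>) ^ (k + 2)) has_integral (F (pi / 2) - F (- (pi / 2)))) ?J"
    by (intro fundamental_theorem_of_calculus F') auto
  then have "integral ?J (\<lambda>\<theta>. 4 * real (k + 1) * (2 * sin \<theta>) ^ k - real (k + 2) * (2 * sin \<theta>) ^ (k + 2)) = 0"
    by (simp add: F_def integral_unique)
  moreover have "integral ?J (\<lambda>\<theta>. 4 * real (k + 1) * (2 * sin \<theta>) ^ k - real (k + 2) * (2 * sin \<theta>) ^ (k + 2))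
      = integral ?J (\<lambda>\<theta>. 4 * real (k + 1) * (2 * sin \<theta>) ^ k) - integral ?J (\<lambda>\<theta>. real (k + 2) * (2 * sin \<theta>) ^ (k + 2))"
    by (rule integral_diff) (intro integrable_continuous_real continuous_intros)+
  ultimately show ?thesis by (simp del: of_nat_add of_nat_Suc)
qed

lemma integral_sin_power: "integral {- (pi / 2)..pi / 2} (\<lambda>\<theta>. (2 * sin \<theta>) ^ k) = pi * arcsine_moment k"
proof (induction k rule: less_induct)
  case (less k)
  consider "k = 0" | "k = 1" | j where "k = j + 2"
    by (metis add_2_eq_Suc' not0_implies_Suc One_nat_def)
  then show ?case
  proof cases
    case 1
    then show ?thesis by simp
  next
    case 2
    have "((\<lambda>\<theta>. 2 * sin \<theta>) has_integral (- 2 * cos (pi / 2) - (- 2 * cos (- (pi / 2))))) {- (pi / 2)..pi / 2}"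
      by (rule fundamental_theorem_of_calculus)
         (auto simp flip: has_real_derivative_iff_has_vector_derivative intro!: derivative_eq_intros)
    then show ?thesis using 2 by (simp add: integral_unique)
  next
    case 3
    have "real (j + 2) * integral {- (pi / 2)..pi / 2} (\<lambda>\<theta>. (2 * sin \<theta>) ^ (j + 2)) = pi * (4 * real (Suc j) * arcsine_moment j)"
      using wallis[of j] less[of j] 3 by simp
    also have "\<dots> = real (j + 2) * (pi * arcsine_moment (j + 2))"
      using arcsine_moment_recurrence[of j] by (simp del: arcsine_moment.simps)
    finally show ?thesis unfolding 3 by (subst (asm) mult_left_cancel) auto
  qed
qed

text \<open>Substitute \<open>t = 2 * sin \<theta>\<close>, so that the curve becomes \<open>h \<theta>\<close>, and integrate by parts twice: the
  function \<open>F\<close> collects the boundary terms, and \<open>(2 * sin \<theta>) ^ (k + 2)\<close> remains under the integral.\<close>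
lemma Omega_curve_moment:
  "integral {-2..2} (\<lambda>t. t ^ k * Omega_curve t)
    = (2 ^ (k + 2) + (- 2) ^ (k + 2)) / real (k + 2) + 2 * arcsine_moment (k + 2) / real ((k + 1) * (k + 2))"
proof -
  let ?J = "{- (pi / 2)..pi / 2}"
  define h where "h = (\<lambda>\<theta>. 4 / pi * (\<theta> * sin \<theta> + cos \<theta>))"
  have cont: "continuous_on {-2..2} (\<lambda>t. t ^ k * Omega_curve t)"
    using lipschitz_imp_continuous[of Omega_curve 1] Omega_curve_lipschitz by (intro continuous_intros) auto
  have "((\<lambda>\<theta>. (2 * cos \<theta>) *\<^sub>R ((2 * sin \<theta>) ^ k * Omega_curve (2 * sin \<theta>))) has_integral
      integral {2 * sin (- (pi / 2))..2 * sin (pi / 2)} (\<lambda>t. t ^ k * Omega_curve t)) ?J"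
    by (rule has_integral_substitution[of _ _ "\<lambda>\<theta>. 2 * sin \<theta>" "-2" 2]) (auto intro!: cont derivative_eq_intros)
  then have sub: "((\<lambda>\<theta>. 2 * cos \<theta> * ((2 * sin \<theta>) ^ k * Omega_curve (2 * sin \<theta>))) has_integral
      integral {-2..2} (\<lambda>t. t ^ k * Omega_curve t)) ?J"
    by simp
  define F where "F = (\<lambda>\<theta>. (2 * sin \<theta>) ^ (k + 1) / real (k + 1) * h \<theta>
      - 2 / (pi * real (k + 1) * real (k + 2)) * ((2 * sin \<theta>) ^ (k + 2) * \<theta>))"
  have F': "(F has_real_derivative 2 * cos \<theta> * ((2 * sin \<theta>) ^ k * h \<theta>)
      - 2 / (pi * real (k + 1) * real (k + 2)) * (2 * sin \<theta>) ^ (k + 2)) (at \<theta> within T)" for \<theta> T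
  proof -
    have h': "(h has_real_derivative 4 / pi * (\<theta> * cos \<theta>)) (at \<theta> within T)"
      unfolding h_def by (rule derivative_eq_intros refl | simp)+
    have p': "((\<lambda>\<theta>. (2 * sin \<theta>) ^ Suc n / real (Suc n)) has_real_derivative (2 * sin \<theta>) ^ n * (2 * cos \<theta>)) (at \<theta> within T)" for n
      by (rule derivative_eq_intros refl | simp del: of_nat_Suc)+
    have "(F has_real_derivative ((2 * sin \<theta>) ^ k * (2 * cos \<theta>) * h \<theta> + (4 / pi * (\<theta> * cos \<theta>)) * ((2 * sin \<theta>) ^ Suc k / real (Suc k)))
      - 2 / (pi * real (Suc k)) * (((2 * sin \<theta>) ^ Suc k * (2 * cos \<theta>)) * \<theta> + 1 * ((2 * sin \<theta>) ^ Suc (Suc k) / real (Suc (Suc k))))) (at \<theta> within T)"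
    proof -
      have "F = (\<lambda>\<theta>. (2 * sin \<theta>) ^ Suc k / real (Suc k) * h \<theta>
        - 2 / (pi * real (Suc k)) * ((2 * sin \<theta>) ^ Suc (Suc k) / real (Suc (Suc k)) * \<theta>))"
        by (simp add: F_def fun_eq_iff del: of_nat_Suc power_Suc)
      then show ?thesis
        by (simp only:) (intro DERIV_diff DERIV_mult DERIV_cmult p' h' DERIV_ident)
    qed
    then show ?thesis
      by (rule DERIV_cong) (simp add: divide_simps del: of_nat_Suc, simp add: algebra_simps del: of_nat_Suc)
  qed
  have "((\<lambda>\<theta>. 2 * cos \<theta> * ((2 * sin \<theta>) ^ k * h \<theta>)
      - 2 / (pi * real (k + 1) * real (k + 2)) * (2 * sin \<theta>) ^ (k + 2)) has_integral (F (pi / 2) - F (- (pi / 2)))) ?J"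
    using F' by (intro fundamental_theorem_of_calculus) (auto simp: has_real_derivative_iff_has_vector_derivative)
  moreover have "((\<lambda>\<theta>. 2 / (pi * real (k + 1) * real (k + 2)) * (2 * sin \<theta>) ^ (k + 2)) has_integral
      2 / (pi * real (k + 1) * real (k + 2)) * (pi * arcsine_moment (k + 2))) ?J"
    unfolding integral_sin_power[symmetric]
    by (intro has_integral_mult_right integrable_integral sin_power_integrable)
  ultimately have "((\<lambda>\<theta>. (2 * cos \<theta> * ((2 * sin \<theta>) ^ k * h \<theta>)
      - 2 / (pi * real (k + 1) * real (k + 2)) * (2 * sin \<theta>) ^ (k + 2)) + 2 / (pi * real (k + 1) * real (k + 2)) * (2 * sin \<theta>) ^ (k + 2)) has_integral
      (F (pi / 2) - F (- (pi / 2))) + 2 / (pi * real (k + 1) * real (k + 2)) * (pi * arcsine_moment (k + 2))) ?J"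
    by (rule has_integral_add)
  then have "((\<lambda>\<theta>. 2 * cos \<theta> * ((2 * sin \<theta>) ^ k * h \<theta>)) has_integral
      (F (pi / 2) - F (- (pi / 2))) + 2 / (pi * real (k + 1) * real (k + 2)) * (pi * arcsine_moment (k + 2))) ?J"
    by simp
  then have "((\<lambda>\<theta>. 2 * cos \<theta> * ((2 * sin \<theta>) ^ k * Omega_curve (2 * sin \<theta>))) has_integral
      (F (pi / 2) - F (- (pi / 2))) + 2 / (pi * real (k + 1) * real (k + 2)) * (pi * arcsine_moment (k + 2))) ?J"
    by (rule has_integral_eq[rotated]) (simp add: h_def Omega_curve_sin)
  from has_integral_unique[OF sub this]
  have "integral {-2..2} (\<lambda>t. t ^ k * Omega_curve t) = (F (pi / 2) - F (- (pi / 2)))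
      + 2 * arcsine_moment (k + 2) / (real (k + 1) * real (k + 2))"
    by (simp del: arcsine_moment.simps)
  also have "F (pi / 2) - F (- (pi / 2)) = (2 ^ (k + 2) + (- 2) ^ (k + 2)) / (k + 2)"
  proof -
    have "y / u - 1 / (u * (u + 1)) * y = y / (u + 1)" if "u > 0" for u y :: real
      using that by (simp add: divide_simps) (simp add: algebra_simps)
    from this[of "real (k + 1)"]
    have *: "(a * x / real (k + 1) - 1 / (real (k + 1) * real (k + 2)) * (a * x)) = a * x / real (k + 2)" for a x :: real
      by (simp add: add.commute)
    have "F (pi / 2) = 2 ^ (k + 2) / real (k + 2)"
      using *[of 2 "2 ^ (k + 1)"] by (simp add: F_def h_def)
    moreover have "F (- (pi / 2)) = - ((- 2) ^ (k + 2) / real (k + 2))"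
    proof -
      define x where "x = (- 2 :: real) ^ (k + 1)"
      have pow: "(2 * sin (- (pi / 2))) ^ (k + 1) = x" "(2 * sin (- (pi / 2))) ^ (k + 2) = - 2 * x"
        by (simp_all add: x_def)
      have "F (- (pi / 2)) = 2 * x / real (k + 1) - 1 / (real (k + 1) * real (k + 2)) * (2 * x)"
        unfolding F_def pow by (simp add: h_def)
      then show ?thesis unfolding * by (simp add: x_def)
    qed
    ultimately show ?thesis by (simp add: add_divide_distrib)
  qed
  finally show ?thesis unfolding of_nat_mult .
qed

lemma Omega_excess_moment:
  "integral {-2..2} (\<lambda>t. t ^ k * Omega_excess t) = arcsine_moment (k + 2) / real ((k + 1) * (k + 2))"
proof -
  have "(\<lambda>t. t ^ k * Omega_curve t) integrable_on {-2..2}"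
    using lipschitz_imp_continuous[of Omega_curve 1] Omega_curve_lipschitz
    by (intro integrable_continuous_real continuous_intros) auto
  from integrable_integral[OF this]
  have "((\<lambda>t. t ^ k * Omega_curve t) has_integral
     ((2 ^ (k + 2) + (- 2) ^ (k + 2)) / (k + 2) + 2 * arcsine_moment (k + 2) / ((k + 1) * (k + 2)))) {-2..2}"
    unfolding Omega_curve_moment .
  moreover have "((\<lambda>t. t ^ k * \<bar>t\<bar>) has_integral (2 ^ (k + 2) + (- 2) ^ (k + 2)) / (k + 2)) {-2..2::real}"
    using has_integral_power_abs[of 0 2 k] by simp
  ultimately have "((\<lambda>t. (t ^ k * Omega_curve t - t ^ k * \<bar>t\<bar>) * (1 / 2)) has_integral
     ((2 ^ (k + 2) + (- 2) ^ (k + 2)) / (k + 2) + 2 * arcsine_moment (k + 2) / ((k + 1) * (k + 2))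
      - (2 ^ (k + 2) + (- 2) ^ (k + 2)) / (k + 2)) * (1 / 2)) {-2..2}"
    by (intro has_integral_mult_left has_integral_diff)
  moreover have "(\<lambda>t. (t ^ k * Omega_curve t - t ^ k * \<bar>t\<bar>) * (1 / 2)) = (\<lambda>t. t ^ k * Omega_excess t)"
    by (simp add: fun_eq_iff Omega_excess_def right_diff_distrib diff_divide_distrib)
  moreover have "(a + 2 * b / c - a) * (1 / 2) = b / c" for a b c :: real by simp
  ultimately have "((\<lambda>t. t ^ k * Omega_excess t) has_integral arcsine_moment (k + 2) / real ((k + 1) * (k + 2))) {-2..2}"
    by (simp only:)
  then show ?thesis by (rule integral_unique)
qed


section \<open>Convergence of the random diagrams\<close>

definition power_sum_diff :: "real list \<Rightarrow> real list \<Rightarrow> nat \<Rightarrow> real" where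
  "power_sum_diff xs ys k = (\<Sum>x\<leftarrow>xs. x ^ k) - (\<Sum>y\<leftarrow>ys. y ^ k)"

definition lipschitz_diagram :: "real list \<Rightarrow> real list \<Rightarrow> bool" where
  "lipschitz_diagram xs ys \<longleftrightarrow> length xs = Suc (length ys) \<and>
     (\<forall>t s. \<bar>rect_young_diagram xs ys t - rect_young_diagram xs ys s\<bar> \<le> \<bar>t - s\<bar>)"

text \<open>A bound for all entries and for the apex. The summand 4 makes it admissible in \<open>converging_moments\<close>.\<close>
definition support_radius :: "real list \<Rightarrow> real list \<Rightarrow> real" where
  "support_radius xs ys = 4 + (\<Sum>x\<leftarrow>xs @ ys. \<bar>x\<bar>) + \<bar>sum_list xs - sum_list ys\<bar>"

lemma support_radius:
  "x \<in> set xs \<union> set ys \<Longrightarrow> \<bar>x\<bar> \<le> support_radius xs ys"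
  "\<bar>sum_list xs - sum_list ys\<bar> \<le> support_radius xs ys"
  "4 \<le> support_radius xs ys"
proof -
  have nn: "0 \<le> (\<Sum>x\<leftarrow>xs @ ys. \<bar>x\<bar>)" by (rule sum_list_nonneg) auto
  show "\<bar>x\<bar> \<le> support_radius xs ys" if x: "x \<in> set xs \<union> set ys"
  proof -
    have "\<bar>x\<bar> \<le> (\<Sum>x\<leftarrow>xs @ ys. \<bar>x\<bar>)"
      using x by (intro member_le_sum_list) auto
    then show ?thesis unfolding support_radius_def by linarith
  qed
  show "\<bar>sum_list xs - sum_list ys\<bar> \<le> support_radius xs ys" "4 \<le> support_radius xs ys"
    unfolding support_radius_def using nn by linarith+
qed

lemma rect_young_diagram_excess:
  "rect_young_diagram xs ys t = 2 * diagram_excess xs ys t + \<bar>t - power_sum_diff xs ys 1\<bar>"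
  by (simp add: diagram_excess_def power_sum_diff_def field_simps)

text \<open>The moments of the excess functions are combinations of the power sums \<open>k + 2\<close> and 1, hence
  converge to the moments of \<open>Omega_excess\<close>. The apex of the rectangle is the first power sum, which
  tends to 0.\<close>
lemma diagrams_converge_of_power_sums:
  assumes good: "\<And>n. lipschitz_diagram (xs n) (ys n)"
    and lim: "\<And>k. (\<lambda>n. power_sum_diff (xs n) (ys n) k) \<longlonglongrightarrow> arcsine_moment k"
    and \<epsilon>: "\<epsilon> > 0"
  shows "\<forall>\<^sub>F n in sequentially. \<forall>t. \<bar>rect_young_diagram (xs n) (ys n) t - Omega_curve t\<bar> \<le> \<epsilon>"
proof -
  have len: "length (xs n) = Suc (length (ys n))"
    and lip: "\<bar>rect_young_diagram (xs n) (ys n) t - rect_young_diagram (xs n) (ys n) s\<bar> \<le> \<bar>t - s\<bar>" for n t s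
    using good[of n] by (auto simp: lipschitz_diagram_def)
  note shape = rect_young_diagram_shape[OF len lip]
  interpret converging_moments "\<lambda>n. diagram_excess (xs n) (ys n)" "\<lambda>n. support_radius (xs n) (ys n)" Omega_excess
  proof
    fix k
    have "integral {- support_radius (xs n) (ys n)..support_radius (xs n) (ys n)} (\<lambda>t. t ^ k * diagram_excess (xs n) (ys n) t)
        = (power_sum_diff (xs n) (ys n) (k + 2) - power_sum_diff (xs n) (ys n) 1 ^ (k + 2)) / real ((k + 1) * (k + 2))" for n
      using diagram_excess_moment[OF len support_radius(1,2), of n k]
      by (simp add: integral_unique power_sum_diff_def)
    moreover have "(\<lambda>n. (power_sum_diff (xs n) (ys n) (k + 2) - power_sum_diff (xs n) (ys n) 1 ^ (k + 2)) / real ((k + 1) * (k + 2)))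
        \<longlonglongrightarrow> (arcsine_moment (k + 2) - arcsine_moment 1 ^ (k + 2)) / real ((k + 1) * (k + 2))"
      by (intro tendsto_intros lim) (simp only: of_nat_eq_0_iff, simp)
    ultimately show "(\<lambda>n. integral {- support_radius (xs n) (ys n)..support_radius (xs n) (ys n)}
          (\<lambda>t. t ^ k * diagram_excess (xs n) (ys n) t)) \<longlonglongrightarrow> integral {-2..2} (\<lambda>t. t ^ k * Omega_excess t)"
      unfolding Omega_excess_moment using arcsine_moment_1 by (simp del: arcsine_moment.simps)
  qed (use shape(1,2) shape(3)[OF support_radius(1,2)] support_radius(3) Omega_excess_shape in auto)
  have "(\<lambda>n. power_sum_diff (xs n) (ys n) 1) \<longlonglongrightarrow> 0"
    using lim[of 1] arcsine_moment_1 by (simp del: arcsine_moment.simps)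
  then have "\<forall>\<^sub>F n in sequentially. dist (power_sum_diff (xs n) (ys n) 1) 0 < \<epsilon> / 2"
    by (rule tendstoD) (use \<epsilon> in simp)
  moreover have "\<forall>\<^sub>F n in sequentially. \<forall>t. \<bar>diagram_excess (xs n) (ys n) t - Omega_excess t\<bar> \<le> \<epsilon> / 4"
    by (rule uniformly_close) (use \<epsilon> in simp)
  ultimately show ?thesis
  proof eventually_elim
    case (elim n)
    show ?case
    proof
      fix t
      let ?z = "power_sum_diff (xs n) (ys n) 1"
      have "rect_young_diagram (xs n) (ys n) t - Omega_curve t
          = 2 * (diagram_excess (xs n) (ys n) t - Omega_excess t) + (\<bar>t - ?z\<bar> - \<bar>t\<bar>)"
        by (simp add: rect_young_diagram_excess Omega_excess_def field_simps)
      also have "\<bar>\<dots>\<bar> \<le> 2 * \<bar>diagram_excess (xs n) (ys n) t - Omega_excess t\<bar> + \<bar>\<bar>t - ?z\<bar> - \<bar>t\<bar>\<bar>"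
        by (rule order_trans[OF abs_triangle_ineq]) (simp only: abs_mult abs_numeral order_refl)
      also have "\<dots> \<le> 2 * (\<epsilon> / 4) + \<epsilon> / 2"
      proof (intro add_mono mult_left_mono)
        show "\<bar>diagram_excess (xs n) (ys n) t - Omega_excess t\<bar> \<le> \<epsilon> / 4" using elim by blast
        have "\<bar>\<bar>t - ?z\<bar> - \<bar>t\<bar>\<bar> \<le> \<bar>?z\<bar>" by linarith
        then show "\<bar>\<bar>t - ?z\<bar> - \<bar>t\<bar>\<bar> \<le> \<epsilon> / 2" using elim(1) by (simp add: dist_real_def)
      qed simp
      finally show "\<bar>rect_young_diagram (xs n) (ys n) t - Omega_curve t\<bar> \<le> \<epsilon>" by simp
    qed
  qed
qed

text \<open>A quantitative form of the preceding lemma that involves finitely many power sums only. This is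
  what carries over to convergence in probability. A sequence of counterexamples with \<open>K = n\<close> and
  \<open>\<delta> = 1 / (n + 1)\<close> would contradict the preceding lemma.\<close>
lemma diagram_close_of_power_sums:
  assumes \<epsilon>: "\<epsilon> > 0"
  shows "\<exists>K. \<exists>\<delta>>0. \<forall>xs ys. lipschitz_diagram xs ys \<longrightarrow> (\<forall>k\<le>K. \<bar>power_sum_diff xs ys k - arcsine_moment k\<bar> \<le> \<delta>) \<longrightarrow>
    (\<forall>t. \<bar>rect_young_diagram xs ys t - Omega_curve t\<bar> \<le> \<epsilon>)"
proof (rule ccontr)
  assume not: "\<not> ?thesis"
  have "\<exists>xs ys. lipschitz_diagram xs ys \<and> (\<forall>k\<le>n. \<bar>power_sum_diff xs ys k - arcsine_moment k\<bar> \<le> 1 / real (Suc n)) \<and>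
      \<not> (\<forall>t. \<bar>rect_young_diagram xs ys t - Omega_curve t\<bar> \<le> \<epsilon>)" for n
  proof (rule ccontr)
    assume "\<not> ?thesis"
    then have "\<exists>\<delta>>0. \<forall>xs ys. lipschitz_diagram xs ys \<longrightarrow> (\<forall>k\<le>n. \<bar>power_sum_diff xs ys k - arcsine_moment k\<bar> \<le> \<delta>) \<longrightarrow>
        (\<forall>t. \<bar>rect_young_diagram xs ys t - Omega_curve t\<bar> \<le> \<epsilon>)"
      by (intro exI[of _ "1 / real (Suc n)"] conjI) (simp, blast)
    with not show False by blast
  qed
  then obtain xs ys where xy: "\<And>n. lipschitz_diagram (xs n) (ys n)"
    "\<And>n k. k \<le> n \<Longrightarrow> \<bar>power_sum_diff (xs n) (ys n) k - arcsine_moment k\<bar> \<le> 1 / real (Suc n)"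
    "\<And>n. \<not> (\<forall>t. \<bar>rect_young_diagram (xs n) (ys n) t - Omega_curve t\<bar> \<le> \<epsilon>)"
    by metis
  have "(\<lambda>n. power_sum_diff (xs n) (ys n) k) \<longlonglongrightarrow> arcsine_moment k" for k
  proof (rule Lim_null[THEN iffD2], rule Lim_null_comparison)
    show "\<forall>\<^sub>F n in sequentially. norm (power_sum_diff (xs n) (ys n) k - arcsine_moment k) \<le> 1 / real (Suc n)"
      using eventually_ge_at_top[of k] by eventually_elim (use xy(2) in simp)
    show "(\<lambda>n. 1 / real (Suc n)) \<longlonglongrightarrow> 0" by (rule LIMSEQ_Suc[OF lim_1_over_n])
  qed
  from diagrams_converge_of_power_sums[OF xy(1) this \<epsilon>] xy(3) show False
    by (auto simp: eventually_sequentially)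
qed

lemma diagram_minus_Omega_lipschitz:
  assumes "lipschitz_diagram xs ys"
  shows "\<bar>\<bar>rect_young_diagram xs ys t - Omega_curve t\<bar> - \<bar>rect_young_diagram xs ys s - Omega_curve s\<bar>\<bar> \<le> 2 * \<bar>t - s\<bar>"
proof -
  let ?w = "rect_young_diagram xs ys"
  have "\<bar>\<bar>?w t - Omega_curve t\<bar> - \<bar>?w s - Omega_curve s\<bar>\<bar> \<le> \<bar>(?w t - Omega_curve t) - (?w s - Omega_curve s)\<bar>"
    by (rule abs_triangle_ineq3)
  also have "(?w t - Omega_curve t) - (?w s - Omega_curve s) = (?w t - ?w s) - (Omega_curve t - Omega_curve s)" by simp
  also have "\<bar>\<dots>\<bar> \<le> \<bar>?w t - ?w s\<bar> + \<bar>Omega_curve t - Omega_curve s\<bar>" by (rule abs_triangle_ineq4)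
  also have "\<dots> \<le> \<bar>t - s\<bar> + \<bar>t - s\<bar>"
    using assms by (intro add_mono Omega_curve_lipschitz) (auto simp: lipschitz_diagram_def)
  finally show ?thesis by simp
qed

lemma diagram_minus_Omega_bounded:
  assumes good: "lipschitz_diagram xs ys"
  shows "bdd_above (range (\<lambda>t. \<bar>rect_young_diagram xs ys t - Omega_curve t\<bar>))"
proof -
  have len: "length xs = Suc (length ys)"
    and lip: "\<bar>rect_young_diagram xs ys t - rect_young_diagram xs ys s\<bar> \<le> \<bar>t - s\<bar>" for t s
    using good by (auto simp: lipschitz_diagram_def)
  define r z where "r = support_radius xs ys" and "z = power_sum_diff xs ys 1"
  have r: "4 \<le> r" by (simp add: r_def support_radius)
  show ?thesis
  proof (rule bdd_aboveI2)
    fix t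
    show "\<bar>rect_young_diagram xs ys t - Omega_curve t\<bar>
        \<le> \<bar>rect_young_diagram xs ys 0 - Omega_curve 0\<bar> + 2 * r + \<bar>z\<bar>"
    proof (cases "\<bar>t\<bar> \<le> r")
      case True
      then show ?thesis using diagram_minus_Omega_lipschitz[OF good, of t 0] by simp
    next
      case False
      have "diagram_excess xs ys t = 0"
        using rect_young_diagram_shape(3)[OF len lip support_radius(1,2), of t] False by (simp add: r_def)
      then have "\<bar>rect_young_diagram xs ys t - Omega_curve t\<bar> = \<bar>\<bar>t - z\<bar> - \<bar>t\<bar>\<bar>"
        using False r by (simp add: rect_young_diagram_excess Omega_curve_outside z_def)
      also have "\<dots> \<le> \<bar>z\<bar>" by linarith
      finally show ?thesis using r by simp
    qed
  qed
qed

lemma SUP_real_eq_SUP_rat: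
  fixes g :: "real \<Rightarrow> real"
  assumes lip: "\<And>t s. \<bar>g t - g s\<bar> \<le> 2 * \<bar>t - s\<bar>" and bdd: "bdd_above (range g)"
  shows "(SUP t. g t) = (SUP t\<in>\<rat>. g t)"
proof (rule antisym)
  have bdd': "bdd_above (g ` \<rat>)" by (rule bdd_above_mono[OF bdd]) auto
  show "(SUP t. g t) \<le> (SUP t\<in>\<rat>. g t)"
  proof (rule cSUP_least)
    fix t
    show "g t \<le> (SUP t\<in>\<rat>. g t)"
    proof (rule field_le_epsilon)
      fix e :: real assume "e > 0"
      then obtain q where q: "q \<in> \<rat>" "t < q" "q < t + e / 2"
        using Rats_dense_in_real[of t "t + e / 2"] by auto
      have "g t \<le> g q + 2 * \<bar>t - q\<bar>" using lip[of t q] by linarith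
      also have "\<dots> \<le> (SUP t\<in>\<rat>. g t) + e"
        using q by (intro add_mono cSUP_upper bdd') auto
      finally show "g t \<le> (SUP t\<in>\<rat>. g t) + e" .
    qed
  qed simp
  show "(SUP t\<in>\<rat>. g t) \<le> (SUP t. g t)"
    by (rule cSUP_subset_mono[OF _ bdd]) (auto intro: Rats_0)
qed

lemma rect_young_diagram_scale:
  assumes "c > 0"
  shows "rect_young_diagram (map (\<lambda>x. x / c) xs) (map (\<lambda>x. x / c) ys) t = 1 / c * rect_young_diagram xs ys (t * c)"
proof -
  have "\<bar>t - x / c\<bar> = 1 / c * \<bar>t * c - x\<bar>" for x
    using assms by (simp add: abs_if field_simps)
  then show ?thesis
    by (simp only: rect_young_diagram_def map_map o_def sum_list_const_mult right_diff_distrib)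
qed

context wigner_family
begin

definition spectrum :: "nat \<Rightarrow> 'a \<Rightarrow> real list" where
  "spectrum n \<omega> = eigenvalue_list (kernel_mat (entry Z \<omega>) n)"

definition scaled_spectrum :: "nat \<Rightarrow> nat \<Rightarrow> 'a \<Rightarrow> real list" where
  "scaled_spectrum N n \<omega> = map (\<lambda>x. x / sqrt (real N)) (spectrum n \<omega>)"

lemma sum_spectrum_powers: "(\<Sum>x\<leftarrow>spectrum n \<omega>. x ^ k) = closed_walk_sum (entry Z \<omega>) {..<n} k"
  unfolding spectrum_def by (rule sum_eigenvalue_list_powers) (rule entry_sym)

lemma wigner_diagram_spectrum:
  "wigner_diagram Z (Suc n) \<omega> = rect_young_diagram (spectrum (Suc n) \<omega>) (spectrum n \<omega>)"
  by (simp add: wigner_diagram_def wigner_matrix_eq_kernel_mat mat_delete_kernel_mat spectrum_def)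

lemma spectrum_lipschitz_diagram: "lipschitz_diagram (spectrum (Suc n) \<omega>) (spectrum n \<omega>)"
proof -
  have sym: "entry Z \<omega> i j = entry Z \<omega> j i" for i j by (rule entry_sym)
  have len: "length (spectrum n \<omega>) = n" for n
    unfolding spectrum_def by (rule eigenvalue_list_kernel_mat(1)) (rule sym)
  have det: "Determinant.det (pencil (entry Z \<omega>) n z) = (\<Prod>x\<leftarrow>spectrum n \<omega>. z - complex_of_real x)" for n z
    unfolding spectrum_def by (rule eigenvalue_list_kernel_mat(2)) (rule sym)
  have "\<bar>rect_young_diagram (spectrum (Suc n) \<omega>) (spectrum n \<omega>) t
      - rect_young_diagram (spectrum (Suc n) \<omega>) (spectrum n \<omega>) s\<bar> \<le> \<bar>t - s\<bar>" for t s
  proof (rule rect_young_diagram_lipschitz)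
    fix z :: complex assume "Im z > 0"
    then show "0 < Im (cnj (\<Prod>y\<leftarrow>spectrum n \<omega>. z - complex_of_real y) * (\<Prod>x\<leftarrow>spectrum (Suc n) \<omega>. z - complex_of_real x))"
      unfolding det[symmetric] by (intro Im_det_pencil_pos sym)
  qed (simp add: len)
  then show ?thesis by (simp add: lipschitz_diagram_def len)
qed

lemma scaled_lipschitz_diagram:
  "lipschitz_diagram (scaled_spectrum (Suc n) (Suc n) \<omega>) (scaled_spectrum (Suc n) n \<omega>)"
proof -
  define c where "c = sqrt (real (Suc n))"
  have c: "c > 0" by (simp add: c_def)
  let ?w = "rect_young_diagram (spectrum (Suc n) \<omega>) (spectrum n \<omega>)"
  have "\<bar>1 / c * ?w (t * c) - 1 / c * ?w (s * c)\<bar> \<le> \<bar>t - s\<bar>" for t s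
  proof -
    have "\<bar>1 / c * ?w (t * c) - 1 / c * ?w (s * c)\<bar> = 1 / c * \<bar>?w (t * c) - ?w (s * c)\<bar>"
      unfolding right_diff_distrib[symmetric] abs_mult using c by simp
    also have "\<dots> \<le> 1 / c * \<bar>t * c - s * c\<bar>"
      using spectrum_lipschitz_diagram[of n \<omega>] c by (intro mult_left_mono) (auto simp: lipschitz_diagram_def)
    also have "\<dots> = \<bar>t - s\<bar>"
      using c by (simp add: left_diff_distrib[symmetric] abs_mult)
    finally show ?thesis .
  qed
  then show ?thesis
    using spectrum_lipschitz_diagram[of n \<omega>]
    unfolding lipschitz_diagram_def scaled_spectrum_def c_def[symmetric] rect_young_diagram_scale[OF c] by simp
qed

lemma scaled_wigner_diagram:
  "1 / sqrt (real (Suc n)) * wigner_diagram Z (Suc n) \<omega> (t * sqrt (real (Suc n)))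
    = rect_young_diagram (scaled_spectrum (Suc n) (Suc n) \<omega>) (scaled_spectrum (Suc n) n \<omega>) t"
  unfolding scaled_spectrum_def by (subst rect_young_diagram_scale) (simp_all add: wigner_diagram_spectrum)

text \<open>Power sums of eigenvalues are traces of powers, and these are sums over closed walks.\<close>
lemma power_sum_diff_scaled_spectrum:
  "power_sum_diff (scaled_spectrum (Suc n) (Suc n) \<omega>) (scaled_spectrum (Suc n) n \<omega>) k
    = scaled_trace_diff k ({..<Suc n}, n) \<omega>"
proof -
  have "(\<Sum>x\<leftarrow>scaled_spectrum (Suc n) l \<omega>. x ^ k) = closed_walk_sum (entry Z \<omega>) {..<l} k / sqrt (real (Suc n)) ^ k" for l
  proof -
    have "(x / sqrt (real (Suc n))) ^ k = x ^ k * inverse (sqrt (real (Suc n)) ^ k)" for x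
      by (simp only: divide_inverse power_mult_distrib power_inverse)
    then show ?thesis
      unfolding sum_spectrum_powers[symmetric] scaled_spectrum_def
      by (simp only: map_map o_def sum_list_mult_const divide_inverse)
  qed
  moreover have "{..<Suc n} - {n} = {..<n}" by auto
  ultimately show ?thesis
    by (simp add: power_sum_diff_def scaled_trace_diff_def diff_divide_distrib del: lessThan_Suc)
qed

text \<open>For a polynomial the statistic is a polynomial in the entries. On each outcome the spectrum is
  bounded, so polynomials that approximate \<open>\<phi>\<close> better and better on growing intervals give pointwise
  convergence.\<close>
lemma linear_statistic_measurable:
  assumes \<phi>: "continuous_on UNIV (\<phi> :: real \<Rightarrow> real)"
  shows "(\<lambda>\<omega>. \<Sum>x\<leftarrow>spectrum n \<omega>. \<phi> x) \<in> borel_measurable M"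
proof -
  have "\<exists>a d. \<forall>x\<in>{- real j..real j}. \<bar>\<phi> x - (\<Sum>i\<le>d. a i * x ^ i)\<bar> < 1 / real (Suc j)" for j :: nat
  proof -
    have "0 < 1 / real (Suc j)" by simp
    then obtain g where "real_polynomial_function g" and g: "\<And>x. x \<in> {- real j..real j} \<Longrightarrow> \<bar>\<phi> x - g x\<bar> < 1 / real (Suc j)"
      by (rule Stone_Weierstrass_real_polynomial_function[OF compact_Icc[of "- real j" "real j"]
            continuous_on_subset[OF \<phi> subset_UNIV]]) blast
    then obtain a d where "g = (\<lambda>x. \<Sum>i\<le>d. a i * x ^ i)" unfolding real_polynomial_function_iff_sum by blast
    then show ?thesis using g by blast
  qed
  then obtain a d where ad: "\<And>j x. x \<in> {- real j..real j} \<Longrightarrow> \<bar>\<phi> x - (\<Sum>i\<le>d j. a j i * x ^ i)\<bar> < 1 / real (Suc j)"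
    by metis
  define S where "S = (\<lambda>j \<omega>. \<Sum>x\<leftarrow>spectrum n \<omega>. \<Sum>i\<le>d j. a j i * x ^ i)"
  show ?thesis
  proof (rule borel_measurable_LIMSEQ_real)
    fix j
    have "(\<Sum>x\<leftarrow>xs. \<Sum>i\<le>d j. a j i * x ^ i) = (\<Sum>i\<le>d j. a j i * (\<Sum>x\<leftarrow>xs. x ^ i))" for xs
      by (induction xs) (simp_all add: sum.distrib distrib_left)
    then have "S j = (\<lambda>\<omega>. \<Sum>i\<le>d j. a j i * closed_walk_sum (entry Z \<omega>) {..<n} i)"
      by (simp add: S_def sum_spectrum_powers fun_eq_iff)
    also have "\<dots> \<in> borel_measurable M"
      by (intro borel_measurable_sum borel_measurable_times borel_measurable_const
          has_moments_measurable[OF has_moments_closed_walk_sum])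
    finally show "S j \<in> borel_measurable M" .
  next
    fix \<omega>
    have "(\<lambda>j. \<Sum>i\<le>d j. a j i * x ^ i) \<longlonglongrightarrow> \<phi> x" for x
    proof (rule Lim_null[THEN iffD2], rule Lim_null_comparison)
      show "\<forall>\<^sub>F j in sequentially. norm ((\<Sum>i\<le>d j. a j i * x ^ i) - \<phi> x) \<le> 1 / real (Suc j)"
        using eventually_ge_at_top[of "nat \<lceil>\<bar>x\<bar>\<rceil>"]
      proof eventually_elim
        case (elim j)
        then have "\<bar>x\<bar> \<le> real j" by linarith
        then have "x \<in> {- real j..real j}" by (auto simp: abs_le_iff)
        from ad[OF this] show ?case by (simp add: abs_minus_commute)
      qed
      show "(\<lambda>j. 1 / real (Suc j)) \<longlonglongrightarrow> 0" by (rule LIMSEQ_Suc[OF lim_1_over_n])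
    qed
    then show "(\<lambda>j. S j \<omega>) \<longlonglongrightarrow> (\<Sum>x\<leftarrow>spectrum n \<omega>. \<phi> x)"
      unfolding S_def by (intro tendsto_sum_list)
  qed
qed

lemma wigner_diagram_measurable: "(\<lambda>\<omega>. wigner_diagram Z (Suc n) \<omega> t) \<in> borel_measurable M"
  unfolding wigner_diagram_spectrum rect_young_diagram_def
  by (intro borel_measurable_diff linear_statistic_measurable continuous_intros)

definition sup_distance :: "nat \<Rightarrow> 'a \<Rightarrow> real" where
  "sup_distance N \<omega> = (SUP x. \<bar>1 / sqrt (real N) * wigner_diagram Z N \<omega> (x * sqrt (real N)) - Omega_curve x\<bar>)"

lemma sup_distance_Suc:
  fixes n \<omega>
  defines "g \<equiv> \<lambda>x. \<bar>1 / sqrt (real (Suc n)) * wigner_diagram Z (Suc n) \<omega> (x * sqrt (real (Suc n))) - Omega_curve x\<bar>"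
  shows "bdd_above (range g)" and "sup_distance (Suc n) \<omega> = (SUP x\<in>\<rat>. g x)"
proof -
  note good = scaled_lipschitz_diagram[of n \<omega>]
  show bdd: "bdd_above (range g)"
    unfolding g_def scaled_wigner_diagram by (rule diagram_minus_Omega_bounded[OF good])
  have "\<bar>g t - g s\<bar> \<le> 2 * \<bar>t - s\<bar>" for t s
    unfolding g_def scaled_wigner_diagram by (rule diagram_minus_Omega_lipschitz[OF good])
  from SUP_real_eq_SUP_rat[OF this bdd] show "sup_distance (Suc n) \<omega> = (SUP x\<in>\<rat>. g x)"
    by (simp add: sup_distance_def g_def)
qed

lemma sup_distance_measurable: "sup_distance N \<in> borel_measurable M"
proof (cases N)
  case 0
  then show ?thesis by (simp add: sup_distance_def[abs_def])
next
  case (Suc n)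
  have "(\<lambda>\<omega>. SUP x\<in>\<rat>. \<bar>1 / sqrt (real (Suc n)) * wigner_diagram Z (Suc n) \<omega> (x * sqrt (real (Suc n))) - Omega_curve x\<bar>)
      \<in> borel_measurable M"
  proof (rule borel_measurable_cSUP[OF countable_rat])
    fix \<omega>
    show "bdd_above ((\<lambda>x. \<bar>1 / sqrt (real (Suc n)) * wigner_diagram Z (Suc n) \<omega> (x * sqrt (real (Suc n))) - Omega_curve x\<bar>) ` \<rat>)"
      by (rule bdd_above_mono[OF sup_distance_Suc(1)[of n \<omega>]]) auto
  qed (intro borel_measurable_abs borel_measurable_diff borel_measurable_times borel_measurable_const wigner_diagram_measurable)
  then show ?thesis
    unfolding Suc sup_distance_Suc(2)[abs_def] .
qed

lemma sup_distance_tendsto_in_probability: "tendsto_in_probability M sup_distance 0"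
  unfolding tendsto_in_probability_def
proof (intro conjI allI impI sup_distance_measurable)
  fix \<epsilon> :: real assume \<epsilon>: "\<epsilon> > 0"
  obtain K \<delta> where \<delta>: "\<delta> > 0" and close:
    "\<And>xs ys. lipschitz_diagram xs ys \<Longrightarrow> (\<And>k. k \<le> K \<Longrightarrow> \<bar>power_sum_diff xs ys k - arcsine_moment k\<bar> \<le> \<delta>) \<Longrightarrow>
      (\<forall>t. \<bar>rect_young_diagram xs ys t - Omega_curve t\<bar> \<le> \<epsilon>)"
    using diagram_close_of_power_sums[OF \<epsilon>] by metis
  define X where "X = (\<lambda>k n. scaled_trace_diff k ({..<n}, n - 1))"
  have X: "converges_in_prob (X k) (arcsine_moment k) sequentially" for k
    unfolding X_def by (rule converges_in_prob_compose[OF scaled_trace_diff_converges filterlim_initial_segments])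
  have meas: "{\<omega> \<in> space M. \<delta> < \<bar>X k n \<omega> - arcsine_moment k\<bar>} \<in> events" for k n
    using converges_in_prob_measurable[OF X, of k n] by measurable
  \<comment> \<open>For \<open>N = 0\<close> the scaling factor is 0 by convention, and the supremum is taken over an unbounded set.\<close>
  have bound: "prob {\<omega> \<in> space M. \<epsilon> < \<bar>sup_distance N \<omega> - 0\<bar>}
      \<le> (\<Sum>k\<le>K. prob {\<omega> \<in> space M. \<delta> < \<bar>X k N \<omega> - arcsine_moment k\<bar>})" if "N \<ge> 1" for N
  proof -
    from \<open>N \<ge> 1\<close> obtain n where N: "N = Suc n" by (cases N) auto
    have "{\<omega> \<in> space M. \<epsilon> < \<bar>sup_distance N \<omega> - 0\<bar>}
        \<subseteq> (\<Union>k\<in>{..K}. {\<omega> \<in> space M. \<delta> < \<bar>X k N \<omega> - arcsine_moment k\<bar>})"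
    proof (rule subsetI, rule ccontr)
      fix \<omega>
      assume \<omega>: "\<omega> \<in> {\<omega> \<in> space M. \<epsilon> < \<bar>sup_distance N \<omega> - 0\<bar>}"
        "\<omega> \<notin> (\<Union>k\<in>{..K}. {\<omega> \<in> space M. \<delta> < \<bar>X k N \<omega> - arcsine_moment k\<bar>})"
      let ?d = "\<lambda>x. \<bar>1 / sqrt (real (Suc n)) * wigner_diagram Z (Suc n) \<omega> (x * sqrt (real (Suc n))) - Omega_curve x\<bar>"
      have "\<bar>power_sum_diff (scaled_spectrum (Suc n) (Suc n) \<omega>) (scaled_spectrum (Suc n) n \<omega>) k - arcsine_moment k\<bar> \<le> \<delta>"
        if "k \<le> K" for k
        using \<omega> that unfolding power_sum_diff_scaled_spectrum by (auto simp: X_def N not_less)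
      then have small: "?d x \<le> \<epsilon>" for x
        unfolding scaled_wigner_diagram using close[OF scaled_lipschitz_diagram] by blast
      have "sup_distance N \<omega> \<le> \<epsilon>"
        unfolding sup_distance_def N using small by (intro cSUP_least) auto
      moreover have "0 \<le> sup_distance N \<omega>"
        unfolding sup_distance_def N by (rule cSUP_upper2[OF sup_distance_Suc(1) UNIV_I]) simp
      ultimately show False using \<omega>(1) by simp
    qed
    then have "prob {\<omega> \<in> space M. \<epsilon> < \<bar>sup_distance N \<omega> - 0\<bar>}
        \<le> prob (\<Union>k\<in>{..K}. {\<omega> \<in> space M. \<delta> < \<bar>X k N \<omega> - arcsine_moment k\<bar>})"
      by (rule finite_measure_mono) (intro sets.finite_UN meas finite_atMost)
    also have "\<dots> \<le> (\<Sum>k\<le>K. prob {\<omega> \<in> space M. \<delta> < \<bar>X k N \<omega> - arcsine_moment k\<bar>})"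
      by (rule measure_UNION_le) (auto simp: meas)
    finally show ?thesis .
  qed
  have lim: "(\<lambda>N. \<Sum>k\<le>K. prob {\<omega> \<in> space M. \<delta> < \<bar>X k N \<omega> - arcsine_moment k\<bar>}) \<longlonglongrightarrow> 0"
  proof (rule tendsto_null_sum)
    fix k
    show "(\<lambda>N. prob {\<omega> \<in> space M. \<delta> < \<bar>X k N \<omega> - arcsine_moment k\<bar>}) \<longlonglongrightarrow> 0"
      using X[of k] \<delta> by (simp add: converges_in_prob_def)
  qed
  show "(\<lambda>N. prob {\<omega> \<in> space M. \<epsilon> < \<bar>sup_distance N \<omega> - 0\<bar>}) \<longlonglongrightarrow> 0"
  proof (rule tendsto_sandwich[OF _ _ tendsto_const lim])
    show "\<forall>\<^sub>F N in sequentially. prob {\<omega> \<in> space M. \<epsilon> < \<bar>sup_distance N \<omega> - 0\<bar>}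
        \<le> (\<Sum>k\<le>K. prob {\<omega> \<in> space M. \<delta> < \<bar>X k N \<omega> - arcsine_moment k\<bar>})"
      by (rule eventually_sequentiallyI[of 1], rule bound)
  qed simp
qed

end

theorem theorem1:
  fixes M :: "'a measure" and Z :: "nat \<Rightarrow> nat \<Rightarrow> 'a \<Rightarrow> real"
  assumes "prob_space M"
    and "prob_space.indep_vars M (\<lambda>_. borel) (\<lambda>(i, j). Z i j) UNIV"
    and "\<And>i j. distr M borel (Z i j) = distr M borel (Z 0 0)"
    and "\<And>k::nat. k \<ge> 1 \<Longrightarrow> integrable M (\<lambda>\<omega>. \<bar>Z 0 0 \<omega>\<bar> ^ k)"
    and "integral\<^sup>L M (Z 0 0) = 0"
    and "integral\<^sup>L M (\<lambda>\<omega>. (Z 0 0 \<omega>)\<^sup>2) = 1"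
  shows "tendsto_in_probability M
           (\<lambda>N \<omega>. SUP x. \<bar>1 / sqrt (real N) * wigner_diagram Z N \<omega> (x * sqrt (real N)) - Omega_curve x\<bar>)
           0"
proof -
  interpret wigner_family M Z
    by (intro wigner_family.intro wigner_family_axioms.intro assms)
  show ?thesis
    using sup_distance_tendsto_in_probability by (simp add: sup_distance_def[abs_def])
qed

end
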